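(* Let $(C(X),G,\alpha)$ be the Boava–Exel partial dynamical system (described in the context) of the ring $R=\mathbb{Z}$, with $G=\mathbb{Q}\rtimes\mathbb{Q}^\times$, and let $H=\mathbb{Q}\rtimes\mathbb{Q}^\times_+$, a subgroup of $G$. Then every nonempty compact and open subset of $X$ is $(H,\tau_X)$-paradoxical. In particular the $C^*$-algebra $C(X)\rtimes_{\alpha,r}H$ (which is isomorphic to $\mathcal{O}_{\mathbb{N}}$) is purely infinite.
   Context: Write $\mathbb{Q}^\times=\mathbb{Q}\setminus\{0\}$ and $\mathbb{Q}^\times_+=\{w\in\mathbb{Q}:w>0\}$. $G=\mathbb{Q}\rtimes\mathbb{Q}^\times=\{(u,w):u\in\mathbb{Q},w\in\mathbb{Q}^\times\}$ (discrete) has operations $(u,w)(u',w')=(u+u'w,ww')$ and $(u,w)^{-1}=(-u/w,1/w)$. For $w,w'\in\mathbb{Q}^\times$ write $w\leq w'$ if $w'=wr$ for some $r\in\mathbb{Z}$, and let $(w)=w\mathbb{Z}\subseteq\mathbb{Q}$. $X$ is the compact space of all families $(u_w+(w))_{w\in\mathbb{Q}^\times}\in\prod_{w\in\mathbb{Q}^\times}(\mathbb{Z}+(w))/(w)$ with $u_{w'}+(w)=u_w+(w)$ whenever $w\leq w'$ in this sense, with the relative product topology (each $(\mathbb{Z}+(w))/(w)$ being discrete). The partial action $\theta$ of $G$ on $X$ is given by the open sets $X_{(u,w)}=\{(u_{w'}+(w'))_{w'}\in X:u_w+(w)=u+(w)\}$ and the homeomorphisms $\theta_{(u,w)}:X_{(u,w)^{-1}}\to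 X_{(u,w)}$, $\theta_{(u,w)}\big((u_{w'}+(w'))_{w'}\big)=(u+wu_{w^{-1}w'}+(w'))_{w'}$. It induces the partial action $\alpha$ on $\mathcal{A}=C(X)$ with ideals $\mathcal{D}_t=C_0(X_t)$ and $\alpha_t(f)=f\circ\theta_{t^{-1}}$ for $f\in C_0(X_{t^{-1}})$. The group $H$ acts partially by restriction. Reduced crossed product $\mathcal{A}\rtimes_{\alpha,r}H$: let $\mathcal{L}$ be the $^*$-algebra of finite formal sums $\sum_{t\in H}a_t\delta_t$, $a_t\in\mathcal{D}_t$, with $(a_t\delta_t)(a_s\delta_s)=\alpha_t(\alpha_{t^{-1}}(a_t)a_s)\delta_{ts}$ and $(a_t\delta_t)^*=\alpha_{t^{-1}}(a_t^* )\delta_{t^{-1}}$. Let $E(\sum a_t\delta_t)=a_e$, and let $\ell_2$ be the right Hilbert $\mathcal{A}$-module obtained by completing $\mathcal{L}$ for the inner product $\langle x,y\rangle=E(x^*y)$. Left multiplication represents $\mathcal{L}$ faithfully by adjointable operators on $\ell_2$, and $\mathcal{A}\rtimes_{\alpha,r}H$ is the norm closure of $\mathcal{L}$ in the adjointable operators. Paradoxicality: $\tau_X$ denotes the topology of $X$. A nonempty set $V\subseteq X$ is $(H,\tau_X)$-paradoxical if there exist $n,m\geq1$, open sets $V_1,\dots,V_{n+m}\in\tau_X$ and $t_1,\dots,t_{n+m}\in H$ such that $\bigcup_{i=1}^nV_i=\bigcup_{i=n+1}^{n+m}V_i=V$, $V_i\subseteq X_{t_i^{-1}}$ and $\theta_{t_i}(V_i)\subseteq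 V$ for all $i$, and $\theta_{t_k}(V_k)\cap\theta_{t_l}(V_l)=\emptyset$ for $k\neq l$. For positive matrices $a\in M_n(\mathcal{B})$, $b\in M_m(\mathcal{B})$ over a $C^*$-algebra $\mathcal{B}$, write $a\precsim b$ if $r_k^*br_k\to a$ for some sequence $(r_k)$ in $M_{m,n}(\mathcal{B})$. $\mathcal{B}$ is purely infinite if there are no characters on $\mathcal{B}$ and for all positive $a,b\in\mathcal{B}$ with $b$ in the (closed two-sided) ideal generated by $a$ one has $b\precsim a$; equivalently, every nonzero positive $a\in\mathcal{B}$ satisfies $\mathrm{diag}(a,a)\precsim a$. The algebra denoted $\mathcal{O}_{\mathbb{N}}$ is not defined separately here; the identification with $C(X)\rtimes_{\alpha,r}H$ is only for orientation and the assertion concerns $C(X)\rtimes_{\alpha,r}H$. *)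

theory Defs
  imports "HOL-Analysis.Analysis" "HOL-Algebra.Group"
begin

section \<open>Complex *-algebras with a norm, and pure infiniteness\<close>

record 'b star_alg =
  acarrier :: "'b set"
  aplus :: "'b \<Rightarrow> 'b \<Rightarrow> 'b"
  atimes :: "'b \<Rightarrow> 'b \<Rightarrow> 'b"
  ascale :: "complex \<Rightarrow> 'b \<Rightarrow> 'b"
  astar :: "'b \<Rightarrow> 'b"
  anorm :: "'b \<Rightarrow> real"

definition adist :: "'b star_alg \<Rightarrow> 'b \<Rightarrow> 'b \<Rightarrow> real" where
  "adist B a b = anorm B (aplus B a (ascale B (-1) b))"

definition alg_character :: "'b star_alg \<Rightarrow> ('b \<Rightarrow> complex) \<Rightarrow> bool" where
  "alg_character B h \<longleftrightarrow>
     (\<forall>a\<in>acarrier B. \<forall>b\<in>acarrier B. h (aplus B a b) = h a + h b) \<and>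
     (\<forall>a\<in>acarrier B. \<forall>b\<in>acarrier B. h (atimes B a b) = h a * h b) \<and>
     (\<forall>c. \<forall>a\<in>acarrier B. h (ascale B c a) = c * h a) \<and>
     (\<exists>a\<in>acarrier B. h a \<noteq> 0)"

definition alg_positive :: "'b star_alg \<Rightarrow> 'b \<Rightarrow> bool" where
  "alg_positive B a \<longleftrightarrow> (\<exists>c\<in>acarrier B. a = atimes B (astar B c) c)"

definition closed_ideal :: "'b star_alg \<Rightarrow> 'b set \<Rightarrow> bool" where
  "closed_ideal B J \<longleftrightarrow> J \<subseteq> acarrier B \<and> J \<noteq> {} \<and>
     (\<forall>a\<in>J. \<forall>b\<in>J. aplus B a b \<in> J) \<and>
     (\<forall>c. \<forall>a\<in>J. ascale B c a \<in> J) \<and>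
     (\<forall>a\<in>J. \<forall>b\<in>acarrier B. atimes B a b \<in> J \<and> atimes B b a \<in> J) \<and>
     (\<forall>a\<in>acarrier B. (\<forall>\<epsilon>>0. \<exists>b\<in>J. adist B a b < \<epsilon>) \<longrightarrow> a \<in> J)"

definition generated_closed_ideal :: "'b star_alg \<Rightarrow> 'b \<Rightarrow> 'b set" where
  "generated_closed_ideal B a = \<Inter>{J. closed_ideal B J \<and> a \<in> J}"

text \<open>Cuntz comparison \<open>a \<precsim> b\<close> of positive elements of \<open>B\<close> itself, i.e. of \<open>1 \<times> 1\<close> matrices;
  pure infiniteness as defined below compares no larger matrices.\<close>

definition cuntz_below :: "'b star_alg \<Rightarrow> 'b \<Rightarrow> 'b \<Rightarrow> bool" where
  "cuntz_below B a b \<longleftrightarrow>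
     (\<exists>r :: nat \<Rightarrow> 'b. (\<forall>k. r k \<in> acarrier B) \<and>
        (\<lambda>k. adist B (atimes B (atimes B (astar B (r k)) b) (r k)) a) \<longlonglongrightarrow> 0)"

definition purely_infinite :: "'b star_alg \<Rightarrow> bool" where
  "purely_infinite B \<longleftrightarrow> (\<nexists>h. alg_character B h) \<and>
     (\<forall>a b. alg_positive B a \<longrightarrow> alg_positive B b \<longrightarrow>
        b \<in> generated_closed_ideal B a \<longrightarrow> cuntz_below B b a)"

section \<open>Partial actions on spaces and their reduced crossed products\<close>

text \<open>\<open>\<theta> t\<close> is only meaningful on \<open>D (inv t)\<close>, which it maps homeomorphically onto \<open>D t\<close>.\<close>

locale partial_action = group G for G (structure) +
  fixes X :: "'x topology" and D :: "'a \<Rightarrow> 'x set" and \<theta> :: "'a \<Rightarrow> 'x \<Rightarrow> 'x"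
  assumes open_dom: "t \<in> carrier G \<Longrightarrow> openin X (D t)"
    and dom_one: "D \<one> = topspace X"
    and act_one: "x \<in> topspace X \<Longrightarrow> \<theta> \<one> x = x"
    and homeo: "t \<in> carrier G \<Longrightarrow>
      homeomorphic_maps (subtopology X (D (inv t))) (subtopology X (D t)) (\<theta> t) (\<theta> (inv t))"
    and act_mult: "\<lbrakk>s \<in> carrier G; t \<in> carrier G; x \<in> D (inv t); \<theta> t x \<in> D (inv s)\<rbrakk> \<Longrightarrow>
      x \<in> D (inv (s \<otimes> t)) \<and> \<theta> (s \<otimes> t) x = \<theta> s (\<theta> t x)"
begin

definition paradoxical :: "'x set \<Rightarrow> bool" where
  "paradoxical S \<longleftrightarrow> S \<noteq> {} \<and> S \<subseteq> topspace X \<and>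
     (\<exists>(n::nat) (m::nat) (V :: nat \<Rightarrow> 'x set) (t :: nat \<Rightarrow> 'a). n \<ge> 1 \<and> m \<ge> 1 \<and>
        (\<forall>i\<in>{1..n+m}. openin X (V i) \<and> t i \<in> carrier G) \<and>
        (\<Union>i\<in>{1..n}. V i) = S \<and> (\<Union>i\<in>{n+1..n+m}. V i) = S \<and>
        (\<forall>i\<in>{1..n+m}. V i \<subseteq> D (inv (t i)) \<and> \<theta> (t i) ` V i \<subseteq> S) \<and>
        (\<forall>k\<in>{1..n+m}. \<forall>l\<in>{1..n+m}. k \<noteq> l \<longrightarrow> \<theta> (t k) ` V k \<inter> \<theta> (t l) ` V l = {}))"

text \<open>Functions on \<open>X\<close> are extended by \<open>0\<close> to the whole type. \<open>C0 U\<close> is \<open>C\<^sub>0(U)\<close> regarded,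
  via extension by \<open>0\<close>, as an ideal of \<open>C0 (topspace X)\<close>; the latter is \<open>C(X)\<close> if \<open>X\<close> is compact.\<close>

definition C0 :: "'x set \<Rightarrow> ('x \<Rightarrow> complex) set" where
  "C0 U = {f. continuous_map X euclidean f \<and> (\<forall>x. x \<notin> U \<longrightarrow> f x = 0) \<and>
              (\<forall>\<epsilon>>0. compactin X {x \<in> U. \<epsilon> \<le> cmod (f x)})}"

definition supnorm :: "('x \<Rightarrow> complex) \<Rightarrow> real" where
  "supnorm f = (SUP x. cmod (f x))"

definition \<alpha> :: "'a \<Rightarrow> ('x \<Rightarrow> complex) \<Rightarrow> 'x \<Rightarrow> complex" where
  "\<alpha> t f = (\<lambda>x. if x \<in> D t then f (\<theta> (inv t) x) else 0)"

text \<open>The finite formal sums \<open>\<Sum>\<^sub>t a\<^sub>t \<delta>\<^sub>t\<close>, represented by their coefficient functions.\<close>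

definition Lalg :: "('a \<Rightarrow> 'x \<Rightarrow> complex) set" where
  "Lalg = {a. (\<forall>t\<in>carrier G. a t \<in> C0 (D t)) \<and>
              (\<forall>t. t \<notin> carrier G \<longrightarrow> a t = (\<lambda>_. 0)) \<and>
              finite {t. a t \<noteq> (\<lambda>_. 0)}}"

definition L_times ::
    "('a \<Rightarrow> 'x \<Rightarrow> complex) \<Rightarrow> ('a \<Rightarrow> 'x \<Rightarrow> complex) \<Rightarrow> 'a \<Rightarrow> 'x \<Rightarrow> complex" where
  "L_times a b = (\<lambda>r x. \<Sum>(t, s) \<in> {(t, s). a t \<noteq> (\<lambda>_. 0) \<and> b s \<noteq> (\<lambda>_. 0) \<and> t \<otimes> s = r}.
                     \<alpha> t (\<lambda>y. \<alpha> (inv t) (a t) y * b s y) x)"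

definition L_star :: "('a \<Rightarrow> 'x \<Rightarrow> complex) \<Rightarrow> 'a \<Rightarrow> 'x \<Rightarrow> complex" where
  "L_star a = (\<lambda>t. if t \<in> carrier G then \<alpha> t (\<lambda>y. cnj (a (inv t) y)) else (\<lambda>_. 0))"

definition E :: "('a \<Rightarrow> 'x \<Rightarrow> complex) \<Rightarrow> 'x \<Rightarrow> complex" where
  "E a = a \<one>"

definition L_inner ::
    "('a \<Rightarrow> 'x \<Rightarrow> complex) \<Rightarrow> ('a \<Rightarrow> 'x \<Rightarrow> complex) \<Rightarrow> 'x \<Rightarrow> complex" where
  "L_inner a b = E (L_times (L_star a) b)"

definition L_dist :: "('a \<Rightarrow> 'x \<Rightarrow> complex) \<Rightarrow> ('a \<Rightarrow> 'x \<Rightarrow> complex) \<Rightarrow> real" where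
  "L_dist a b = (let d = (\<lambda>t x. a t x - b t x) in sqrt (supnorm (L_inner d d)))"

text \<open>The completion \<open>\<ell>\<^sub>2\<close> of \<open>Lalg\<close>: Cauchy sequences modulo null sequences. All operations
  below extend by continuity and are independent of the representatives chosen by \<open>rep\<close>.\<close>

definition L_Cauchy :: "(nat \<Rightarrow> 'a \<Rightarrow> 'x \<Rightarrow> complex) set" where
  "L_Cauchy = {p. (\<forall>n. p n \<in> Lalg) \<and>
                  (\<forall>\<epsilon>>0. \<exists>N. \<forall>m\<ge>N. \<forall>n\<ge>N. L_dist (p m) (p n) < \<epsilon>)}"

definition L_equiv ::
    "((nat \<Rightarrow> 'a \<Rightarrow> 'x \<Rightarrow> complex) \<times> (nat \<Rightarrow> 'a \<Rightarrow> 'x \<Rightarrow> complex)) set" where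
  "L_equiv = {(p, q). p \<in> L_Cauchy \<and> q \<in> L_Cauchy \<and> (\<lambda>n. L_dist (p n) (q n)) \<longlonglongrightarrow> 0}"

definition ell2 :: "(nat \<Rightarrow> 'a \<Rightarrow> 'x \<Rightarrow> complex) set set" where
  "ell2 = L_Cauchy // L_equiv"

definition cls :: "(nat \<Rightarrow> 'a \<Rightarrow> 'x \<Rightarrow> complex) \<Rightarrow> (nat \<Rightarrow> 'a \<Rightarrow> 'x \<Rightarrow> complex) set" where
  "cls p = L_equiv `` {p}"

definition rep :: "(nat \<Rightarrow> 'a \<Rightarrow> 'x \<Rightarrow> complex) set \<Rightarrow> nat \<Rightarrow> 'a \<Rightarrow> 'x \<Rightarrow> complex" where
  "rep \<xi> = (SOME p. p \<in> \<xi>)"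

definition ell2_plus where
  "ell2_plus \<xi> \<eta> = cls (\<lambda>n t x. rep \<xi> n t x + rep \<eta> n t x)"

definition ell2_scale where
  "ell2_scale c \<xi> = cls (\<lambda>n t x. c * rep \<xi> n t x)"

text \<open>The limit exists even uniformly in \<open>x\<close>.\<close>

definition ell2_inner ::
    "(nat \<Rightarrow> 'a \<Rightarrow> 'x \<Rightarrow> complex) set \<Rightarrow> (nat \<Rightarrow> 'a \<Rightarrow> 'x \<Rightarrow> complex) set \<Rightarrow> 'x \<Rightarrow> complex" where
  "ell2_inner \<xi> \<eta> = (\<lambda>x. lim (\<lambda>n. L_inner (rep \<xi> n) (rep \<eta> n) x))"

definition ell2_norm :: "(nat \<Rightarrow> 'a \<Rightarrow> 'x \<Rightarrow> complex) set \<Rightarrow> real" where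
  "ell2_norm \<xi> = sqrt (supnorm (ell2_inner \<xi> \<xi>))"

text \<open>Operators on \<open>\<ell>\<^sub>2\<close> are extensional functions. Linearity, \<open>C(X)\<close>-linearity and boundedness
  are not required: they are consequences of adjointability.\<close>

definition is_adjoint where
  "is_adjoint T S \<longleftrightarrow> T \<in> ell2 \<rightarrow>\<^sub>E ell2 \<and> S \<in> ell2 \<rightarrow>\<^sub>E ell2 \<and>
     (\<forall>\<xi>\<in>ell2. \<forall>\<eta>\<in>ell2. ell2_inner (T \<xi>) \<eta> = ell2_inner \<xi> (S \<eta>))"

text \<open>The \<open>*\<close>-algebra of adjointable operators on \<open>\<ell>\<^sub>2\<close>, with the operator norm.\<close>

definition adjointable_ops ::
    "((nat \<Rightarrow> 'a \<Rightarrow> 'x \<Rightarrow> complex) set \<Rightarrow> (nat \<Rightarrow> 'a \<Rightarrow> 'x \<Rightarrow> complex) set) star_alg" where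
  "adjointable_ops =
     \<lparr>acarrier = {T. \<exists>S. is_adjoint T S},
      aplus = (\<lambda>T S. \<lambda>\<xi>\<in>ell2. ell2_plus (T \<xi>) (S \<xi>)),
      atimes = compose ell2,
      ascale = (\<lambda>c T. \<lambda>\<xi>\<in>ell2. ell2_scale c (T \<xi>)),
      astar = (\<lambda>T. THE S. is_adjoint T S),
      anorm = (\<lambda>T. Sup {ell2_norm (T \<xi>) |\<xi>. \<xi> \<in> ell2 \<and> ell2_norm \<xi> \<le> 1})\<rparr>"

definition left_mult :: "('a \<Rightarrow> 'x \<Rightarrow> complex) \<Rightarrow>
    (nat \<Rightarrow> 'a \<Rightarrow> 'x \<Rightarrow> complex) set \<Rightarrow> (nat \<Rightarrow> 'a \<Rightarrow> 'x \<Rightarrow> complex) set" where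
  "left_mult a = (\<lambda>\<xi>\<in>ell2. cls (\<lambda>n. L_times a (rep \<xi> n)))"

definition reduced_crossed_product ::
    "((nat \<Rightarrow> 'a \<Rightarrow> 'x \<Rightarrow> complex) set \<Rightarrow> (nat \<Rightarrow> 'a \<Rightarrow> 'x \<Rightarrow> complex) set) star_alg" where
  "reduced_crossed_product = adjointable_ops
     \<lparr>acarrier := {T \<in> acarrier adjointable_ops.
                    \<forall>\<epsilon>>0. \<exists>a\<in>Lalg. adist adjointable_ops T (left_mult a) < \<epsilon>}\<rparr>"

lemma restrict_subgroup:
  assumes "subgroup H G"
  shows "partial_action (G\<lparr>carrier := H\<rparr>) X D \<theta>"
proof -
  have sub: "t \<in> carrier G" if "t \<in> H" for t
    using assms that by (rule subgroup.mem_carrier)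
  have inv: "inv\<^bsub>G\<lparr>carrier := H\<rparr>\<^esub> t = inv t" if "t \<in> H" for t
    using m_inv_consistent[OF assms that] .
  have mult: "s \<otimes> t \<in> H" if "s \<in> H" "t \<in> H" for s t
    using assms that by (rule subgroup.m_closed)
  interpret H: group "G\<lparr>carrier := H\<rparr>"
    using assms by (rule subgroup_imp_group)
  show ?thesis
    by unfold_locales (auto simp: inv sub mult open_dom dom_one act_one homeo dest: act_mult[OF sub sub])
qed

end

section \<open>The Boava--Exel partial action of the ring of integers\<close>

definition BE_G :: "(rat \<times> rat) monoid" where
  "BE_G = \<lparr>carrier = {(u, w). w \<noteq> 0},
           mult = (\<lambda>(u, w) (u', w'). (u + u' * w, w * w')),
           one = (0, 1)\<rparr>"

definition BE_H :: "(rat \<times> rat) set" where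
  "BE_H = {(u, w). w > 0}"

definition rat_dvd :: "rat \<Rightarrow> rat \<Rightarrow> bool" where
  "rat_dvd w w' \<longleftrightarrow> (\<exists>r::int. w' = w * of_int r)"

definition pideal :: "rat \<Rightarrow> rat set" where
  "pideal w = range (\<lambda>k::int. w * of_int k)"

definition pcoset :: "rat \<Rightarrow> rat \<Rightarrow> rat set" where
  "pcoset u w = (\<lambda>z. u + z) ` pideal w"

definition int_plus_pideal :: "rat \<Rightarrow> rat set" where
  "int_plus_pideal w = {of_int k + z |k z. z \<in> pideal w}"

definition BE_points :: "(rat \<Rightarrow> rat set) set" where
  "BE_points = {(\<lambda>w\<in>{w. w \<noteq> 0}. pcoset (u w) w) |u.
      (\<forall>w. w \<noteq> 0 \<longrightarrow> u w \<in> int_plus_pideal w) \<and>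
      (\<forall>w w'. w \<noteq> 0 \<longrightarrow> w' \<noteq> 0 \<longrightarrow> rat_dvd w w' \<longrightarrow> pcoset (u w') w = pcoset (u w) w)}"

definition BE_X :: "(rat \<Rightarrow> rat set) topology" where
  "BE_X = subtopology
     (product_topology (\<lambda>w. discrete_topology ((\<lambda>u. pcoset u w) ` int_plus_pideal w)) {w. w \<noteq> 0})
     BE_points"

definition BE_D :: "rat \<times> rat \<Rightarrow> (rat \<Rightarrow> rat set) set" where
  "BE_D = (\<lambda>(u, w). {x \<in> BE_points. x w = pcoset u w})"

text \<open>\<open>q \<mapsto> u + w q\<close> maps the coset \<open>v + (w\<inverse>w')\<close> onto \<open>(u + w v) + (w')\<close>.\<close>

definition BE_\<theta> :: "rat \<times> rat \<Rightarrow> (rat \<Rightarrow> rat set) \<Rightarrow> rat \<Rightarrow> rat set" where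
  "BE_\<theta> = (\<lambda>(u, w) x. \<lambda>w'\<in>{w'. w' \<noteq> 0}. (\<lambda>q. u + w * q) ` x (inverse w * w'))"

lemma BE_G_simps [simp]:
  "(u, w) \<in> carrier BE_G \<longleftrightarrow> w \<noteq> 0"
  "(u, w) \<otimes>\<^bsub>BE_G\<^esub> (u', w') = (u + u' * w, w * w')"
  "\<one>\<^bsub>BE_G\<^esub> = (0, 1)"
  by (simp_all add: BE_G_def)

lemma group_BE_G: "group BE_G"
proof (rule groupI)
  fix x assume "x \<in> carrier BE_G"
  then obtain u w where x: "x = (u, w)" "w \<noteq> 0" by (cases x) auto
  then have "(- u / w, 1 / w) \<in> carrier BE_G \<and> (- u / w, 1 / w) \<otimes>\<^bsub>BE_G\<^esub> x = \<one>\<^bsub>BE_G\<^esub>"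
    by simp
  then show "\<exists>y\<in>carrier BE_G. y \<otimes>\<^bsub>BE_G\<^esub> x = \<one>\<^bsub>BE_G\<^esub>" by blast
qed (auto simp: BE_G_def algebra_simps split: prod.splits)

lemma inv_BE_G: "w \<noteq> 0 \<Longrightarrow> inv\<^bsub>BE_G\<^esub> (u, w) = (- u / w, 1 / w)"
  by (rule group.inv_equality[OF group_BE_G]) auto

lemma subgroup_BE_H: "subgroup BE_H BE_G"
proof (rule group.subgroupI[OF group_BE_G])
  fix a assume "a \<in> BE_H"
  then show "inv\<^bsub>BE_G\<^esub> a \<in> BE_H" by (auto simp: BE_H_def inv_BE_G)
next
  show "BE_H \<noteq> {}" unfolding BE_H_def by (auto intro: exI[of _ "1::rat"])
qed (auto simp: BE_H_def)

lemma pideal_iff: "z \<in> pideal w \<longleftrightarrow> (\<exists>k::int. z = w * of_int k)"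
  by (auto simp: pideal_def)

lemma pideal_add: "\<lbrakk>y \<in> pideal w; z \<in> pideal w\<rbrakk> \<Longrightarrow> y + z \<in> pideal w"
  unfolding pideal_iff by (metis distrib_left of_int_add)

lemma pideal_minus: "z \<in> pideal w \<Longrightarrow> - z \<in> pideal w"
  unfolding pideal_iff by (metis mult_minus_right of_int_minus)

lemma pideal_zero: "0 \<in> pideal w"
  unfolding pideal_iff by (metis mult_zero_right of_int_0)

lemma pideal_cmult: "z \<in> pideal w \<Longrightarrow> c * z \<in> pideal (c * w)"
  unfolding pideal_iff by (metis mult.assoc)

lemma pideal_cmult_iff: "c \<noteq> 0 \<Longrightarrow> c * z \<in> pideal (c * w) \<longleftrightarrow> z \<in> pideal w"
  unfolding pideal_iff by (metis mult.assoc mult_left_cancel)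

lemma int_plus_pideal_one: "u \<in> int_plus_pideal 1 \<Longrightarrow> u \<in> pideal 1"
  unfolding int_plus_pideal_def pideal_iff by clarsimp (metis of_int_add)

lemma pcoset_iff: "q \<in> pcoset u w \<longleftrightarrow> q - u \<in> pideal w"
proof
  assume "q - u \<in> pideal w"
  then have "u + (q - u) \<in> pcoset u w" unfolding pcoset_def by (rule imageI)
  then show "q \<in> pcoset u w" by simp
qed (auto simp: pcoset_def)

lemma pcoset_eq_iff: "pcoset u w = pcoset v w \<longleftrightarrow> u - v \<in> pideal w"
proof
  assume "pcoset u w = pcoset v w"
  then have "u \<in> pcoset v w" using pcoset_iff[of u u w] pideal_zero by simp
  then show "u - v \<in> pideal w" by (simp add: pcoset_iff)
next
  assume uv: "u - v \<in> pideal w"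
  have "q - u \<in> pideal w \<longleftrightarrow> q - v \<in> pideal w" for q
    using pideal_add[OF uv, of "q - u"] pideal_add[OF pideal_minus[OF uv], of "q - v"] by auto
  then show "pcoset u w = pcoset v w" by (auto simp: pcoset_iff)
qed

lemma affine_pcoset:
  assumes "w \<noteq> 0"
  shows "(\<lambda>q. u + w * q) ` pcoset v (inverse w * w') = pcoset (u + w * v) w'"
proof -
  have *: "w * (inverse w * w') = w'" using assms by simp
  have "w * z \<in> pideal w' \<longleftrightarrow> z \<in> pideal (inverse w * w')" for z
    using pideal_cmult_iff[OF assms, of z "inverse w * w'"] by (simp only: *)
  then have iff: "u + w * q \<in> pcoset (u + w * v) w' \<longleftrightarrow> q \<in> pcoset v (inverse w * w')" for q
    unfolding pcoset_iff by (metis add_diff_cancel_left right_diff_distrib)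
  have eq: "y = u + w * ((y - u) / w)" for y using assms by simp
  show ?thesis
  proof (intro subset_antisym subsetI)
    fix y assume "y \<in> pcoset (u + w * v) w'"
    then have "(y - u) / w \<in> pcoset v (inverse w * w')" using iff eq[of y] by metis
    then show "y \<in> (\<lambda>q. u + w * q) ` pcoset v (inverse w * w')" using eq by (rule rev_image_eqI)
  qed (auto simp: iff)
qed

lemma rat_common_multiple:
  fixes p q :: rat
  assumes "p \<noteq> 0" "q \<noteq> 0"
  obtains r where "r \<noteq> 0" "rat_dvd p r" "rat_dvd q r"
proof -
  obtain a b where p: "p = of_int a / of_int b" "b > 0"
    by (metis quotient_of_div quotient_of_denom_pos surj_pair)
  obtain c d where q: "q = of_int c / of_int d" "d > 0"
    by (metis quotient_of_div quotient_of_denom_pos surj_pair)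
  have "rat_dvd p (of_int (a * c))" unfolding rat_dvd_def
    using p by (intro exI[of _ "b * c"]) simp
  moreover have "rat_dvd q (of_int (a * c))" unfolding rat_dvd_def
    using q by (intro exI[of _ "a * d"]) simp
  moreover have "rat_of_int (a * c) \<noteq> 0" using assms p q by auto
  ultimately show ?thesis using that by blast
qed

lemma topspace_BE_X: "topspace BE_X = BE_points"
  unfolding BE_X_def by (auto simp: topspace_subtopology BE_points_def)

lemma BE_\<theta>_coset:
  assumes "w \<noteq> 0"
  shows "BE_\<theta> (a, w) (\<lambda>w\<in>{w. w \<noteq> 0}. pcoset (u w) w) =
    (\<lambda>w'\<in>{w'. w' \<noteq> 0}. pcoset (a + w * u (inverse w * w')) w')"
  using assms by (auto simp: BE_\<theta>_def fun_eq_iff affine_pcoset restrict_def)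

lemma BE_\<theta>_closed:
  assumes w: "w \<noteq> 0" and x: "x \<in> BE_D (inv\<^bsub>BE_G\<^esub> (a, w))"
  shows "BE_\<theta> (a, w) x \<in> BE_D (a, w)"
proof -
  from x w obtain u where x_eq: "x = (\<lambda>w\<in>{w. w \<noteq> 0}. pcoset (u w) w)"
    and u_mem: "\<And>w. w \<noteq> 0 \<Longrightarrow> u w \<in> int_plus_pideal w"
    and u_comp: "\<And>w w'. w \<noteq> 0 \<Longrightarrow> w' \<noteq> 0 \<Longrightarrow> rat_dvd w w' \<Longrightarrow> pcoset (u w') w = pcoset (u w) w"
    and "x (1 / w) = pcoset (- a / w) (1 / w)"
    by (auto simp: inv_BE_G BE_D_def BE_points_def)
  then have start: "u (1 / w) + a / w \<in> pideal (1 / w)"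
    using w by (simp add: pcoset_eq_iff)
  define v where "v = (\<lambda>w'. a + w * u (inverse w * w'))"
  have v_eq: "BE_\<theta> (a, w) x = (\<lambda>w'\<in>{w'. w' \<noteq> 0}. pcoset (v w') w')"
    unfolding x_eq v_def by (rule BE_\<theta>_coset[OF w])
  have "v w' \<in> int_plus_pideal w'" if w': "w' \<noteq> 0" for w'
  proof -
    have nz: "inverse w * w' \<noteq> 0" "1 / w \<noteq> 0" using w w' by auto
    obtain r where r: "r \<noteq> 0" "rat_dvd (inverse w * w') r" "rat_dvd (1 / w) r"
      using rat_common_multiple[OF nz] .
    have 1: "u (inverse w * w') - u r \<in> pideal (inverse w * w')"
      using u_comp[OF nz(1) r(1,2)] by (simp flip: pcoset_eq_iff)
    have "u r - u (1 / w) \<in> pideal (1 / w)"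
      using u_comp[OF nz(2) r(1,3)] by (simp flip: pcoset_eq_iff)
    from pideal_add[OF this start] have "u r + a / w \<in> pideal (1 / w)" by simp
    from pideal_cmult[OF this, of w] have "w * u r + a \<in> pideal 1"
      using w by (simp add: distrib_left)
    then obtain k :: int where k: "w * u r + a = of_int k" by (auto simp: pideal_iff)
    have "w * (u (inverse w * w') - u r) \<in> pideal w'"
      using pideal_cmult[OF 1, of w] by (simp only: right_inverse[OF w] mult.assoc[symmetric] mult_1)
    moreover have "v w' = of_int k + w * (u (inverse w * w') - u r)"
      unfolding v_def k[symmetric] by (simp add: algebra_simps)
    ultimately show ?thesis unfolding int_plus_pideal_def by blast
  qed
  moreover have "pcoset (v w'') w' = pcoset (v w') w'"
    if "w' \<noteq> 0" "w'' \<noteq> 0" "rat_dvd w' w''" for w' w''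
  proof -
    have "rat_dvd (inverse w * w') (inverse w * w'')"
      using that(3) by (auto simp: rat_dvd_def)
    then have "u (inverse w * w'') - u (inverse w * w') \<in> pideal (inverse w * w')"
      using that w u_comp by (simp flip: pcoset_eq_iff)
    from pideal_cmult[OF this, of w]
    have "w * (u (inverse w * w'') - u (inverse w * w')) \<in> pideal w'"
      by (simp only: right_inverse[OF w] mult.assoc[symmetric] mult_1)
    then show ?thesis by (simp add: pcoset_eq_iff v_def right_diff_distrib)
  qed
  ultimately have "BE_\<theta> (a, w) x \<in> BE_points"
    unfolding v_eq BE_points_def by blast
  moreover have "pcoset (v w) w = pcoset a w"
  proof -
    have "u 1 \<in> pideal 1"
      using u_mem[of 1] by (simp add: int_plus_pideal_one)
    from pideal_cmult[OF this, of w] show ?thesis using w by (simp add: pcoset_eq_iff v_def)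
  qed
  then have "BE_\<theta> (a, w) x w = pcoset a w" unfolding v_eq using w by simp
  ultimately show ?thesis by (simp add: BE_D_def)
qed

lemma BE_\<theta>_mult:
  assumes "w \<noteq> 0" "w' \<noteq> 0"
  shows "BE_\<theta> (a, w) (BE_\<theta> (b, w') x) = BE_\<theta> (a + b * w, w * w') x"
  using assms by (auto simp: BE_\<theta>_def fun_eq_iff image_image algebra_simps)

lemma BE_\<theta>_one: "x \<in> BE_points \<Longrightarrow> BE_\<theta> (0, 1) x = x"
  by (auto simp: BE_\<theta>_def BE_points_def fun_eq_iff)

lemma BE_D_subset: "BE_D t \<subseteq> BE_points"
  by (auto simp: BE_D_def)

lemma BE_\<theta>_inv:
  assumes "w \<noteq> 0" "x \<in> BE_points"
  shows "BE_\<theta> (inv\<^bsub>BE_G\<^esub> (a, w)) (BE_\<theta> (a, w) x) = x"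
    and "BE_\<theta> (a, w) (BE_\<theta> (inv\<^bsub>BE_G\<^esub> (a, w)) x) = x"
  using assms by (simp_all add: inv_BE_G BE_\<theta>_mult BE_\<theta>_one)

lemma BE_continuous_proj:
  assumes "w \<noteq> 0"
  shows "continuous_map BE_X (discrete_topology ((\<lambda>u. pcoset u w) ` int_plus_pideal w)) (\<lambda>x. x w)"
  unfolding BE_X_def using assms
  by (intro continuous_map_from_subtopology continuous_map_product_projection) simp

lemma openin_BE_D:
  assumes "w \<noteq> 0"
  shows "openin BE_X (BE_D (a, w))"
proof -
  let ?Y = "(\<lambda>u. pcoset u w) ` int_plus_pideal w"
  have "openin BE_X {x \<in> topspace BE_X. x w \<in> {pcoset a w} \<inter> ?Y}"
    by (rule openin_continuous_map_preimage[OF BE_continuous_proj[OF assms]]) auto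
  moreover have "{x \<in> topspace BE_X. x w \<in> {pcoset a w} \<inter> ?Y} = BE_D (a, w)"
    using assms by (auto simp: topspace_BE_X BE_D_def BE_points_def)
  ultimately show ?thesis by simp
qed

lemma BE_\<theta>_continuous:
  assumes w: "w \<noteq> 0"
  shows "continuous_map (subtopology BE_X (BE_D (inv\<^bsub>BE_G\<^esub> (a, w))))
           (subtopology BE_X (BE_D (a, w))) (BE_\<theta> (a, w))"
proof -
  let ?S = "subtopology BE_X (BE_D (inv\<^bsub>BE_G\<^esub> (a, w)))"
  let ?Y = "\<lambda>w. (\<lambda>u. pcoset u w) ` int_plus_pideal w"
  have top: "topspace ?S = BE_D (inv\<^bsub>BE_G\<^esub> (a, w))"
    using BE_D_subset[of "inv\<^bsub>BE_G\<^esub> (a, w)"]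
    by (simp add: topspace_subtopology topspace_BE_X Int_absorb1)
  have maps: "BE_\<theta> (a, w) x \<in> BE_D (a, w)" if "x \<in> topspace ?S" for x
    using BE_\<theta>_closed[OF w] that by (simp only: top)
  have "continuous_map ?S (discrete_topology (?Y w')) (\<lambda>x. BE_\<theta> (a, w) x w')"
    if w': "w' \<noteq> 0" for w'
  proof -
    have nz: "inverse w * w' \<noteq> 0" using w w' by simp
    have cont: "continuous_map ?S (discrete_topology (?Y (inverse w * w'))) (\<lambda>x. x (inverse w * w'))"
      using BE_continuous_proj[OF nz] by (rule continuous_map_from_subtopology)
    have im: "BE_\<theta> (a, w) x w' \<in> ?Y w'" if "x \<in> topspace ?S" for x
      using maps[OF that] w' by (auto simp: BE_D_def BE_points_def)
    show ?thesis unfolding continuous_map_def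
    proof (intro conjI allI impI)
      show "(\<lambda>x. BE_\<theta> (a, w) x w') \<in> topspace ?S \<rightarrow> topspace (discrete_topology (?Y w'))"
        using im by simp
      fix U assume "openin (discrete_topology (?Y w')) U"
      have eq: "{x \<in> topspace ?S. BE_\<theta> (a, w) x w' \<in> U} =
        {x \<in> topspace ?S. x (inverse w * w') \<in> {A \<in> ?Y (inverse w * w'). (\<lambda>q. a + w * q) ` A \<in> U}}"
        using w' continuous_map_image_subset_topspace[OF cont] by (auto simp: BE_\<theta>_def)
      show "openin ?S {x \<in> topspace ?S. BE_\<theta> (a, w) x w' \<in> U}"
        unfolding eq by (rule openin_continuous_map_preimage[OF cont]) auto
    qed
  qed
  moreover have "BE_\<theta> (a, w) x \<in> extensional {w. w \<noteq> 0}" for x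
    by (simp add: BE_\<theta>_def)
  ultimately have "continuous_map ?S (product_topology (\<lambda>w. discrete_topology (?Y w)) {w. w \<noteq> 0})
      (BE_\<theta> (a, w))"
    by (auto simp: continuous_map_componentwise)
  then show ?thesis
    unfolding BE_X_def[symmetric]
    using maps BE_D_subset
    by (auto simp: BE_X_def continuous_map_in_subtopology)
qed

theorem partial_action_BE: "partial_action BE_G BE_X BE_D BE_\<theta>"
proof (intro partial_action.intro group_BE_G partial_action_axioms.intro)
  show "openin BE_X (BE_D t)" if "t \<in> carrier BE_G" for t
    using that by (cases t) (auto intro: openin_BE_D)
  show "BE_D \<one>\<^bsub>BE_G\<^esub> = topspace BE_X"
  proof -
    have "x 1 = pcoset 0 1" if x: "x \<in> BE_points" for x
    proof -
      obtain v where "x 1 = pcoset v 1" "v \<in> int_plus_pideal 1"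
        using x by (auto simp: BE_points_def)
      then show ?thesis by (simp add: pcoset_eq_iff int_plus_pideal_one)
    qed
    then show ?thesis by (auto simp: topspace_BE_X BE_D_def)
  qed
  show "BE_\<theta> \<one>\<^bsub>BE_G\<^esub> x = x" if "x \<in> topspace BE_X" for x
    using that by (simp add: topspace_BE_X BE_\<theta>_one)
  show "homeomorphic_maps (subtopology BE_X (BE_D (inv\<^bsub>BE_G\<^esub> t))) (subtopology BE_X (BE_D t))
      (BE_\<theta> t) (BE_\<theta> (inv\<^bsub>BE_G\<^esub> t))" if tG: "t \<in> carrier BE_G" for t
  proof -
    obtain a w where t: "t = (a, w)" "w \<noteq> 0" using tG by (cases t) auto
    have "inv\<^bsub>BE_G\<^esub> (inv\<^bsub>BE_G\<^esub> (a, w)) = (a, w)"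
      using group.inv_inv[OF group_BE_G, of "(a, w)"] t by simp
    then have "continuous_map (subtopology BE_X (BE_D (a, w)))
        (subtopology BE_X (BE_D (inv\<^bsub>BE_G\<^esub> (a, w)))) (BE_\<theta> (inv\<^bsub>BE_G\<^esub> (a, w)))"
      using BE_\<theta>_continuous[of "1 / w" "- a / w"] t by (simp add: inv_BE_G)
    then show ?thesis
      using BE_\<theta>_continuous[OF t(2), of a] BE_\<theta>_inv[OF t(2)]
      by (auto simp: t homeomorphic_maps_def topspace_BE_X)
  qed
  show "x \<in> BE_D (inv\<^bsub>BE_G\<^esub> (s \<otimes>\<^bsub>BE_G\<^esub> t)) \<and> BE_\<theta> (s \<otimes>\<^bsub>BE_G\<^esub> t) x = BE_\<theta> s (BE_\<theta> t x)"
    if sG: "s \<in> carrier BE_G" and tG: "t \<in> carrier BE_G" and x: "x \<in> BE_D (inv\<^bsub>BE_G\<^esub> t)"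
      and y: "BE_\<theta> t x \<in> BE_D (inv\<^bsub>BE_G\<^esub> s)" for s t x
  proof -
    obtain a b where s: "s = (a, b)" "b \<noteq> 0" using sG by (cases s) auto
    obtain c d where t: "t = (c, d)" "d \<noteq> 0" using tG by (cases t) auto
    have xX: "x \<in> BE_points" using x BE_D_subset by blast
    then obtain u where x_eq: "x = (\<lambda>w\<in>{w. w \<noteq> 0}. pcoset (u w) w)"
      by (auto simp: BE_points_def)
    have arg: "inverse d / b = 1 / (b * d)" using s t by (simp add: field_simps)
    have "pcoset (c + d * u (1 / (b * d))) (1 / b) = pcoset (- a / b) (1 / b)"
      using y s t by (simp add: x_eq BE_\<theta>_coset inv_BE_G BE_D_def arg)
    then have "c + d * u (1 / (b * d)) + a / b \<in> pideal (1 / b)"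
      by (simp add: pcoset_eq_iff)
    moreover have "1 / d * (c + d * v + a / b) = v - (- (a + c * b) / (b * d))" for v
      using s t by (simp add: field_simps)
    moreover have "1 / d * (1 / b) = 1 / (b * d)" by simp
    ultimately have "u (1 / (b * d)) - (- (a + c * b) / (b * d)) \<in> pideal (1 / (b * d))"
      by (metis pideal_cmult)
    then have "x (1 / (b * d)) = pcoset (- (a + c * b) / (b * d)) (1 / (b * d))"
      using s t by (simp add: x_eq pcoset_eq_iff)
    then show ?thesis
      using s t xX by (simp add: inv_BE_G BE_D_def BE_\<theta>_mult)
  qed
qed

interpretation BE_H: partial_action "BE_G\<lparr>carrier := BE_H\<rparr>" BE_X BE_D BE_\<theta>
  by (rule partial_action.restrict_subgroup[OF partial_action_BE subgroup_BE_H])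

end

theory Submission
  imports Defs
begin

text \<open>Every nonempty open subset of \<open>X\<close> contains a set \<open>D\<^sub>g = \<theta>\<^sub>g(X)\<close> with \<open>g = (k, m)\<close>, where \<open>k\<close> is an
  integer and \<open>m\<close> a positive integer; and as a nontrivial element of \<open>H\<close> has at most one fixed point,
  \<open>D\<^sub>g\<close> can be chosen so small that finitely many given \<open>t \<noteq> e\<close> move it off itself. Two disjoint sets
  \<open>D\<^sub>g\<close> inside \<open>V\<close> make \<open>V\<close> paradoxical.

  For such \<open>g\<close> the element \<open>s = 1\<^bsub>D\<^sub>g\<^esub> \<delta>\<^sub>g\<close> is an isometry. Let \<open>a = c\<^sup>* c\<close> be nonzero. Since \<open>\<delta>\<^sub>e\<close> is a
  separating vector, the function \<open>\<langle>\<delta>\<^sub>e, a \<delta>\<^sub>e\<rangle> = \<langle>c \<delta>\<^sub>e, c \<delta>\<^sub>e\<rangle>\<close> takes a value \<open>\<lambda> > 0\<close>. Approximating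
  \<open>a\<close> by a finite sum and choosing \<open>D\<^sub>g\<close> near a point where this value is attained, one gets
  \<open>s\<^sup>* a s \<approx> \<lambda>\<close>, because compression by \<open>s\<close> kills all coefficients but the one at \<open>e\<close>. Hence
  \<open>(s d)\<^sup>* a (s d) / \<lambda> \<approx> d\<^sup>* d\<close> for every \<open>d\<close>. Two such isometries with orthogonal ranges exclude
  characters.\<close>

text \<open>The module is a completion modulo null sequences with values in functions on
  \<open>X\<close>, so ordinary Hilbert space theory does not apply directly. It is handled one
  point at a time: for each p the coefficients \<open>a s (\<theta> s p)\<close> form a vector
  indexed by the group, the inner product at p is the usual scalar one, and a finite sum acts by a
  matrix. Norms are suprema over p of these scalar norms, so every inequality reduces to one between
  finite sums with constants uniform in p.

  Two facts do not come from this reduction alone. Adjointable operators are not assumed bounded,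
  and their norm is a real \<open>Sup\<close>, so boundedness has to be derived from the adjoint.
  And \<delta>_e is separating because right multiplication by b, while moving the base point p to
  \<open>\<theta> t p\<close>, is bounded for the supremum over all p.

  On the arithmetic side, k has to avoid the fixed points u/(1-w) of finitely many affine maps. Once
  k is fixed, such a map shifts k by a nonzero rational with bounded denominator, and a large
  modulus m cannot divide that shift.

  For a = 0 the comparison rests on {0} being a closed ideal, which forces b = 0.\<close>

lemma tendsto_zero_sandwich:
  fixes f :: "nat \<Rightarrow> 'b::real_normed_vector"
  assumes "\<And>n. norm (f n) \<le> g n" "g \<longlonglongrightarrow> 0"
  shows "f \<longlonglongrightarrow> 0"
  by (rule Lim_null_comparison[OF _ assms(2)]) (simp add: assms(1))

text \<open>Minkowski's inequality for finitely many summands; in \<open>L_times_right_bound\<close>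
  these are the columns of a matrix.\<close>

lemma L2_set_sum_le:
  assumes "finite I"
  shows "L2_set (\<lambda>r. cmod (\<Sum>i\<in>I. f i r)) A \<le> (\<Sum>i\<in>I. L2_set (\<lambda>r. cmod (f i r)) A)"
  using assms
proof (induction I rule: finite_induct)
  case (insert i I)
  have "L2_set (\<lambda>r. cmod (\<Sum>j\<in>insert i I. f j r)) A
      \<le> L2_set (\<lambda>r. cmod (f i r) + cmod (\<Sum>j\<in>I. f j r)) A"
    using insert(1,2) by (intro L2_set_mono) (auto intro: norm_triangle_ineq)
  also have "\<dots> \<le> L2_set (\<lambda>r. cmod (f i r)) A + L2_set (\<lambda>r. cmod (\<Sum>j\<in>I. f j r)) A"
    by (rule L2_set_triangle_ineq)
  finally show ?case using insert by simp
qed (simp add: L2_set_def)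

text \<open>Closes approximation arguments whose error is e times a fixed constant, so that e need
  not be rescaled beforehand.\<close>

lemma nonpos_if_le_all_multiples:
  fixes y M :: real
  assumes "M \<ge> 0" "\<And>e. e > 0 \<Longrightarrow> y \<le> e * M"
  shows "y \<le> 0"
proof (rule field_le_epsilon)
  fix e :: real assume e: "e > 0"
  have "y \<le> e / (M + 1) * M" by (rule assms(2)) (use assms(1) e in simp)
  also have "\<dots> \<le> e" using assms(1) e by (simp add: field_simps)
  finally show "y \<le> 0 + e" by simp
qed

section \<open>The convolution algebra and its orbit representations\<close>

text \<open>Closedness of the domains makes extension by 0 continuous, so every indicator of
  \<open>D t\<close> is an admissible coefficient. Compactness makes continuous functions bounded
  and turns the condition at infinity in \<open>C0\<close> into plain vanishing off the set.\<close>

locale clopen_partial_action = partial_action G X D \<theta>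
  for G (structure) and X :: "'x topology" and D :: "'a \<Rightarrow> 'x set" and \<theta> :: "'a \<Rightarrow> 'x \<Rightarrow> 'x" +
  assumes compact_X: "compact_space X"
    and closed_dom: "t \<in> carrier G \<Longrightarrow> closedin X (D t)"
begin

section \<open>Moving between points of one partial orbit\<close>

lemma dom_subset: "t \<in> carrier G \<Longrightarrow> D t \<subseteq> topspace X"
  using open_dom openin_subset by blast

lemma topspace_dom: "t \<in> carrier G \<Longrightarrow> topspace (subtopology X (D t)) = D t"
  using dom_subset by (simp add: topspace_subtopology Int_absorb1)

lemma act_closed:
  assumes "t \<in> carrier G" "x \<in> D (inv t)"
  shows "\<theta> t x \<in> D t"
  using homeo[OF assms(1)] assms topspace_dom[of t] topspace_dom[of "inv t"]
  unfolding homeomorphic_maps_def continuous_map_def Pi_def by auto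

lemma act_inv:
  assumes "t \<in> carrier G" "x \<in> D (inv t)"
  shows "\<theta> (inv t) (\<theta> t x) = x"
  using homeo[OF assms(1)] assms topspace_dom[of "inv t"]
  unfolding homeomorphic_maps_def by auto

lemma act_inv':
  assumes "t \<in> carrier G" "x \<in> D t"
  shows "\<theta> (inv t) x \<in> D (inv t)" "\<theta> t (\<theta> (inv t) x) = x"
  using act_closed[of "inv t" x] act_inv[of "inv t" x] assms by auto

text \<open>The element \<open>s \<otimes> inv r\<close> leads from \<open>\<theta> r x\<close> to
  \<open>\<theta> s x\<close>. This and the converse domain statement \<open>act_quot_dom\<close>
  are what turn convolution into multiplication of matrices.\<close>

lemma act_quot:
  assumes "r \<in> carrier G" "s \<in> carrier G" "x \<in> D (inv r)" "x \<in> D (inv s)"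
  shows "\<theta> r x \<in> D (r \<otimes> inv s)" "\<theta> (s \<otimes> inv r) (\<theta> r x) = \<theta> s x"
  using act_mult[of s "inv r" "\<theta> r x"] act_closed[of r x] act_inv[of r x] assms
  by (auto simp: inv_mult_group)

lemma act_quot_dom:
  assumes "r \<in> carrier G" "s \<in> carrier G" "x \<in> D (inv r)" "\<theta> r x \<in> D (r \<otimes> inv s)"
  shows "x \<in> D (inv s)" "\<theta> (s \<otimes> inv r) (\<theta> r x) = \<theta> s x"
proof -
  have "s \<otimes> inv r \<otimes> r = s" using assms by (simp add: m_assoc)
  then show "x \<in> D (inv s)" "\<theta> (s \<otimes> inv r) (\<theta> r x) = \<theta> s x"
    using act_mult[of "s \<otimes> inv r" r x] assms by (auto simp: inv_mult_group)
qed

section \<open>Continuous functions supported on the domains\<close>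

lemma C0_iff:
  assumes "U \<subseteq> topspace X"
  shows "f \<in> C0 U \<longleftrightarrow> continuous_map X euclidean f \<and> (\<forall>x. x \<notin> U \<longrightarrow> f x = 0)"
proof -
  have "compactin X {x \<in> U. e \<le> cmod (f x)}"
    if f: "continuous_map X euclidean f" "\<forall>x. x \<notin> U \<longrightarrow> f x = 0" and e: "e > 0" for e
  proof -
    \<comment> \<open>Off \<open>U\<close> the function is 0, which is below e, so the set equals a
      superlevel set in all of \<open>X\<close> and is closed.\<close>
    have "{x \<in> U. e \<le> cmod (f x)} = {x \<in> topspace X. f x \<in> {z. e \<le> cmod z}}"
      using assms f(2) e by force
    moreover have "closedin X {x \<in> topspace X. f x \<in> {z. e \<le> cmod z}}"
      by (rule closedin_continuous_map_preimage[OF f(1)])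
        (auto intro: closed_Collect_le continuous_intros)
    ultimately show ?thesis using closedin_compact_space[OF compact_X] by simp
  qed
  then show ?thesis unfolding C0_def by blast
qed

lemma continuous_bounded:
  assumes f: "continuous_map X euclidean (f :: 'x \<Rightarrow> complex)" and 0: "\<And>x. x \<notin> topspace X \<Longrightarrow> f x = 0"
  obtains K where "K \<ge> 0" "\<And>x. cmod (f x) \<le> K"
proof -
  have "compactin euclidean (f ` topspace X)"
    using image_compactin[OF _ f] compact_X by (simp add: compact_space_def)
  then have "bounded (f ` topspace X)" by (simp add: compact_imp_bounded)
  then obtain K where K: "\<And>x. x \<in> topspace X \<Longrightarrow> cmod (f x) \<le> K" by (auto simp: bounded_iff)
  show ?thesis
  proof (rule that[of "max K 0"])
    show "cmod (f x) \<le> max K 0" for x using K[of x] 0[of x] by (cases "x \<in> topspace X") auto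
  qed simp
qed

lemma continuous_\<alpha>:
  assumes t: "t \<in> carrier G" and g: "continuous_map X euclidean (g :: 'x \<Rightarrow> complex)"
  shows "continuous_map X euclidean (\<alpha> t g)"
proof (subst continuous_map, intro conjI allI impI)
  fix U :: "complex set" assume U: "openin euclidean U"
  have *: "continuous_map (subtopology X (D t)) euclidean (g \<circ> \<theta> (inv t))"
    using homeo[OF t] g unfolding homeomorphic_maps_def
    by (meson continuous_map_compose continuous_map_from_subtopology continuous_map_into_fulltopology)
  have "openin (subtopology X (D t)) {x \<in> topspace (subtopology X (D t)). (g \<circ> \<theta> (inv t)) x \<in> U}"
    using openin_continuous_map_preimage[OF * U] .
  then have 1: "openin X {x \<in> D t. g (\<theta> (inv t) x) \<in> U}"
    using openin_trans_full[OF _ open_dom[OF t]] unfolding topspace_dom[OF t] comp_def by blast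
  \<comment> \<open>The region of extension by 0 has to be open as well; this is where
    \<open>D t\<close> must be closed.\<close>
  have 2: "openin X (topspace X - D t)" using closed_dom[OF t] by blast
  have "{x \<in> topspace X. \<alpha> t g x \<in> U} =
     {x \<in> D t. g (\<theta> (inv t) x) \<in> U} \<union> (if 0 \<in> U then topspace X - D t else {})"
    using dom_subset[OF t] by (auto simp: \<alpha>_def split: if_splits)
  then show "openin X {x \<in> topspace X. \<alpha> t g x \<in> U}" using 1 2 by auto
qed auto

lemma continuous_map_complex_mult:
  fixes f g :: "'x \<Rightarrow> complex"
  assumes "continuous_map X euclidean f" "continuous_map X euclidean g"
  shows "continuous_map X euclidean (\<lambda>x. f x * g x)"
  using assms by (simp add: continuous_map_atin tendsto_mult)

lemma continuous_map_cnj: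
  assumes "continuous_map X euclidean f"
  shows "continuous_map X euclidean (\<lambda>x. cnj (f x))"
  using assms by (simp add: continuous_map_atin tendsto_cnj)

section \<open>Finite sums with their convolution and involution\<close>

definition supp :: "('a \<Rightarrow> 'x \<Rightarrow> complex) \<Rightarrow> 'a set" where
  "supp a = {t. a t \<noteq> (\<lambda>_. 0)}"

lemma LalgI:
  assumes "\<And>t. t \<in> carrier G \<Longrightarrow> continuous_map X euclidean (a t)"
    and "\<And>t x. t \<in> carrier G \<Longrightarrow> x \<notin> D t \<Longrightarrow> a t x = 0"
    and "finite F" and "\<And>t. t \<notin> F \<or> t \<notin> carrier G \<Longrightarrow> a t = (\<lambda>_. 0)"
  shows "a \<in> Lalg"
proof -
  have "{t. a t \<noteq> (\<lambda>_. 0)} \<subseteq> F" using assms(4) by auto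
  then have "finite {t. a t \<noteq> (\<lambda>_. 0)}" using assms(3) finite_subset by blast
  then show ?thesis unfolding Lalg_def using assms by (auto simp: C0_iff dom_subset)
qed

lemma LalgD:
  assumes "a \<in> Lalg"
  shows "finite (supp a)" "supp a \<subseteq> carrier G" "t \<notin> supp a \<Longrightarrow> a t x = 0"
    "t \<in> carrier G \<Longrightarrow> x \<notin> D t \<Longrightarrow> a t x = 0" "t \<notin> carrier G \<Longrightarrow> a t x = 0"
    "continuous_map X euclidean (a t)"
proof -
  show "continuous_map X euclidean (a t)"
    using assms by (cases "t \<in> carrier G") (auto simp: Lalg_def C0_iff dom_subset)
qed (use assms in \<open>auto simp: Lalg_def supp_def C0_iff dom_subset\<close>)

lemma Lalg_bounded:
  assumes "a \<in> Lalg"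
  shows "\<exists>K. (\<forall>t. K t \<ge> (0::real)) \<and> (\<forall>t x. cmod (a t x) \<le> K t)"
proof -
  have "\<exists>K\<ge>0. \<forall>x. cmod (a t x) \<le> K" for t
  proof (cases "t \<in> carrier G")
    case True
    then have "\<And>x. x \<notin> topspace X \<Longrightarrow> a t x = 0" using LalgD(4)[OF assms True] dom_subset by blast
    then show ?thesis using continuous_bounded[OF LalgD(6)[OF assms]] by metis
  qed (use LalgD[OF assms] in \<open>auto intro!: exI[of _ 0]\<close>)
  then show ?thesis by metis
qed

lemma Lalg_zero: "(\<lambda>_ _. 0) \<in> Lalg"
  by (rule LalgI[of _ "{}"]) auto

lemma Lalg_add:
  assumes "a \<in> Lalg" "b \<in> Lalg"
  shows "(\<lambda>t x. a t x + b t x) \<in> Lalg"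
  by (rule LalgI[of _ "supp a \<union> supp b"])
    (use assms LalgD[OF assms(1)] LalgD[OF assms(2)] in \<open>auto intro!: continuous_map_add\<close>)

lemma Lalg_scale:
  assumes "a \<in> Lalg"
  shows "(\<lambda>t x. c * a t x) \<in> Lalg"
  by (rule LalgI[of _ "supp a"])
    (use LalgD[OF assms] in \<open>auto intro!: continuous_map_complex_mult\<close>)

lemma Lalg_diff:
  assumes "a \<in> Lalg" "b \<in> Lalg"
  shows "(\<lambda>t x. a t x - b t x) \<in> Lalg"
  using Lalg_add[OF assms(1) Lalg_scale[OF assms(2), of "-1"]] by simp

text \<open>Solving t s = r for t leaves a sum over s alone, and the nested \<alpha> collapse to an
  evaluation at a translated point. Allowing any finite \<open>F\<close> above \<open>supp b\<close>
  lets several products be expanded over the same index set.\<close>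

lemma L_times_eq:
  assumes a: "a \<in> Lalg" and b: "b \<in> Lalg" and r: "r \<in> carrier G"
    and F: "finite F" "supp b \<subseteq> F" "F \<subseteq> carrier G"
  shows "L_times a b r x = (\<Sum>s\<in>F. a (r \<otimes> inv s) x * b s (\<theta> (s \<otimes> inv r) x))"
proof -
  let ?P = "{(t, s). a t \<noteq> (\<lambda>_. 0) \<and> b s \<noteq> (\<lambda>_. 0) \<and> t \<otimes> s = r}"
  let ?S = "{s \<in> supp b. r \<otimes> inv s \<in> supp a}"
  have P: "?P = (\<lambda>s. (r \<otimes> inv s, s)) ` ?S"
  proof (intro subset_antisym subsetI)
    fix z assume "z \<in> ?P"
    then obtain t s where z: "z = (t, s)" "t \<in> supp a" "s \<in> supp b" "t \<otimes> s = r"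
      by (auto simp: supp_def)
    then have "t \<in> carrier G" "s \<in> carrier G" using LalgD(2)[OF a] LalgD(2)[OF b] by auto
    then have "t = r \<otimes> inv s" using z by (auto simp: m_assoc)
    then show "z \<in> (\<lambda>s. (r \<otimes> inv s, s)) ` ?S" using z by auto
  next
    fix z assume "z \<in> (\<lambda>s. (r \<otimes> inv s, s)) ` ?S"
    then show "z \<in> ?P" using F r by (auto simp: m_assoc subset_iff) (auto simp: supp_def)
  qed
  \<comment> \<open>Off \<open>D t\<close> both sides vanish, the right one because
    \<open>a t\<close> does; on \<open>D t\<close> the two translations in the first factor
    cancel.\<close>
  have term_eq: "\<alpha> t (\<lambda>y. \<alpha> (inv t) (a t) y * b s y) x = a t x * b s (\<theta> (inv t) x)"
    if t: "t \<in> carrier G" for s t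
    using LalgD(4)[OF a t, of x] t act_inv'[OF t, of x] by (auto simp: \<alpha>_def)
  have inv_quot: "inv (r \<otimes> inv s) = s \<otimes> inv r" if "s \<in> F" for s
    using that F r by (auto simp: inv_mult_group)
  have "L_times a b r x = (\<Sum>s\<in>?S. \<alpha> (r \<otimes> inv s) (\<lambda>y. \<alpha> (inv (r \<otimes> inv s)) (a (r \<otimes> inv s)) y * b s y) x)"
    unfolding L_times_def P by (subst sum.reindex) (auto simp: inj_on_def)
  also have "\<dots> = (\<Sum>s\<in>?S. a (r \<otimes> inv s) x * b s (\<theta> (s \<otimes> inv r) x))"
  proof (rule sum.cong[OF refl])
    fix s assume "s \<in> ?S"
    then have "s \<in> F" "r \<otimes> inv s \<in> carrier G" using F r by auto
    then show "\<alpha> (r \<otimes> inv s) (\<lambda>y. \<alpha> (inv (r \<otimes> inv s)) (a (r \<otimes> inv s)) y * b s y) x =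
      a (r \<otimes> inv s) x * b s (\<theta> (s \<otimes> inv r) x)"
      using term_eq[of "r \<otimes> inv s" s] inv_quot[of s] by simp
  qed
  also have "\<dots> = (\<Sum>s\<in>F. a (r \<otimes> inv s) x * b s (\<theta> (s \<otimes> inv r) x))"
  proof (rule sum.mono_neutral_left[OF F(1)])
    show "\<forall>s\<in>F - ?S. a (r \<otimes> inv s) x * b s (\<theta> (s \<otimes> inv r) x) = 0"
      using LalgD(3)[OF a] LalgD(3)[OF b] by fastforce
  qed (use F in auto)
  finally show ?thesis .
qed

lemma L_times_outside:
  assumes "a \<in> Lalg" "b \<in> Lalg" "r \<notin> carrier G"
  shows "L_times a b r x = 0"
proof -
  have "{(t, s). a t \<noteq> (\<lambda>_. 0) \<and> b s \<noteq> (\<lambda>_. 0) \<and> t \<otimes> s = r} = {}"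
    using assms LalgD(2)[OF assms(1)] LalgD(2)[OF assms(2)] by (auto simp: supp_def)
  then show ?thesis unfolding L_times_def by (simp only: sum.empty)
qed

lemma Lalg_times:
  assumes a: "a \<in> Lalg" and b: "b \<in> Lalg"
  shows "L_times a b \<in> Lalg"
proof (rule LalgI)
  let ?F = "supp b"
  note eq = L_times_eq[OF a b _ LalgD(1)[OF b] order_refl LalgD(2)[OF b]]
  fix t assume t: "t \<in> carrier G"
  \<comment> \<open>The first factor vanishes off \<open>D (t \<otimes> inv s)\<close>, so the
    second may be cut off there; in this form each factor is continuous.\<close>
  have term_eq: "a (t \<otimes> inv s) x * b s (\<theta> (s \<otimes> inv t) x) = a (t \<otimes> inv s) x * \<alpha> (t \<otimes> inv s) (b s) x"
    if "s \<in> ?F" for s x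
    using that LalgD(2)[OF b] LalgD(4)[OF a, of "t \<otimes> inv s" x] t by (auto simp: \<alpha>_def inv_mult_group)
  have "L_times a b t = (\<lambda>x. \<Sum>s\<in>?F. a (t \<otimes> inv s) x * \<alpha> (t \<otimes> inv s) (b s) x)"
    by (rule ext, unfold eq[OF t], rule sum.cong[OF refl], erule term_eq)
  moreover have "continuous_map X euclidean (\<lambda>x. a (t \<otimes> inv s) x * \<alpha> (t \<otimes> inv s) (b s) x)" if "s \<in> ?F" for s
    using that t LalgD[OF a] LalgD[OF b] by (intro continuous_map_complex_mult continuous_\<alpha>) auto
  ultimately show "continuous_map X euclidean (L_times a b t)"
    using LalgD(1)[OF b] by (simp add: continuous_map_sum)
  fix x assume x: "x \<notin> D t"
  have "a (t \<otimes> inv s) x * b s (\<theta> (s \<otimes> inv t) x) = 0" if "s \<in> ?F" for s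
  proof (rule ccontr)
    assume nz: "a (t \<otimes> inv s) x * b s (\<theta> (s \<otimes> inv t) x) \<noteq> 0"
    have s: "s \<in> carrier G" using that LalgD(2)[OF b] by auto
    have 1: "x \<in> D (t \<otimes> inv s)" using nz LalgD(4)[OF a, of "t \<otimes> inv s" x] s t by auto
    have 2: "\<theta> (s \<otimes> inv t) x \<in> D s" using nz LalgD(4)[OF b s] by auto
    \<comment> \<open>If the term is nonzero, \<open>s \<otimes> inv t\<close> acts on x and its
      image lies in \<open>D s\<close>, where \<open>inv s\<close> acts. The composite is
      \<open>inv t\<close>, hence x is in \<open>D t\<close>.\<close>
    have "x \<in> D (inv (inv s \<otimes> (s \<otimes> inv t)))"
      using act_mult[of "inv s" "s \<otimes> inv t" x] s t 1 2 by (simp add: inv_mult_group)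
    then show False using s t x by (simp flip: m_assoc)
  qed
  then show "L_times a b t x = 0" using eq[OF t] by (simp add: sum.neutral)
next
  show "finite ((\<lambda>(t, s). t \<otimes> s) ` (supp a \<times> supp b))" using LalgD(1)[OF a] LalgD(1)[OF b] by auto
  fix r assume r: "r \<notin> (\<lambda>(t, s). t \<otimes> s) ` (supp a \<times> supp b) \<or> r \<notin> carrier G"
  have "{(t, s). a t \<noteq> (\<lambda>_. 0) \<and> b s \<noteq> (\<lambda>_. 0) \<and> t \<otimes> s = r} = {}"
    using r LalgD(2)[OF a] LalgD(2)[OF b] by (auto simp: supp_def image_iff)
  then show "L_times a b r = (\<lambda>_. 0)" unfolding L_times_def by (simp only: sum.empty)
qed

lemma Lalg_star:
  assumes a: "a \<in> Lalg"
  shows "L_star a \<in> Lalg"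
proof (rule LalgI)
  show "finite ((\<lambda>t. inv t) ` supp a)" using LalgD(1)[OF a] by simp
  fix t
  show "continuous_map X euclidean (L_star a t)" if "t \<in> carrier G"
    using that LalgD[OF a] by (auto simp: L_star_def intro!: continuous_\<alpha> continuous_map_cnj)
  show "L_star a t x = 0" if "t \<in> carrier G" "x \<notin> D t" for x
    using that by (simp add: L_star_def \<alpha>_def)
  assume t: "t \<notin> (\<lambda>t. inv t) ` supp a \<or> t \<notin> carrier G"
  have "inv t \<notin> supp a" if "t \<in> carrier G" using t that by (metis image_eqI inv_inv)
  then show "L_star a t = (\<lambda>_. 0)"
    using LalgD(3)[OF a] by (auto simp: L_star_def \<alpha>_def fun_eq_iff)
qed

text \<open>\<open>fib a p\<close> is the vector of the orbit representation at \<open>p\<close> that corresponds to \<open>a\<close>, and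
  \<open>mat a p\<close> is the matrix by which \<open>a\<close> acts in this representation.\<close>

definition fib :: "('a \<Rightarrow> 'x \<Rightarrow> complex) \<Rightarrow> 'x \<Rightarrow> 'a \<Rightarrow> complex" where
  "fib a p s = (if p \<in> D (inv s) then a s (\<theta> s p) else 0)"

definition mat :: "('a \<Rightarrow> 'x \<Rightarrow> complex) \<Rightarrow> 'x \<Rightarrow> 'a \<Rightarrow> 'a \<Rightarrow> complex" where
  "mat a p r s = (if p \<in> D (inv r) \<and> p \<in> D (inv s) then a (r \<otimes> inv s) (\<theta> r p) else 0)"

text \<open>Both products agree term by term: if \<open>\<theta> r p\<close> is in
  \<open>D (r \<otimes> inv s)\<close>, then s acts on p by \<open>act_quot_dom\<close>; otherwise
  \<open>a\<close> vanishes there and, by \<open>act_quot\<close>, s does not act on p, so the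
  matrix entry is 0 too.\<close>

lemma fib_times:
  assumes a: "a \<in> Lalg" and b: "b \<in> Lalg" and r: "r \<in> carrier G"
    and F: "finite F" "supp b \<subseteq> F" "F \<subseteq> carrier G"
  shows "fib (L_times a b) p r = (\<Sum>s\<in>F. mat a p r s * fib b p s)"
proof (cases "p \<in> D (inv r)")
  case True
  have "a (r \<otimes> inv s) (\<theta> r p) * b s (\<theta> (s \<otimes> inv r) (\<theta> r p)) = mat a p r s * fib b p s"
    if "s \<in> F" for s
  proof (cases "\<theta> r p \<in> D (r \<otimes> inv s)")
    case in_dom: True
    have s: "s \<in> carrier G" using that F by auto
    show ?thesis using act_quot_dom[OF r s True in_dom] True by (simp add: mat_def fib_def)
  next
    case False
    moreover have "p \<notin> D (inv s)" using act_quot(1)[OF r _ True, of s] False that F by auto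
    ultimately show ?thesis using LalgD(4)[OF a, of "r \<otimes> inv s"] r that F by (auto simp: mat_def)
  qed
  then show ?thesis using True L_times_eq[OF a b r F, of "\<theta> r p"] by (simp add: fib_def[of _ p r])
qed (simp add: fib_def mat_def)

lemma mat_star:
  assumes r: "r \<in> carrier G" and s: "s \<in> carrier G"
  shows "mat (L_star a) p s r = cnj (mat a p r s)"
proof (cases "p \<in> D (inv r) \<and> p \<in> D (inv s)")
  case True
  then show ?thesis using act_quot[of s r p] r s
    by (auto simp: mat_def L_star_def \<alpha>_def inv_mult_group)
qed (auto simp: mat_def)

text \<open>At a point p the function E(a* b) is the standard inner product of the two orbit
  vectors. Positivity and Cauchy-Schwarz thereby become statements about finite sums.\<close>

lemma L_inner_eq:
  assumes a: "a \<in> Lalg" and b: "b \<in> Lalg" and F: "finite F" "supp b \<subseteq> F" "F \<subseteq> carrier G"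
  shows "L_inner a b p = (\<Sum>s\<in>F. cnj (fib a p s) * fib b p s)"
proof -
  have "L_inner a b p = (\<Sum>s\<in>F. L_star a (inv s) p * b s (\<theta> s p))"
    unfolding L_inner_def E_def using L_times_eq[OF Lalg_star[OF a] b one_closed F, of p] F
    by (auto intro!: sum.cong)
  also have "\<dots> = (\<Sum>s\<in>F. cnj (fib a p s) * fib b p s)"
    using F by (auto intro!: sum.cong simp: L_star_def fib_def \<alpha>_def)
  finally show ?thesis .
qed

lemma L_inner_cnj:
  assumes a: "a \<in> Lalg" and b: "b \<in> Lalg"
  shows "L_inner b a p = cnj (L_inner a b p)"
  using L_inner_eq[OF a b, of "supp a \<union> supp b"] L_inner_eq[OF b a, of "supp a \<union> supp b"]
    LalgD[OF a] LalgD[OF b] by (simp add: mult.commute)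

text \<open>Conjugate symmetry allows the index set to be taken from the first argument, which keeps
  it fixed while the second one varies.\<close>

lemma L_inner_eq':
  assumes a: "a \<in> Lalg" and b: "b \<in> Lalg" and F: "finite F" "supp a \<subseteq> F" "F \<subseteq> carrier G"
  shows "L_inner a b p = (\<Sum>s\<in>F. cnj (fib a p s) * fib b p s)"
  using L_inner_cnj[OF b a] L_inner_eq[OF b a F] by (simp add: mult.commute)

lemma L_inner_self:
  assumes "a \<in> Lalg" "finite F" "supp a \<subseteq> F" "F \<subseteq> carrier G"
  shows "Re (L_inner a a p) = (\<Sum>s\<in>F. (cmod (fib a p s))\<^sup>2)"
  using L_inner_eq[OF assms(1,1,2-4), of p] by (simp add: cmod_power2) (simp add: power2_eq_square)

lemma L_inner_adjoint:
  assumes a: "a \<in> Lalg" and x: "x \<in> Lalg" and y: "y \<in> Lalg"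
  shows "L_inner (L_times a x) y p = L_inner x (L_times (L_star a) y) p"
proof -
  note X = LalgD(1)[OF x] order_refl LalgD(2)[OF x] and Y = LalgD(1)[OF y] order_refl LalgD(2)[OF y]
  note c = LalgD(2)[OF x, THEN subsetD] LalgD(2)[OF y, THEN subsetD]
  have "L_inner (L_times a x) y p
      = (\<Sum>r\<in>supp y. \<Sum>s\<in>supp x. cnj (mat a p r s) * cnj (fib x p s) * fib y p r)"
    using L_inner_eq[OF Lalg_times[OF a x] y Y] fib_times[OF a x _ X] c
    by (simp add: sum_distrib_right)
  also have "\<dots> = (\<Sum>s\<in>supp x. \<Sum>r\<in>supp y. cnj (mat a p r s) * cnj (fib x p s) * fib y p r)"
    by (rule sum.swap)
  also have "\<dots> = L_inner x (L_times (L_star a) y) p"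
    using L_inner_eq'[OF x Lalg_times[OF Lalg_star[OF a] y] X] fib_times[OF Lalg_star[OF a] y _ Y] c
    by (auto simp: sum_distrib_left mat_star mult_ac intro!: sum.cong)
  finally show ?thesis .
qed

lemma L_times_assoc:
  assumes a: "a \<in> Lalg" and b: "b \<in> Lalg" and c: "c \<in> Lalg"
  shows "L_times (L_times a b) c = L_times a (L_times b c)"
proof (intro ext)
  fix r x
  show "L_times (L_times a b) c r x = L_times a (L_times b c) r x"
  proof (cases "r \<in> carrier G")
    case r: True
    \<comment> \<open>\<open>U\<close> must contain \<open>supp (L_times b c)\<close> for expanding
      the outer product, and all products v s for the substitution u = v s.\<close>
    define U where "U = supp (L_times b c) \<union> (\<lambda>(v, s). v \<otimes> s) ` (supp b \<times> supp c)"
    note bc = Lalg_times[OF b c] and ab = Lalg_times[OF a b]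
    note cB = LalgD(2)[OF b, THEN subsetD] and cC = LalgD(2)[OF c, THEN subsetD]
    have U: "finite U" "supp (L_times b c) \<subseteq> U" "U \<subseteq> carrier G"
      using LalgD(1,2)[OF bc] LalgD(1)[OF b] LalgD(1)[OF c] cB cC by (auto simp: U_def)
    have inner: "(\<Sum>u\<in>U. a (r \<otimes> inv u) x * (b (u \<otimes> inv s) (\<theta> (u \<otimes> inv r) x)
          * c s (\<theta> (s \<otimes> inv u) (\<theta> (u \<otimes> inv r) x))))
        = (\<Sum>v\<in>supp b. a (r \<otimes> inv s \<otimes> inv v) x * b v (\<theta> (v \<otimes> inv (r \<otimes> inv s)) x)) *
          c s (\<theta> (s \<otimes> inv r) x)" if s: "s \<in> supp c" for s
    proof -
      let ?f = "\<lambda>u. a (r \<otimes> inv u) x * (b (u \<otimes> inv s) (\<theta> (u \<otimes> inv r) x)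
          * c s (\<theta> (s \<otimes> inv r) x))"
      have sG: "s \<in> carrier G" using cC s by auto
      have "(\<Sum>u\<in>U. a (r \<otimes> inv u) x * (b (u \<otimes> inv s) (\<theta> (u \<otimes> inv r) x)
          * c s (\<theta> (s \<otimes> inv u) (\<theta> (u \<otimes> inv r) x)))) = sum ?f U"
      proof (rule sum.cong[OF refl])
        fix u assume "u \<in> U"
        then have u: "u \<in> carrier G" using U by auto
        \<comment> \<open>The two translations compose only where both are defined. Elsewhere the
          coefficient of a or of b is 0, so the terms still agree.\<close>
        have "\<theta> (s \<otimes> inv u) (\<theta> (u \<otimes> inv r) x) = \<theta> (s \<otimes> inv r) x"
          if "x \<in> D (r \<otimes> inv u)" "\<theta> (u \<otimes> inv r) x \<in> D (u \<otimes> inv s)"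
        proof -
          have "s \<otimes> inv u \<otimes> (u \<otimes> inv r) = s \<otimes> inv r"
            using u r sG by (metis inv_closed inv_solve_right m_assoc m_closed)
          then show ?thesis using act_mult[of "s \<otimes> inv u" "u \<otimes> inv r" x] that u r sG
            by (auto simp: inv_mult_group)
        qed
        then show "a (r \<otimes> inv u) x * (b (u \<otimes> inv s) (\<theta> (u \<otimes> inv r) x)
          * c s (\<theta> (s \<otimes> inv u) (\<theta> (u \<otimes> inv r) x))) = ?f u"
          using LalgD(4)[OF a, of "r \<otimes> inv u" x]
            LalgD(4)[OF b, of "u \<otimes> inv s" "\<theta> (u \<otimes> inv r) x"] u r sG by force
      qed
      also have "sum ?f U = sum ?f ((\<lambda>v. v \<otimes> s) ` supp b)"
      proof (rule sum.mono_neutral_right[OF U(1)])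
        show "(\<lambda>v. v \<otimes> s) ` supp b \<subseteq> U" using s by (auto simp: U_def)
        show "\<forall>u\<in>U - (\<lambda>v. v \<otimes> s) ` supp b. ?f u = 0"
        proof
          fix u assume u: "u \<in> U - (\<lambda>v. v \<otimes> s) ` supp b"
          then have uG: "u \<in> carrier G" using U by auto
          then have "u = u \<otimes> inv s \<otimes> s" using sG by (simp add: m_assoc)
          then have "u \<otimes> inv s \<notin> supp b" using u by (metis DiffD2 image_eqI)
          then show "?f u = 0" using LalgD(3)[OF b] by simp
        qed
      qed
      also have "\<dots> = (\<Sum>v\<in>supp b. ?f (v \<otimes> s))"
        using cB sG by (subst sum.reindex) (auto simp: inj_on_def)
      also have "\<dots> = (\<Sum>v\<in>supp b. a (r \<otimes> inv s \<otimes> inv v) x * b v (\<theta> (v \<otimes> inv (r \<otimes> inv s)) x)) *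
          c s (\<theta> (s \<otimes> inv r) x)"
        unfolding sum_distrib_right using cB sG r
        by (intro sum.cong refl) (simp add: m_assoc inv_mult_group)
      finally show ?thesis .
    qed
    have "L_times a (L_times b c) r x = (\<Sum>u\<in>U. a (r \<otimes> inv u) x * L_times b c u (\<theta> (u \<otimes> inv r) x))"
      by (rule L_times_eq[OF a bc r U])
    also have "\<dots> = (\<Sum>u\<in>U. \<Sum>s\<in>supp c. a (r \<otimes> inv u) x * (b (u \<otimes> inv s) (\<theta> (u \<otimes> inv r) x)
          * c s (\<theta> (s \<otimes> inv u) (\<theta> (u \<otimes> inv r) x))))"
      using U by (intro sum.cong refl)
        (auto simp: L_times_eq[OF b c _ LalgD(1)[OF c] order_refl LalgD(2)[OF c]] sum_distrib_left)
    also have "\<dots> = (\<Sum>s\<in>supp c. \<Sum>u\<in>U. a (r \<otimes> inv u) x * (b (u \<otimes> inv s) (\<theta> (u \<otimes> inv r) x)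
          * c s (\<theta> (s \<otimes> inv u) (\<theta> (u \<otimes> inv r) x))))"
      by (rule sum.swap)
    also have "\<dots> = (\<Sum>s\<in>supp c. L_times a b (r \<otimes> inv s) x * c s (\<theta> (s \<otimes> inv r) x))"
      using cC r by (intro sum.cong refl)
        (simp only: inner L_times_eq[OF a b _ LalgD(1)[OF b] order_refl LalgD(2)[OF b]] m_closed inv_closed)
    also have "\<dots> = L_times (L_times a b) c r x"
      by (rule L_times_eq[OF ab c r LalgD(1)[OF c] order_refl LalgD(2)[OF c], symmetric])
    finally show ?thesis by simp
  qed (simp add: L_times_outside assms Lalg_times)
qed

lemma L_times_diff:
  assumes a: "a \<in> Lalg" and b: "b \<in> Lalg" and c: "c \<in> Lalg"
  shows "L_times a (\<lambda>t x. b t x - c t x) = (\<lambda>t x. L_times a b t x - L_times a c t x)"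
proof (intro ext)
  fix r x
  have "supp (\<lambda>t x. b t x - c t x) \<subseteq> supp b \<union> supp c" by (auto simp: supp_def)
  then show "L_times a (\<lambda>t x. b t x - c t x) r x = L_times a b r x - L_times a c r x"
    using L_times_eq[OF a b, of r "supp b \<union> supp c" x] L_times_eq[OF a c, of r "supp b \<union> supp c" x]
      L_times_eq[OF a Lalg_diff[OF b c], of r "supp b \<union> supp c" x] LalgD[OF b] LalgD[OF c]
      L_times_outside[OF a b, of r x] L_times_outside[OF a c, of r x] L_times_outside[OF a Lalg_diff[OF b c], of r x]
    by (cases "r \<in> carrier G") (simp_all add: algebra_simps sum_subtractf)
qed

text \<open>A Schur test: both the rows and the columns of \<open>mat a p\<close> have \<open>\<ell>\<^sup>1\<close>-norm at most
  \<open>\<Sum>\<^sub>t \<parallel>a\<^sub>t\<parallel>\<close>.\<close>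

lemma L_times_bound:
  assumes a: "a \<in> Lalg" and x: "x \<in> Lalg" and K: "\<And>t y. cmod (a t y) \<le> K t"
  shows "Re (L_inner (L_times a x) (L_times a x) p) \<le> (\<Sum>t\<in>supp a. K t)\<^sup>2 * Re (L_inner x x p)"
proof -
  let ?A = "supp a" and ?S = "supp x" and ?R = "supp (L_times a x)" and ?m = "\<lambda>r s. cmod (mat a p r s)"
  define C where "C = (\<Sum>t\<in>?A. K t)"
  have K0: "K t \<ge> 0" for t using K[of t] norm_ge_zero order_trans by blast
  have C0: "C \<ge> 0" unfolding C_def using K0 by (simp add: sum_nonneg)
  note ax = Lalg_times[OF a x]
  note fin = LalgD(1)[OF a] LalgD(1)[OF x] LalgD(1)[OF ax]
  note sG = LalgD(2)[OF x, THEN subsetD] and rG = LalgD(2)[OF ax, THEN subsetD]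
  have m_le: "?m r s \<le> (if r \<otimes> inv s \<in> ?A then K (r \<otimes> inv s) else 0)" for r s
    using K K0 LalgD(3)[OF a] by (simp add: mat_def)
  have row: "(\<Sum>s\<in>?S. ?m r s) \<le> C" if r: "r \<in> ?R" for r
  proof -
    have inj: "inj_on (\<lambda>s. r \<otimes> inv s) ?S" by (rule inj_onI) (metis sG rG[OF r] inv_closed inv_inv Units_eq Units_l_cancel)
    have "(\<Sum>s\<in>?S. ?m r s) \<le> (\<Sum>s\<in>?S. if r \<otimes> inv s \<in> ?A then K (r \<otimes> inv s) else 0)"
      by (intro sum_mono m_le)
    also have "\<dots> = (\<Sum>t\<in>(\<lambda>s. r \<otimes> inv s) ` ?S. if t \<in> ?A then K t else 0)"
      using inj by (simp add: sum.reindex)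
    also have "\<dots> = (\<Sum>t\<in>(\<lambda>s. r \<otimes> inv s) ` ?S \<inter> ?A. K t)"
      using fin by (simp add: sum.inter_restrict)
    also have "\<dots> \<le> C" unfolding C_def using fin K0 by (intro sum_mono2) auto
    finally show ?thesis .
  qed
  have col: "(\<Sum>r\<in>?R. ?m r s) \<le> C" if s: "s \<in> ?S" for s
  proof -
    have inj: "inj_on (\<lambda>r. r \<otimes> inv s) ?R" using rG sG[OF s] by (auto simp: inj_on_def)
    have "(\<Sum>r\<in>?R. ?m r s) \<le> (\<Sum>r\<in>?R. if r \<otimes> inv s \<in> ?A then K (r \<otimes> inv s) else 0)"
      by (intro sum_mono m_le)
    also have "\<dots> = (\<Sum>t\<in>(\<lambda>r. r \<otimes> inv s) ` ?R. if t \<in> ?A then K t else 0)"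
      using inj by (simp add: sum.reindex)
    also have "\<dots> = (\<Sum>t\<in>(\<lambda>r. r \<otimes> inv s) ` ?R \<inter> ?A. K t)"
      using fin by (simp add: sum.inter_restrict)
    also have "\<dots> \<le> C" unfolding C_def using fin K0 by (intro sum_mono2) auto
    finally show ?thesis .
  qed
  note sq = L_inner_self[OF _ LalgD(1) order_refl LalgD(2)]
  have term_le: "(cmod (fib (L_times a x) p r))\<^sup>2 \<le> C * (\<Sum>s\<in>?S. ?m r s * (cmod (fib x p s))\<^sup>2)" if r: "r \<in> ?R" for r
  proof -
    \<comment> \<open>Each entry is split into two square roots for Cauchy-Schwarz: one factor
      yields the row sum, the other keeps the weighted squares for the later column sum.\<close>
    let ?u = "\<lambda>s. sqrt (?m r s)" and ?v = "\<lambda>s. sqrt (?m r s) * cmod (fib x p s)"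
    have "cmod (fib (L_times a x) p r) \<le> (\<Sum>s\<in>?S. ?m r s * cmod (fib x p s))"
      unfolding fib_times[OF a x rG[OF r] fin(2) order_refl LalgD(2)[OF x]]
      by (rule order_trans[OF norm_sum]) (simp add: norm_mult)
    also have "\<dots> = (\<Sum>s\<in>?S. \<bar>?u s\<bar> * \<bar>?v s\<bar>)"
      by (intro sum.cong refl) (simp add: mult.assoc[symmetric] abs_mult)
    also have "\<dots> \<le> L2_set ?u ?S * L2_set ?v ?S" by (rule L2_set_mult_ineq)
    finally have "(cmod (fib (L_times a x) p r))\<^sup>2 \<le> (L2_set ?u ?S * L2_set ?v ?S)\<^sup>2"
      by (intro power_mono) auto
    also have "\<dots> = (\<Sum>s\<in>?S. ?m r s) * (\<Sum>s\<in>?S. ?m r s * (cmod (fib x p s))\<^sup>2)"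
      by (simp add: L2_set_def power_mult_distrib sum_nonneg)
    also have "\<dots> \<le> C * (\<Sum>s\<in>?S. ?m r s * (cmod (fib x p s))\<^sup>2)"
      using row[OF r] by (intro mult_right_mono sum_nonneg) auto
    finally show ?thesis .
  qed
  have "Re (L_inner (L_times a x) (L_times a x) p) = (\<Sum>r\<in>?R. (cmod (fib (L_times a x) p r))\<^sup>2)"
    by (rule sq[OF ax ax ax])
  also have "\<dots> \<le> (\<Sum>r\<in>?R. C * (\<Sum>s\<in>?S. ?m r s * (cmod (fib x p s))\<^sup>2))"
    by (intro sum_mono term_le)
  also have "\<dots> = C * (\<Sum>s\<in>?S. (\<Sum>r\<in>?R. ?m r s) * (cmod (fib x p s))\<^sup>2)"
    unfolding sum_distrib_left sum_distrib_right by (rule sum.swap)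
  also have "\<dots> \<le> C * (\<Sum>s\<in>?S. C * (cmod (fib x p s))\<^sup>2)"
    using C0 col by (intro mult_left_mono sum_mono mult_right_mono) auto
  also have "\<dots> = C\<^sup>2 * Re (L_inner x x p)"
    by (simp add: sq[OF x x x] sum_distrib_left power2_eq_square mult.assoc)
  finally show ?thesis unfolding C_def .
qed

section \<open>The Hilbert module\<close>

abbreviation L_add :: "('a \<Rightarrow> 'x \<Rightarrow> complex) \<Rightarrow> ('a \<Rightarrow> 'x \<Rightarrow> complex) \<Rightarrow> 'a \<Rightarrow> 'x \<Rightarrow> complex" where
  "L_add a b \<equiv> \<lambda>t x. a t x + b t x"

abbreviation L_diff :: "('a \<Rightarrow> 'x \<Rightarrow> complex) \<Rightarrow> ('a \<Rightarrow> 'x \<Rightarrow> complex) \<Rightarrow> 'a \<Rightarrow> 'x \<Rightarrow> complex" where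
  "L_diff a b \<equiv> \<lambda>t x. a t x - b t x"

abbreviation L_scale :: "complex \<Rightarrow> ('a \<Rightarrow> 'x \<Rightarrow> complex) \<Rightarrow> 'a \<Rightarrow> 'x \<Rightarrow> complex" where
  "L_scale c a \<equiv> \<lambda>t x. c * a t x"

section \<open>The function-valued inner product and its fibre norms\<close>

lemma L_inner_add_right:
  assumes a: "a \<in> Lalg" and b: "b \<in> Lalg" and c: "c \<in> Lalg"
  shows "L_inner a (L_add b c) p = L_inner a b p + L_inner a c p"
  using L_inner_eq'[OF a b LalgD(1)[OF a] order_refl LalgD(2)[OF a]]
    L_inner_eq'[OF a c LalgD(1)[OF a] order_refl LalgD(2)[OF a]]
    L_inner_eq'[OF a Lalg_add[OF b c] LalgD(1)[OF a] order_refl LalgD(2)[OF a]]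
  by (simp add: sum.distrib[symmetric] fib_def distrib_left if_distrib cong: if_cong)

lemma L_inner_scale_right:
  assumes a: "a \<in> Lalg" and b: "b \<in> Lalg"
  shows "L_inner a (L_scale c b) p = c * L_inner a b p"
  using L_inner_eq'[OF a b LalgD(1)[OF a] order_refl LalgD(2)[OF a]]
    L_inner_eq'[OF a Lalg_scale[OF b] LalgD(1)[OF a] order_refl LalgD(2)[OF a]]
  by (auto intro!: sum.cong simp: fib_def sum_distrib_left)

lemma L_inner_diff_right:
  assumes "a \<in> Lalg" "b \<in> Lalg" "c \<in> Lalg"
  shows "L_inner a (L_diff b c) p = L_inner a b p - L_inner a c p"
  using L_inner_add_right[OF assms(1,2) Lalg_scale[OF assms(3), of "-1"], of p]
    L_inner_scale_right[OF assms(1,3), of "-1" p] by simp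

lemma L_inner_scale_left:
  assumes "a \<in> Lalg" "b \<in> Lalg"
  shows "L_inner (L_scale c a) b p = cnj c * L_inner a b p"
  using L_inner_scale_right[OF assms(2,1), of c p] L_inner_cnj[OF assms(2) Lalg_scale[OF assms(1)], of c p]
    L_inner_cnj[OF assms(2,1), of p] by simp

lemma L_inner_diff_left:
  assumes "a \<in> Lalg" "b \<in> Lalg" "c \<in> Lalg"
  shows "L_inner (L_diff a b) c p = L_inner a c p - L_inner b c p"
  using L_inner_diff_right[OF assms(3,1,2), of p] L_inner_cnj[OF assms(3) Lalg_diff[OF assms(1,2)], of p]
    L_inner_cnj[OF assms(3,1), of p] L_inner_cnj[OF assms(3,2), of p] by simp

text \<open>The scalar norm of the orbit vector at p. Estimates are proved for it and transferred to
  \<open>L_norm\<close>, its supremum, by \<open>L_fnorm_le_norm\<close> and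
  \<open>L_norm_leI\<close>.\<close>

definition L_fnorm :: "('a \<Rightarrow> 'x \<Rightarrow> complex) \<Rightarrow> 'x \<Rightarrow> real" where
  "L_fnorm a p = sqrt (Re (L_inner a a p))"

definition L_norm :: "('a \<Rightarrow> 'x \<Rightarrow> complex) \<Rightarrow> real" where
  "L_norm a = sqrt (supnorm (L_inner a a))"

lemma L_dist_eq: "L_dist a b = L_norm (L_diff a b)"
  by (simp add: L_dist_def L_norm_def Let_def)

lemma L_fnorm_eq:
  assumes "a \<in> Lalg" "finite F" "supp a \<subseteq> F" "F \<subseteq> carrier G"
  shows "L_fnorm a p = L2_set (\<lambda>s. cmod (fib a p s)) F"
  using L_inner_self[OF assms] by (simp add: L_fnorm_def L2_set_def)

lemma L_inner_self_real:
  assumes "a \<in> Lalg"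
  shows "L_inner a a p = of_real ((L_fnorm a p)\<^sup>2)"
proof -
  have "Im (L_inner a a p) = 0" using L_inner_cnj[OF assms assms, of p] by (simp add: complex_eq_iff)
  moreover have "Re (L_inner a a p) \<ge> 0"
    using L_inner_self[OF assms LalgD(1)[OF assms] order_refl LalgD(2)[OF assms]] by (simp add: sum_nonneg)
  ultimately show ?thesis by (simp add: L_fnorm_def complex_eq_iff)
qed

lemma L_fnorm_nonneg: "a \<in> Lalg \<Longrightarrow> L_fnorm a p \<ge> 0"
  using L_fnorm_eq[OF _ LalgD(1) order_refl LalgD(2)] by simp

lemma L_inner_CS:
  assumes a: "a \<in> Lalg" and b: "b \<in> Lalg"
  shows "cmod (L_inner a b p) \<le> L_fnorm a p * L_fnorm b p"
proof -
  let ?F = "supp a \<union> supp b"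
  have F: "finite ?F" "supp a \<subseteq> ?F" "supp b \<subseteq> ?F" "?F \<subseteq> carrier G"
    using LalgD[OF a] LalgD[OF b] by auto
  have "cmod (L_inner a b p) \<le> (\<Sum>s\<in>?F. \<bar>cmod (fib a p s)\<bar> * \<bar>cmod (fib b p s)\<bar>)"
    unfolding L_inner_eq[OF a b F(1,3,4)] by (rule order_trans[OF norm_sum]) (simp add: norm_mult)
  also have "\<dots> \<le> L_fnorm a p * L_fnorm b p"
    unfolding L_fnorm_eq[OF a F(1,2,4)] L_fnorm_eq[OF b F(1,3,4)] by (rule L2_set_mult_ineq)
  finally show ?thesis .
qed

lemma L_fnorm_add:
  assumes a: "a \<in> Lalg" and b: "b \<in> Lalg"
  shows "L_fnorm (L_add a b) p \<le> L_fnorm a p + L_fnorm b p"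
proof -
  let ?F = "supp a \<union> supp b"
  have F: "finite ?F" "supp a \<subseteq> ?F" "supp b \<subseteq> ?F" "?F \<subseteq> carrier G" "supp (L_add a b) \<subseteq> ?F"
    using LalgD[OF a] LalgD[OF b] by (auto simp: supp_def)
  have "L2_set (\<lambda>s. cmod (fib (L_add a b) p s)) ?F \<le> L2_set (\<lambda>s. cmod (fib a p s) + cmod (fib b p s)) ?F"
    by (rule L2_set_mono) (auto simp: fib_def norm_triangle_ineq)
  also have "\<dots> \<le> L2_set (\<lambda>s. cmod (fib a p s)) ?F + L2_set (\<lambda>s. cmod (fib b p s)) ?F"
    by (rule L2_set_triangle_ineq)
  finally show ?thesis
    unfolding L_fnorm_eq[OF a F(1,2,4)] L_fnorm_eq[OF b F(1,3,4)]
      L_fnorm_eq[OF Lalg_add[OF a b] F(1,5,4)] .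
qed

lemma L_fnorm_scale:
  assumes "a \<in> Lalg"
  shows "L_fnorm (L_scale c a) p = cmod c * L_fnorm a p"
proof -
  have "L_inner (L_scale c a) (L_scale c a) p = (cnj c * c) * of_real ((L_fnorm a p)\<^sup>2)"
    using assms by (simp add: L_inner_scale_left L_inner_scale_right Lalg_scale L_inner_self_real)
  moreover have "Re (cnj c * c) = (cmod c)\<^sup>2" "Im (cnj c * c) = 0"
    by (simp_all add: cmod_power2) (simp add: power2_eq_square)
  ultimately show ?thesis
    using L_fnorm_nonneg[OF assms] by (simp add: L_fnorm_def[of "L_scale c a"] real_sqrt_mult)
qed

text \<open>A real \<open>SUP\<close> can be compared with a value only if the set is bounded, so a
  bound must come first; \<open>L_inner_bounded\<close> provides it for inner products.\<close>

lemma supnorm_upper: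
  assumes "\<And>x. cmod (f x) \<le> K"
  shows "cmod (f x) \<le> supnorm f"
  unfolding supnorm_def by (rule cSUP_upper) (auto intro!: bdd_aboveI assms)

lemma supnorm_least:
  assumes "\<And>x. cmod (f x) \<le> K"
  shows "supnorm f \<le> K"
  unfolding supnorm_def by (rule cSUP_least) (auto intro: assms)

lemma L_fnorm_bounded:
  assumes "a \<in> Lalg"
  shows "\<exists>K. \<forall>p. L_fnorm a p \<le> K"
proof -
  obtain K where K: "\<And>t. K t \<ge> (0::real)" "\<And>t x. cmod (a t x) \<le> K t"
    using Lalg_bounded[OF assms] by auto
  have "L_fnorm a p \<le> (\<Sum>s\<in>supp a. K s)" for p
  proof -
    have "L_fnorm a p \<le> (\<Sum>s\<in>supp a. \<bar>cmod (fib a p s)\<bar>)"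
      unfolding L_fnorm_eq[OF assms LalgD(1)[OF assms] order_refl LalgD(2)[OF assms]]
      by (rule L2_set_le_sum_abs)
    also have "\<dots> \<le> (\<Sum>s\<in>supp a. K s)" by (intro sum_mono) (auto simp: fib_def K)
    finally show ?thesis .
  qed
  then show ?thesis by blast
qed

lemma L_inner_bounded:
  assumes "a \<in> Lalg"
  shows "\<exists>K. \<forall>p. cmod (L_inner a a p) \<le> K"
proof -
  obtain K where K: "\<And>p. L_fnorm a p \<le> K" using L_fnorm_bounded[OF assms] by auto
  have "cmod (L_inner a a p) \<le> K * K" for p
    using L_inner_CS[OF assms assms, of p] mult_mono[OF K[of p] K[of p]] L_fnorm_nonneg[OF assms, of p] K[of p]
    by linarith
  then show ?thesis by blast
qed

lemma L_fnorm_le_norm: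
  assumes "a \<in> Lalg"
  shows "L_fnorm a p \<le> L_norm a"
proof -
  obtain K where "\<And>p. cmod (L_inner a a p) \<le> K" using L_inner_bounded[OF assms] by auto
  from supnorm_upper[OF this] have "Re (L_inner a a p) \<le> supnorm (L_inner a a)"
    by (rule order_trans[OF complex_Re_le_cmod])
  then show ?thesis unfolding L_fnorm_def L_norm_def by simp
qed

lemma L_norm_leI:
  assumes "a \<in> Lalg" "C \<ge> 0" "\<And>p. L_fnorm a p \<le> C"
  shows "L_norm a \<le> C"
proof -
  have "supnorm (L_inner a a) \<le> C\<^sup>2"
    by (rule supnorm_least)
      (use L_inner_self_real[OF assms(1)] L_fnorm_nonneg[OF assms(1)] assms(3)
        in \<open>simp add: norm_power power_mono\<close>)
  then show ?thesis unfolding L_norm_def using assms(2) by (simp add: real_le_lsqrt)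
qed

lemma L_norm_nonneg: "a \<in> Lalg \<Longrightarrow> L_norm a \<ge> 0"
  using L_fnorm_le_norm[of a undefined] L_fnorm_nonneg[of a undefined] by linarith

lemma L_norm_add:
  assumes a: "a \<in> Lalg" and b: "b \<in> Lalg"
  shows "L_norm (L_add a b) \<le> L_norm a + L_norm b"
proof (rule L_norm_leI[OF Lalg_add[OF a b]])
  show "L_norm a + L_norm b \<ge> 0" by (rule add_nonneg_nonneg[OF L_norm_nonneg[OF a] L_norm_nonneg[OF b]])
  fix p
  have "L_fnorm a p + L_fnorm b p \<le> L_norm a + L_norm b"
    by (rule add_mono[OF L_fnorm_le_norm[OF a] L_fnorm_le_norm[OF b]])
  then show "L_fnorm (L_add a b) p \<le> L_norm a + L_norm b"
    using L_fnorm_add[OF a b, of p] by linarith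
qed

lemma L_norm_scale_le:
  assumes "a \<in> Lalg"
  shows "L_norm (L_scale c a) \<le> cmod c * L_norm a"
  using L_fnorm_le_norm[OF assms] L_norm_nonneg[OF assms]
  by (intro L_norm_leI Lalg_scale assms) (auto simp: L_fnorm_scale assms mult_left_mono)

lemma L_dist_triangle:
  assumes "a \<in> Lalg" "b \<in> Lalg" "c \<in> Lalg"
  shows "L_dist a c \<le> L_dist a b + L_dist b c"
  using L_norm_add[OF Lalg_diff[OF assms(1,2)] Lalg_diff[OF assms(2,3)]] by (simp add: L_dist_eq)

lemma L_dist_commute: "a \<in> Lalg \<Longrightarrow> b \<in> Lalg \<Longrightarrow> L_dist a b = L_dist b a"
  using L_norm_scale_le[OF Lalg_diff, of a b "-1"] L_norm_scale_le[OF Lalg_diff, of b a "-1"]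
  by (simp add: L_dist_eq)

lemma L_norm_zero: "L_norm (\<lambda>_ _. 0) = 0"
  using L_norm_scale_le[OF Lalg_zero, of 0] L_norm_nonneg[OF Lalg_zero] by simp

lemma L_dist_self: "L_dist a a = 0"
  by (simp add: L_dist_eq L_norm_zero)

lemma L_dist_nonneg: "a \<in> Lalg \<Longrightarrow> b \<in> Lalg \<Longrightarrow> L_dist a b \<ge> 0"
  by (simp add: L_dist_eq L_norm_nonneg Lalg_diff)

lemma L_dist_add:
  assumes "a \<in> Lalg" "b \<in> Lalg" "c \<in> Lalg" "d \<in> Lalg"
  shows "L_dist (L_add a b) (L_add c d) \<le> L_dist a c + L_dist b d"
proof -
  have "L_diff (L_add a b) (L_add c d) = L_add (L_diff a c) (L_diff b d)" by (intro ext) simp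
  then show ?thesis
    using L_norm_add[OF Lalg_diff[OF assms(1,3)] Lalg_diff[OF assms(2,4)]] by (simp only: L_dist_eq)
qed

lemma L_dist_scale:
  assumes "a \<in> Lalg" "b \<in> Lalg"
  shows "L_dist (L_scale c a) (L_scale c b) \<le> cmod c * L_dist a b"
proof -
  have "L_diff (L_scale c a) (L_scale c b) = L_scale c (L_diff a b)"
    by (intro ext) (simp add: right_diff_distrib)
  then show ?thesis
    using L_norm_scale_le[OF Lalg_diff[OF assms]] by (simp only: L_dist_eq)
qed

lemma L_inner_le:
  assumes "a \<in> Lalg" "b \<in> Lalg"
  shows "cmod (L_inner a b p) \<le> L_norm a * L_norm b"
  using L_inner_CS[OF assms, of p] L_fnorm_le_norm[OF assms(1), of p] L_fnorm_le_norm[OF assms(2), of p]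
    L_norm_nonneg[OF assms(1)] L_fnorm_nonneg[OF assms(2), of p]
  by (meson mult_mono order_trans)

lemma L_inner_dist:
  assumes "a \<in> Lalg" "b \<in> Lalg" "c \<in> Lalg" "d \<in> Lalg"
  shows "cmod (L_inner a b p - L_inner c d p) \<le> L_dist a c * L_norm b + L_norm c * L_dist b d"
proof -
  have eq: "L_inner a b p - L_inner c d p = L_inner (L_diff a c) b p + L_inner c (L_diff b d) p"
    using assms by (simp add: L_inner_diff_left L_inner_diff_right)
  then show ?thesis
    using L_inner_le[OF Lalg_diff[OF assms(1,3)] assms(2), of p] L_inner_le[OF assms(3) Lalg_diff[OF assms(2,4)], of p]
      norm_triangle_ineq[of "L_inner (L_diff a c) b p" "L_inner c (L_diff b d) p"]
    unfolding L_dist_eq eq by linarith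
qed

section \<open>Cauchy sequences and their classes\<close>

lemma L_CauchyD:
  assumes "p \<in> L_Cauchy"
  shows "p n \<in> Lalg" "e > 0 \<Longrightarrow> \<exists>N. \<forall>m\<ge>N. \<forall>n\<ge>N. L_dist (p m) (p n) < e"
  using assms by (auto simp: L_Cauchy_def)

lemma L_Cauchy_bounded:
  assumes "p \<in> L_Cauchy"
  shows "\<exists>B>0. \<forall>n. L_norm (p n) \<le> B"
proof -
  note pL = L_CauchyD(1)[OF assms]
  obtain N where N: "\<And>m n. m \<ge> N \<Longrightarrow> n \<ge> N \<Longrightarrow> L_dist (p m) (p n) < 1"
    using L_CauchyD(2)[OF assms, of 1] by auto
  \<comment> \<open>The summand 1 absorbs the tail and makes the bound positive, so that it may be
    divided by.\<close>
  let ?B = "Max ((\<lambda>n. L_norm (p n)) ` {..N}) + 1"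
  have 1: "L_norm (p n) \<le> Max ((\<lambda>n. L_norm (p n)) ` {..N})" if "n \<le> N" for n
    using that by (intro Max_ge) auto
  have "L_norm (p n) \<le> ?B" for n
  proof (cases "n \<le> N")
    case False
    have "L_norm (p n) \<le> L_norm (L_diff (p n) (p N)) + L_norm (p N)"
      using L_norm_add[OF Lalg_diff[OF pL[of n] pL[of N]] pL[of N]] by simp
    moreover have "L_norm (L_diff (p n) (p N)) < 1" using N[of n N] False by (simp add: L_dist_eq)
    ultimately show ?thesis using 1[OF order_refl] by linarith
  qed (use 1[of n] in linarith)
  moreover have "?B > 0" using order_trans[OF L_norm_nonneg[OF pL[of 0]] 1[of 0]] by simp
  ultimately show ?thesis by blast
qed

lemma L_inner_convergent:
  assumes p: "p \<in> L_Cauchy" and q: "q \<in> L_Cauchy"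
  shows "convergent (\<lambda>n. L_inner (p n) (q n) x)"
proof (rule Cauchy_convergent, rule metric_CauchyI)
  fix e :: real assume e: "e > 0"
  obtain A where A: "A > 0" "\<And>n. L_norm (p n) \<le> A" using L_Cauchy_bounded[OF p] by auto
  obtain B where B: "B > 0" "\<And>n. L_norm (q n) \<le> B" using L_Cauchy_bounded[OF q] by auto
  obtain M where M: "\<And>m n. m \<ge> M \<Longrightarrow> n \<ge> M \<Longrightarrow> L_dist (p m) (p n) < e / (2 * B)"
    using L_CauchyD(2)[OF p, of "e / (2 * B)"] e B by auto
  obtain N where N: "\<And>m n. m \<ge> N \<Longrightarrow> n \<ge> N \<Longrightarrow> L_dist (q m) (q n) < e / (2 * A)"
    using L_CauchyD(2)[OF q, of "e / (2 * A)"] e A by auto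
  show "\<exists>K. \<forall>m\<ge>K. \<forall>n\<ge>K. dist (L_inner (p m) (q m) x) (L_inner (p n) (q n) x) < e"
  proof (intro exI allI impI)
    fix m n assume mn: "m \<ge> max M N" "n \<ge> max M N"
    note L = L_CauchyD(1)[OF p] L_CauchyD(1)[OF q]
    have "L_dist (p m) (p n) * L_norm (q m) \<le> L_dist (p m) (p n) * B"
      using B L L_dist_nonneg by (intro mult_left_mono) auto
    also have "\<dots> < e / (2 * B) * B" using M[of m n] mn B by (intro mult_strict_right_mono) auto
    finally have 1: "L_dist (p m) (p n) * L_norm (q m) < e / 2" using B by simp
    have "L_norm (p n) * L_dist (q m) (q n) \<le> A * L_dist (q m) (q n)"
      using A L L_dist_nonneg by (intro mult_right_mono) auto
    also have "\<dots> < A * (e / (2 * A))" using N[of m n] mn A by (intro mult_strict_left_mono) auto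
    finally have "L_norm (p n) * L_dist (q m) (q n) < e / 2" using A by simp
    then show "dist (L_inner (p m) (q m) x) (L_inner (p n) (q n) x) < e"
      using 1 L_inner_dist[OF L(1)[of m] L(2)[of m] L(1)[of n] L(2)[of n], of x]
      unfolding dist_norm by linarith
  qed
qed

lemma L_equivD:
  assumes "(p, q) \<in> L_equiv"
  shows "p \<in> L_Cauchy" "q \<in> L_Cauchy" "(\<lambda>n. L_dist (p n) (q n)) \<longlonglongrightarrow> 0"
  using assms by (auto simp: L_equiv_def)

lemma L_inner_equiv:
  assumes p: "(p, p') \<in> L_equiv" and q: "(q, q') \<in> L_equiv"
  shows "(\<lambda>n. L_inner (p n) (q n) x - L_inner (p' n) (q' n) x) \<longlonglongrightarrow> 0"
proof -
  note P = L_equivD[OF p] and Q = L_equivD[OF q]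
  obtain A where A: "\<And>n. L_norm (p' n) \<le> A" using L_Cauchy_bounded[OF P(2)] by auto
  obtain B where B: "\<And>n. L_norm (q n) \<le> B" using L_Cauchy_bounded[OF Q(1)] by auto
  note L = P(1,2)[THEN L_CauchyD(1)] Q(1,2)[THEN L_CauchyD(1)]
  show ?thesis
  proof (rule tendsto_zero_sandwich)
    show "cmod (L_inner (p n) (q n) x - L_inner (p' n) (q' n) x) \<le>
      L_dist (p n) (p' n) * B + A * L_dist (q n) (q' n)" for n
      using L_inner_dist[OF L(1)[of n] L(3)[of n] L(2)[of n] L(4)[of n], of x]
        mult_left_mono[OF B[of n] L_dist_nonneg[OF L(1)[of n] L(2)[of n]]]
        mult_right_mono[OF A[of n] L_dist_nonneg[OF L(3)[of n] L(4)[of n]]] by linarith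
    show "(\<lambda>n. L_dist (p n) (p' n) * B + A * L_dist (q n) (q' n)) \<longlonglongrightarrow> 0"
      using tendsto_add[OF tendsto_mult_left_zero[OF P(3), of B] tendsto_mult_right_zero[OF Q(3), of A]]
      by simp
  qed
qed

lemma equiv_L: "equiv L_Cauchy L_equiv"
proof (rule equivI)
  show "L_equiv \<subseteq> L_Cauchy \<times> L_Cauchy" by (auto simp: L_equiv_def)
  show "refl_on L_Cauchy L_equiv" by (rule refl_onI) (auto simp: L_equiv_def L_dist_self)
  show "sym L_equiv" by (rule symI) (auto simp: L_equiv_def L_CauchyD L_dist_commute[OF L_CauchyD(1) L_CauchyD(1)])
  show "trans L_equiv"
  proof (rule transI)
    fix p q r assume pq: "(p, q) \<in> L_equiv" and qr: "(q, r) \<in> L_equiv"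
    note L = L_equivD(1)[OF pq, THEN L_CauchyD(1)] L_equivD(1,2)[OF qr, THEN L_CauchyD(1)]
    have "(\<lambda>n. L_dist (p n) (r n)) \<longlonglongrightarrow> 0"
    proof (rule tendsto_zero_sandwich)
      show "(\<lambda>n. L_dist (p n) (q n) + L_dist (q n) (r n)) \<longlonglongrightarrow> 0"
        using tendsto_add[OF L_equivD(3)[OF pq] L_equivD(3)[OF qr]] by simp
    qed (use L in \<open>auto simp: L_dist_nonneg L_dist_triangle\<close>)
    then show "(p, r) \<in> L_equiv" using pq qr by (auto simp: L_equiv_def)
  qed
qed

lemma cls_in [simp]: "p \<in> L_Cauchy \<Longrightarrow> cls p \<in> ell2"
  unfolding ell2_def cls_def by (rule quotientI)

lemma ell2_cases:
  assumes "\<xi> \<in> ell2"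
  obtains p where "p \<in> L_Cauchy" "\<xi> = cls p"
  using assms unfolding ell2_def cls_def by (rule quotientE) auto

lemma cls_eq_iff: "p \<in> L_Cauchy \<Longrightarrow> q \<in> L_Cauchy \<Longrightarrow> cls p = cls q \<longleftrightarrow> (p, q) \<in> L_equiv"
  unfolding cls_def by (rule eq_equiv_class_iff[OF equiv_L])

text \<open>The choice made by \<open>rep\<close> is controlled only up to a null sequence; all
  later use of \<open>rep\<close> goes through this fact.\<close>

lemma rep_equiv: "p \<in> L_Cauchy \<Longrightarrow> (p, rep (cls p)) \<in> L_equiv"
proof -
  assume "p \<in> L_Cauchy"
  then have "p \<in> cls p" unfolding cls_def by (rule equiv_class_self[OF equiv_L])
  then have "rep (cls p) \<in> cls p" unfolding rep_def by (rule someI[of "\<lambda>q. q \<in> cls p"])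
  then show ?thesis by (simp add: cls_def)
qed

text \<open>Working form of the inner product: the \<open>lim\<close> is a genuine limit, and any
  representatives compute it.\<close>

lemma ell2_inner_tendsto:
  assumes "p \<in> L_Cauchy" "q \<in> L_Cauchy"
  shows "(\<lambda>n. L_inner (p n) (q n) x) \<longlonglongrightarrow> ell2_inner (cls p) (cls q) x"
proof -
  note e = rep_equiv[OF assms(1)] rep_equiv[OF assms(2)]
  have "(\<lambda>n. L_inner (rep (cls p) n) (rep (cls q) n) x) \<longlonglongrightarrow> ell2_inner (cls p) (cls q) x"
    unfolding ell2_inner_def
    using L_inner_convergent[OF L_equivD(2)[OF e(1)] L_equivD(2)[OF e(2)]] by (simp add: convergent_LIMSEQ_iff)
  from tendsto_add[OF this L_inner_equiv[OF e, of x]] show ?thesis by simp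
qed

lemma L_Cauchy_add:
  assumes "p \<in> L_Cauchy" "q \<in> L_Cauchy"
  shows "(\<lambda>n. L_add (p n) (q n)) \<in> L_Cauchy"
  unfolding L_Cauchy_def
proof (intro CollectI conjI allI impI)
  note L = assms[THEN L_CauchyD(1)]
  show "L_add (p n) (q n) \<in> Lalg" for n using L by (intro Lalg_add)
  fix e :: real assume "e > 0"
  then have e: "e / 2 > 0" by simp
  obtain M where M: "\<And>m n. m \<ge> M \<Longrightarrow> n \<ge> M \<Longrightarrow> L_dist (p m) (p n) < e / 2"
    using L_CauchyD(2)[OF assms(1) e] by auto
  obtain N where N: "\<And>m n. m \<ge> N \<Longrightarrow> n \<ge> N \<Longrightarrow> L_dist (q m) (q n) < e / 2"
    using L_CauchyD(2)[OF assms(2) e] by auto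
  show "\<exists>K. \<forall>m\<ge>K. \<forall>n\<ge>K. L_dist (L_add (p m) (q m)) (L_add (p n) (q n)) < e"
  proof (intro exI allI impI)
    fix m n assume "m \<ge> max M N" "n \<ge> max M N"
    then show "L_dist (L_add (p m) (q m)) (L_add (p n) (q n)) < e"
      using L_dist_add[OF L(1)[of m] L(2)[of m] L(1)[of n] L(2)[of n]] M[of m n] N[of m n] by simp
  qed
qed

lemma L_Cauchy_lipschitz:
  assumes p: "p \<in> L_Cauchy" and f: "\<And>a. a \<in> Lalg \<Longrightarrow> f a \<in> Lalg"
    and le: "\<And>a b. a \<in> Lalg \<Longrightarrow> b \<in> Lalg \<Longrightarrow> L_dist (f a) (f b) \<le> K * L_dist a b"
  shows "(\<lambda>n. f (p n)) \<in> L_Cauchy"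
  unfolding L_Cauchy_def
proof (intro CollectI conjI allI impI)
  note L = L_CauchyD(1)[OF p]
  show "f (p n) \<in> Lalg" for n using L f by blast
  fix e :: real assume e: "e > 0"
  \<comment> \<open>\<open>K\<close> may be 0 or negative, whereas \<open>K'\<close> is positive and
    can be divided by.\<close>
  define K' where "K' = \<bar>K\<bar> + 1"
  have "e / K' > 0" using e by (simp add: K'_def)
  then obtain M where M: "\<And>m n. m \<ge> M \<Longrightarrow> n \<ge> M \<Longrightarrow> L_dist (p m) (p n) < e / K'"
    using L_CauchyD(2)[OF p] by metis
  have "L_dist (f (p m)) (f (p n)) < e" if "m \<ge> M" "n \<ge> M" for m n
  proof -
    have "L_dist (f (p m)) (f (p n)) \<le> K * L_dist (p m) (p n)" using le L by blast
    also have "\<dots> \<le> K' * L_dist (p m) (p n)"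
      using L_dist_nonneg[OF L L] by (intro mult_right_mono) (auto simp: K'_def)
    also have "\<dots> < K' * (e / K')" using M[OF that] by (intro mult_strict_left_mono) (auto simp: K'_def)
    also have "\<dots> = e" by (simp add: K'_def)
    finally show ?thesis .
  qed
  then show "\<exists>M. \<forall>m\<ge>M. \<forall>n\<ge>M. L_dist (f (p m)) (f (p n)) < e" by blast
qed

text \<open>Source of the well-definedness of \<open>ell2_scale\<close> and
  \<open>left_mult\<close>: the Lipschitz bound keeps the null difference between p and its chosen
  representative null.\<close>

lemma cls_lipschitz:
  assumes p: "p \<in> L_Cauchy" and f: "\<And>a. a \<in> Lalg \<Longrightarrow> f a \<in> Lalg"
    and le: "\<And>a b. a \<in> Lalg \<Longrightarrow> b \<in> Lalg \<Longrightarrow> L_dist (f a) (f b) \<le> K * L_dist a b"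
  shows "cls (\<lambda>n. f (rep (cls p) n)) = cls (\<lambda>n. f (p n))"
proof -
  note e = rep_equiv[OF p]
  have "(\<lambda>n. f (q n)) \<in> L_Cauchy" if "q \<in> L_Cauchy" for q
    by (rule L_Cauchy_lipschitz[OF that]) (erule f, erule (1) le)
  note C = this[OF L_equivD(1)[OF e]] this[OF L_equivD(2)[OF e]]
  note L = L_equivD(1,2)[OF e, THEN L_CauchyD(1)]
  have "(\<lambda>n. L_dist (f (p n)) (f (rep (cls p) n))) \<longlonglongrightarrow> 0"
  proof (rule tendsto_zero_sandwich)
    show "(\<lambda>n. K * L_dist (p n) (rep (cls p) n)) \<longlonglongrightarrow> 0"
      using tendsto_mult_right_zero[OF L_equivD(3)[OF e]] .
  qed (use L f le in \<open>auto simp: L_dist_nonneg\<close>)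
  then have "(\<lambda>n. f (p n), \<lambda>n. f (rep (cls p) n)) \<in> L_equiv"
    by (simp add: L_equiv_def C)
  from cls_eq_iff[OF C, THEN iffD2, OF this] show ?thesis by (rule sym)
qed

lemma L_Cauchy_scale: "p \<in> L_Cauchy \<Longrightarrow> (\<lambda>n. L_scale c (p n)) \<in> L_Cauchy"
  by (rule L_Cauchy_lipschitz[OF _ Lalg_scale L_dist_scale])

lemma ell2_scale_cls: "p \<in> L_Cauchy \<Longrightarrow> ell2_scale c (cls p) = cls (\<lambda>n. L_scale c (p n))"
  unfolding ell2_scale_def by (rule cls_lipschitz[OF _ Lalg_scale L_dist_scale])

lemma ell2_plus_cls:
  assumes p: "p \<in> L_Cauchy" and q: "q \<in> L_Cauchy"
  shows "ell2_plus (cls p) (cls q) = cls (\<lambda>n. L_add (p n) (q n))"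
proof -
  note e = rep_equiv[OF p] rep_equiv[OF q]
  note C = L_equivD(1,2)[OF e(1)] L_equivD(1,2)[OF e(2)]
  note L = C[THEN L_CauchyD(1)]
  have "(\<lambda>n. L_dist (L_add (p n) (q n)) (L_add (rep (cls p) n) (rep (cls q) n))) \<longlonglongrightarrow> 0"
  proof (rule tendsto_zero_sandwich)
    show "(\<lambda>n. L_dist (p n) (rep (cls p) n) + L_dist (q n) (rep (cls q) n)) \<longlonglongrightarrow> 0"
      using tendsto_add[OF L_equivD(3)[OF e(1)] L_equivD(3)[OF e(2)]] by simp
  qed (use L in \<open>auto simp: L_dist_nonneg L_dist_add Lalg_add\<close>)
  then have "(\<lambda>n. L_add (p n) (q n), \<lambda>n. L_add (rep (cls p) n) (rep (cls q) n)) \<in> L_equiv"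
    by (simp add: L_equiv_def L_Cauchy_add[OF C(1,3)] L_Cauchy_add[OF C(2,4)])
  from cls_eq_iff[OF L_Cauchy_add[OF C(1,3)] L_Cauchy_add[OF C(2,4)], THEN iffD2, OF this]
  show ?thesis unfolding ell2_plus_def by (rule sym)
qed

lemma ell2_plus_in [simp]:
  assumes "\<xi> \<in> ell2" "\<eta> \<in> ell2"
  shows "ell2_plus \<xi> \<eta> \<in> ell2"
proof -
  obtain p q where p: "p \<in> L_Cauchy" "\<xi> = cls p" and q: "q \<in> L_Cauchy" "\<eta> = cls q"
    using assms by (metis ell2_cases)
  show ?thesis unfolding p(2) q(2) ell2_plus_cls[OF p(1) q(1)] by (rule cls_in[OF L_Cauchy_add[OF p(1) q(1)]])
qed

lemma ell2_scale_in [simp]: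
  assumes "\<xi> \<in> ell2"
  shows "ell2_scale c \<xi> \<in> ell2"
proof -
  obtain p where p: "p \<in> L_Cauchy" "\<xi> = cls p" using assms by (rule ell2_cases)
  show ?thesis unfolding p(2) ell2_scale_cls[OF p(1)] by (rule cls_in[OF L_Cauchy_scale[OF p(1)]])
qed

section \<open>Inner product and norms on the completion\<close>

lemma ell2_inner_cnj:
  assumes "\<xi> \<in> ell2" "\<eta> \<in> ell2"
  shows "ell2_inner \<eta> \<xi> x = cnj (ell2_inner \<xi> \<eta> x)"
proof -
  obtain p q where p: "p \<in> L_Cauchy" "\<xi> = cls p" and q: "q \<in> L_Cauchy" "\<eta> = cls q"
    using assms by (metis ell2_cases)
  have "(\<lambda>n. L_inner (q n) (p n) x) \<longlonglongrightarrow> cnj (ell2_inner \<xi> \<eta> x)"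
    using tendsto_cnj[OF ell2_inner_tendsto[OF p(1) q(1), of x]] p q
    by (simp add: L_inner_cnj[OF L_CauchyD(1)[OF p(1)] L_CauchyD(1)[OF q(1)]])
  from LIMSEQ_unique[OF ell2_inner_tendsto[OF q(1) p(1), of x] this] show ?thesis by (simp only: p q)
qed

lemma ell2_inner_plus_right:
  assumes "\<xi> \<in> ell2" "\<eta> \<in> ell2" "\<zeta> \<in> ell2"
  shows "ell2_inner \<zeta> (ell2_plus \<xi> \<eta>) x = ell2_inner \<zeta> \<xi> x + ell2_inner \<zeta> \<eta> x"
proof -
  obtain p q r where p: "p \<in> L_Cauchy" "\<xi> = cls p" and q: "q \<in> L_Cauchy" "\<eta> = cls q"
    and r: "r \<in> L_Cauchy" "\<zeta> = cls r"
    using assms by (metis ell2_cases)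
  note L = p(1)[THEN L_CauchyD(1)] q(1)[THEN L_CauchyD(1)] r(1)[THEN L_CauchyD(1)]
  have 1: "(\<lambda>n. L_inner (r n) (L_add (p n) (q n)) x) \<longlonglongrightarrow>
      ell2_inner (cls r) (cls p) x + ell2_inner (cls r) (cls q) x"
    unfolding L_inner_add_right[OF L(3,1,2)]
    by (rule tendsto_add[OF ell2_inner_tendsto[OF r(1) p(1)] ell2_inner_tendsto[OF r(1) q(1)]])
  show ?thesis
    unfolding p(2) q(2) r(2) ell2_plus_cls[OF p(1) q(1)]
    by (rule LIMSEQ_unique[OF ell2_inner_tendsto[OF r(1) L_Cauchy_add[OF p(1) q(1)]] 1])
qed

lemma ell2_inner_scale_right:
  assumes "\<xi> \<in> ell2" "\<zeta> \<in> ell2"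
  shows "ell2_inner \<zeta> (ell2_scale c \<xi>) x = c * ell2_inner \<zeta> \<xi> x"
proof -
  obtain p r where p: "p \<in> L_Cauchy" "\<xi> = cls p" and r: "r \<in> L_Cauchy" "\<zeta> = cls r"
    using assms by (metis ell2_cases)
  note L = p(1)[THEN L_CauchyD(1)] r(1)[THEN L_CauchyD(1)]
  have 1: "(\<lambda>n. L_inner (r n) (L_scale c (p n)) x) \<longlonglongrightarrow> c * ell2_inner (cls r) (cls p) x"
    unfolding L_inner_scale_right[OF L(2,1)]
    by (rule tendsto_mult_left[OF ell2_inner_tendsto[OF r(1) p(1)]])
  show ?thesis
    unfolding p(2) r(2) ell2_scale_cls[OF p(1)]
    by (rule LIMSEQ_unique[OF ell2_inner_tendsto[OF r(1) L_Cauchy_scale[OF p(1)]] 1])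
qed

lemma ell2_inner_plus_left:
  assumes "\<xi> \<in> ell2" "\<eta> \<in> ell2" "\<zeta> \<in> ell2"
  shows "ell2_inner (ell2_plus \<xi> \<eta>) \<zeta> x = ell2_inner \<xi> \<zeta> x + ell2_inner \<eta> \<zeta> x"
  using ell2_inner_plus_right[OF assms, of x] assms
    ell2_inner_cnj[OF assms(3), of "ell2_plus \<xi> \<eta>" x] ell2_inner_cnj[OF assms(3,1), of x]
    ell2_inner_cnj[OF assms(3,2), of x] by simp

lemma ell2_inner_scale_left:
  assumes "\<xi> \<in> ell2" "\<zeta> \<in> ell2"
  shows "ell2_inner (ell2_scale c \<xi>) \<zeta> x = cnj c * ell2_inner \<xi> \<zeta> x"
  using ell2_inner_scale_right[OF assms, of c x] assms
    ell2_inner_cnj[OF assms(2), of "ell2_scale c \<xi>" x] ell2_inner_cnj[OF assms(2,1), of x] by simp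

text \<open>The fibre norm survives completion as a pointwise limit of \<open>L_fnorm\<close>, so
  scalar inequalities pass to the limit separately at each x.\<close>

definition ell2_fnorm :: "(nat \<Rightarrow> 'a \<Rightarrow> 'x \<Rightarrow> complex) set \<Rightarrow> 'x \<Rightarrow> real" where
  "ell2_fnorm \<xi> x = sqrt (Re (ell2_inner \<xi> \<xi> x))"

lemma L_fnorm_tendsto:
  assumes "p \<in> L_Cauchy"
  shows "(\<lambda>n. L_fnorm (p n) x) \<longlonglongrightarrow> ell2_fnorm (cls p) x"
  unfolding L_fnorm_def ell2_fnorm_def
  by (intro tendsto_intros ell2_inner_tendsto assms)

lemma ell2_fnorm_nonneg:
  assumes "\<xi> \<in> ell2"
  shows "ell2_fnorm \<xi> x \<ge> 0"
proof -
  obtain p where p: "p \<in> L_Cauchy" "\<xi> = cls p" using assms by (rule ell2_cases)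
  show ?thesis unfolding p(2)
    using L_fnorm_nonneg[OF L_CauchyD(1)[OF p(1)]] by (intro LIMSEQ_le_const[OF L_fnorm_tendsto[OF p(1)]]) blast
qed

lemma ell2_inner_self_real:
  assumes "\<xi> \<in> ell2"
  shows "ell2_inner \<xi> \<xi> x = of_real ((ell2_fnorm \<xi> x)\<^sup>2)"
proof -
  obtain p where p: "p \<in> L_Cauchy" "\<xi> = cls p" using assms by (rule ell2_cases)
  have "(\<lambda>n. L_inner (p n) (p n) x) \<longlonglongrightarrow> of_real ((ell2_fnorm (cls p) x)\<^sup>2)"
    unfolding L_inner_self_real[OF L_CauchyD(1)[OF p(1)]]
    by (intro tendsto_intros L_fnorm_tendsto p)
  from LIMSEQ_unique[OF ell2_inner_tendsto[OF p(1) p(1), of x] this] show ?thesis by (simp only: p)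
qed

lemma ell2_inner_CS:
  assumes "\<xi> \<in> ell2" "\<eta> \<in> ell2"
  shows "cmod (ell2_inner \<xi> \<eta> x) \<le> ell2_fnorm \<xi> x * ell2_fnorm \<eta> x"
proof -
  obtain p q where p: "p \<in> L_Cauchy" "\<xi> = cls p" and q: "q \<in> L_Cauchy" "\<eta> = cls q"
    using assms by (metis ell2_cases)
  show ?thesis unfolding p(2) q(2)
    by (rule LIMSEQ_le[OF tendsto_norm[OF ell2_inner_tendsto[OF p(1) q(1)]]
      tendsto_mult[OF L_fnorm_tendsto[OF p(1)] L_fnorm_tendsto[OF q(1)]]])
     (use L_inner_CS[OF L_CauchyD(1)[OF p(1)] L_CauchyD(1)[OF q(1)]] in blast)
qed

lemma ell2_fnorm_plus:
  assumes "\<xi> \<in> ell2" "\<eta> \<in> ell2"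
  shows "ell2_fnorm (ell2_plus \<xi> \<eta>) x \<le> ell2_fnorm \<xi> x + ell2_fnorm \<eta> x"
proof -
  obtain p q where p: "p \<in> L_Cauchy" "\<xi> = cls p" and q: "q \<in> L_Cauchy" "\<eta> = cls q"
    using assms by (metis ell2_cases)
  show ?thesis unfolding p(2) q(2) ell2_plus_cls[OF p(1) q(1)]
    by (rule LIMSEQ_le[OF L_fnorm_tendsto[OF L_Cauchy_add[OF p(1) q(1)]]
      tendsto_add[OF L_fnorm_tendsto[OF p(1)] L_fnorm_tendsto[OF q(1)]]])
     (use L_fnorm_add[OF L_CauchyD(1)[OF p(1)] L_CauchyD(1)[OF q(1)]] in blast)
qed

lemma ell2_fnorm_scale:
  assumes "\<xi> \<in> ell2"
  shows "ell2_fnorm (ell2_scale c \<xi>) x = cmod c * ell2_fnorm \<xi> x"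
proof -
  obtain p where p: "p \<in> L_Cauchy" "\<xi> = cls p" using assms by (rule ell2_cases)
  show ?thesis unfolding p(2) ell2_scale_cls[OF p(1)]
    by (rule LIMSEQ_unique[OF L_fnorm_tendsto[OF L_Cauchy_scale[OF p(1)]]],
      unfold L_fnorm_scale[OF L_CauchyD(1)[OF p(1)]],
      rule tendsto_mult_left[OF L_fnorm_tendsto[OF p(1)]])
qed

lemma ell2_fnorm_le_norm:
  assumes "\<xi> \<in> ell2"
  shows "ell2_fnorm \<xi> x \<le> ell2_norm \<xi>"
proof -
  obtain p where p: "p \<in> L_Cauchy" "\<xi> = cls p" using assms by (rule ell2_cases)
  obtain B where B: "B > 0" "\<And>n. L_norm (p n) \<le> B" using L_Cauchy_bounded[OF p(1)] by auto
  have "ell2_fnorm \<xi> x \<le> B" for x unfolding p(2)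
    using L_fnorm_le_norm[OF L_CauchyD(1)[OF p(1)]] B
    by (intro LIMSEQ_le_const2[OF L_fnorm_tendsto[OF p(1)]]) (meson order_trans)
  then have "cmod (ell2_inner \<xi> \<xi> x) \<le> B\<^sup>2" for x
    using ell2_inner_self_real[OF assms] ell2_fnorm_nonneg[OF assms] by (simp add: norm_power power_mono)
  from supnorm_upper[OF this] have "Re (ell2_inner \<xi> \<xi> x) \<le> supnorm (ell2_inner \<xi> \<xi>)"
    by (rule order_trans[OF complex_Re_le_cmod])
  then show ?thesis unfolding ell2_fnorm_def ell2_norm_def by simp
qed

lemma ell2_norm_leI:
  assumes "\<xi> \<in> ell2" "C \<ge> 0" "\<And>x. ell2_fnorm \<xi> x \<le> C"
  shows "ell2_norm \<xi> \<le> C"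
proof -
  have "supnorm (ell2_inner \<xi> \<xi>) \<le> C\<^sup>2"
    by (rule supnorm_least)
      (use ell2_inner_self_real[OF assms(1)] ell2_fnorm_nonneg[OF assms(1)] assms(3)
        in \<open>simp add: norm_power power_mono\<close>)
  then show ?thesis unfolding ell2_norm_def using assms(2) by (simp add: real_le_lsqrt)
qed

lemma ell2_norm_nonneg: "\<xi> \<in> ell2 \<Longrightarrow> ell2_norm \<xi> \<ge> 0"
  using ell2_fnorm_le_norm[of \<xi> undefined] ell2_fnorm_nonneg[of \<xi> undefined] by linarith

lemma ell2_inner_le:
  assumes "\<xi> \<in> ell2" "\<eta> \<in> ell2"
  shows "cmod (ell2_inner \<xi> \<eta> x) \<le> ell2_norm \<xi> * ell2_norm \<eta>"
  using ell2_inner_CS[OF assms, of x] ell2_fnorm_le_norm[OF assms(1), of x] ell2_fnorm_le_norm[OF assms(2), of x]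
    ell2_norm_nonneg[OF assms(1)] ell2_fnorm_nonneg[OF assms(2), of x]
  by (meson mult_mono order_trans)

lemma ell2_norm_plus:
  assumes "\<xi> \<in> ell2" "\<eta> \<in> ell2"
  shows "ell2_norm (ell2_plus \<xi> \<eta>) \<le> ell2_norm \<xi> + ell2_norm \<eta>"
proof (rule ell2_norm_leI)
  show "ell2_fnorm (ell2_plus \<xi> \<eta>) x \<le> ell2_norm \<xi> + ell2_norm \<eta>" for x
    using ell2_fnorm_plus[OF assms] add_mono[OF ell2_fnorm_le_norm[OF assms(1)] ell2_fnorm_le_norm[OF assms(2)]]
    by (rule order_trans)
qed (use assms in \<open>simp_all add: ell2_norm_nonneg\<close>)

lemma ell2_norm_scale:
  assumes "\<xi> \<in> ell2"
  shows "ell2_norm (ell2_scale c \<xi>) = cmod c * ell2_norm \<xi>"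
proof (rule antisym)
  show le: "ell2_norm (ell2_scale c \<xi>) \<le> cmod c * ell2_norm \<xi>" for c
    using ell2_fnorm_le_norm[OF assms] ell2_norm_nonneg[OF assms] assms
    by (intro ell2_norm_leI) (auto simp: ell2_fnorm_scale mult_left_mono)
  show "cmod c * ell2_norm \<xi> \<le> ell2_norm (ell2_scale c \<xi>)"
  proof (cases "c = 0")
    case False
    have "ell2_fnorm \<xi> x \<le> ell2_norm (ell2_scale c \<xi>) / cmod c" for x
      using ell2_fnorm_le_norm[of "ell2_scale c \<xi>" x] assms False
      by (simp add: ell2_fnorm_scale field_simps)
    then have "ell2_norm \<xi> \<le> ell2_norm (ell2_scale c \<xi>) / cmod c"
      using assms ell2_norm_nonneg[of "ell2_scale c \<xi>"] by (intro ell2_norm_leI) auto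
    then show ?thesis using False by (simp add: field_simps)
  qed (use assms ell2_norm_nonneg[of "ell2_scale c \<xi>"] in simp)
qed

lemma ell2_norm_cls_le:
  assumes "r \<in> L_Cauchy" "\<And>n. n \<ge> N \<Longrightarrow> L_norm (r n) \<le> e" "e \<ge> 0"
  shows "ell2_norm (cls r) \<le> e"
proof (rule ell2_norm_leI)
  fix x
  show "ell2_fnorm (cls r) x \<le> e"
    using L_fnorm_le_norm[OF L_CauchyD(1)[OF assms(1)]] assms(2)
    by (intro LIMSEQ_le_const2[OF L_fnorm_tendsto[OF assms(1)]]) (meson order_trans)
qed (use assms in auto)

section \<open>Embedded finite sums, nondegeneracy and completeness\<close>

definition ell2_zero :: "(nat \<Rightarrow> 'a \<Rightarrow> 'x \<Rightarrow> complex) set" where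
  "ell2_zero = cls (\<lambda>_ _ _. 0)"

definition emb :: "('a \<Rightarrow> 'x \<Rightarrow> complex) \<Rightarrow> (nat \<Rightarrow> 'a \<Rightarrow> 'x \<Rightarrow> complex) set" where
  "emb a = cls (\<lambda>_. a)"

definition ell2_minus where
  "ell2_minus \<xi> \<eta> = ell2_plus \<xi> (ell2_scale (-1) \<eta>)"

lemma L_Cauchy_const: "a \<in> Lalg \<Longrightarrow> (\<lambda>_. a) \<in> L_Cauchy"
  by (simp add: L_Cauchy_def L_dist_self)

lemma emb_in [simp]: "a \<in> Lalg \<Longrightarrow> emb a \<in> ell2"
  by (simp add: emb_def L_Cauchy_const)

lemma ell2_zero_emb: "ell2_zero = emb (\<lambda>_ _. 0)"
  by (simp add: ell2_zero_def emb_def)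

lemma ell2_zero_in [simp]: "ell2_zero \<in> ell2"
  by (simp add: ell2_zero_emb Lalg_zero)

lemma ell2_minus_in [simp]: "\<xi> \<in> ell2 \<Longrightarrow> \<eta> \<in> ell2 \<Longrightarrow> ell2_minus \<xi> \<eta> \<in> ell2"
  by (simp add: ell2_minus_def)

lemma ell2_minus_cls:
  assumes "p \<in> L_Cauchy" "q \<in> L_Cauchy"
  shows "ell2_minus (cls p) (cls q) = cls (\<lambda>n. L_diff (p n) (q n))"
  unfolding ell2_minus_def ell2_scale_cls[OF assms(2)]
    ell2_plus_cls[OF assms(1) L_Cauchy_scale[OF assms(2)]] by simp

lemma L_Cauchy_diff:
  assumes "p \<in> L_Cauchy" "q \<in> L_Cauchy"
  shows "(\<lambda>n. L_diff (p n) (q n)) \<in> L_Cauchy"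
  using L_Cauchy_add[OF assms(1) L_Cauchy_scale[OF assms(2), of "-1"]] by simp

lemma ell2_inner_emb: "a \<in> Lalg \<Longrightarrow> b \<in> Lalg \<Longrightarrow> ell2_inner (emb a) (emb b) x = L_inner a b x"
  using ell2_inner_tendsto[OF L_Cauchy_const[of a] L_Cauchy_const[of b], of x]
  by (simp add: emb_def LIMSEQ_const_iff)

lemma ell2_norm_emb: "a \<in> Lalg \<Longrightarrow> ell2_norm (emb a) = L_norm a"
proof -
  assume "a \<in> Lalg"
  then have "ell2_inner (emb a) (emb a) = L_inner a a" by (intro ext ell2_inner_emb)
  then show ?thesis by (simp add: ell2_norm_def L_norm_def)
qed

lemma emb_minus: "a \<in> Lalg \<Longrightarrow> b \<in> Lalg \<Longrightarrow> ell2_minus (emb a) (emb b) = emb (L_diff a b)"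
  by (simp add: emb_def ell2_minus_cls L_Cauchy_const)

lemma ell2_norm_zero: "ell2_norm ell2_zero = 0"
  by (simp add: ell2_zero_emb ell2_norm_emb L_norm_zero Lalg_zero)

lemma ell2_inner_minus_right:
  assumes "\<xi> \<in> ell2" "\<eta> \<in> ell2" "\<zeta> \<in> ell2"
  shows "ell2_inner \<zeta> (ell2_minus \<xi> \<eta>) x = ell2_inner \<zeta> \<xi> x - ell2_inner \<zeta> \<eta> x"
  using assms by (simp add: ell2_minus_def ell2_inner_plus_right ell2_inner_scale_right)

lemma ell2_inner_minus_left:
  assumes "\<xi> \<in> ell2" "\<eta> \<in> ell2" "\<zeta> \<in> ell2"
  shows "ell2_inner (ell2_minus \<xi> \<eta>) \<zeta> x = ell2_inner \<xi> \<zeta> x - ell2_inner \<eta> \<zeta> x"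
  using assms by (simp add: ell2_minus_def ell2_inner_plus_left ell2_inner_scale_left)

text \<open>Fibre norms that tend to 0 at each x do not by themselves form a null sequence for the
  supremum norm. Here they do, since the difference sequence is Cauchy in that norm.\<close>

lemma ell2_eqI_fnorm:
  assumes "\<xi> \<in> ell2" "\<eta> \<in> ell2" and 0: "\<And>x. ell2_fnorm (ell2_minus \<xi> \<eta>) x = 0"
  shows "\<xi> = \<eta>"
proof -
  obtain p q where p: "p \<in> L_Cauchy" "\<xi> = cls p" and q: "q \<in> L_Cauchy" "\<eta> = cls q"
    using assms by (metis ell2_cases)
  define r where "r = (\<lambda>n. L_diff (p n) (q n))"
  have r: "r \<in> L_Cauchy" using p q by (simp add: r_def L_Cauchy_diff)
  have r0: "(\<lambda>n. L_fnorm (r n) x) \<longlonglongrightarrow> 0" for x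
    using L_fnorm_tendsto[OF r, of x] 0[of x] p q by (simp add: ell2_minus_cls r_def)
  note L = L_CauchyD(1)[OF r]
  have "(\<lambda>n. L_norm (r n)) \<longlonglongrightarrow> 0"
  proof (rule LIMSEQ_I)
    fix e :: real assume e: "e > 0"
    obtain N where N: "\<And>m n. m \<ge> N \<Longrightarrow> n \<ge> N \<Longrightarrow> L_dist (r m) (r n) < e / 2"
      using L_CauchyD(2)[OF r, of "e / 2"] e by auto
    have "L_norm (r n) < e" if n: "n \<ge> N" for n
    proof -
      have "L_fnorm (r n) x \<le> e / 2" for x
      \<comment> \<open>Compare \<open>r n\<close> with \<open>r m\<close> uniformly in x, then let
        m tend to infinity at the fixed x.\<close>
      proof (rule LIMSEQ_le_const[OF tendsto_add[OF r0[of x] tendsto_const, of "e / 2", simplified]])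
        have "L_fnorm (r n) x \<le> L_fnorm (r m) x + e / 2" if "m \<ge> N" for m
          using L_fnorm_add[OF L[of m] Lalg_diff[OF L[of n] L[of m]], of x]
            L_fnorm_le_norm[OF Lalg_diff[OF L[of n] L[of m]], of x] N[OF n that]
          by (simp add: L_dist_eq)
        then show "\<exists>N. \<forall>m\<ge>N. L_fnorm (r n) x \<le> L_fnorm (r m) x + e / 2" by blast
      qed
      then have "L_norm (r n) \<le> e / 2" using e by (intro L_norm_leI L) auto
      then show ?thesis using e by simp
    qed
    then show "\<exists>N. \<forall>n\<ge>N. norm (L_norm (r n) - 0) < e"
      using L_norm_nonneg[OF L] by auto
  qed
  then have "(p, q) \<in> L_equiv" using p q by (simp add: L_equiv_def L_dist_eq r_def)
  then show ?thesis using p q cls_eq_iff by simp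
qed

text \<open>Test with the difference of the two vectors. Vector identities, such as linearity of
  adjointable operators, are obtained from inner products in this way.\<close>

lemma ell2_eqI:
  assumes "\<xi> \<in> ell2" "\<eta> \<in> ell2" "\<And>\<zeta> x. \<zeta> \<in> ell2 \<Longrightarrow> ell2_inner \<xi> \<zeta> x = ell2_inner \<eta> \<zeta> x"
  shows "\<xi> = \<eta>"
proof (rule ell2_eqI_fnorm[OF assms(1,2)])
  show "ell2_fnorm (ell2_minus \<xi> \<eta>) x = 0" for x
    unfolding ell2_fnorm_def using assms by (simp add: ell2_inner_minus_left)
qed

lemma ell2_norm_zeroD:
  assumes "\<xi> \<in> ell2" "ell2_norm \<xi> \<le> 0"
  shows "\<xi> = ell2_zero"
proof (rule ell2_eqI)
  fix \<zeta> x assume z: "\<zeta> \<in> ell2"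
  have "ell2_norm \<xi> = 0" using assms ell2_norm_nonneg by force
  then show "ell2_inner \<xi> \<zeta> x = ell2_inner ell2_zero \<zeta> x"
    using ell2_inner_le[OF assms(1) z, of x] ell2_inner_le[OF ell2_zero_in z, of x] by (simp add: ell2_norm_zero)
qed (use assms in auto)

lemma ell2_dense:
  assumes "\<xi> \<in> ell2" "e > 0"
  obtains a where "a \<in> Lalg" "ell2_norm (ell2_minus \<xi> (emb a)) < e"
proof -
  obtain p where p: "p \<in> L_Cauchy" "\<xi> = cls p" using assms by (metis ell2_cases)
  obtain N where N: "\<And>m n. m \<ge> N \<Longrightarrow> n \<ge> N \<Longrightarrow> L_dist (p m) (p n) < e / 2"
    using L_CauchyD(2)[OF p(1), of "e / 2"] assms by auto
  have "ell2_norm (ell2_minus \<xi> (emb (p N))) \<le> e / 2"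
    unfolding p(2) emb_def ell2_minus_cls[OF p(1) L_Cauchy_const[OF L_CauchyD(1)[OF p(1)]]]
  proof (rule ell2_norm_cls_le)
    show "L_norm (L_diff (p n) (p N)) \<le> e / 2" if "n \<ge> N" for n
      using N[OF that, of N] by (simp add: L_dist_eq)
  qed (use p assms L_Cauchy_const L_CauchyD(1)[OF p(1)] in \<open>auto intro!: L_Cauchy_diff\<close>)
  then show ?thesis using that[of "p N"] assms L_CauchyD(1)[OF p(1)] by simp
qed

lemma ell2_norm_minus_commute:
  assumes "\<xi> \<in> ell2" "\<eta> \<in> ell2"
  shows "ell2_norm (ell2_minus \<xi> \<eta>) = ell2_norm (ell2_minus \<eta> \<xi>)"
proof -
  have "ell2_minus \<xi> \<eta> = ell2_scale (-1) (ell2_minus \<eta> \<xi>)"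
    using assms by (intro ell2_eqI) (auto simp: ell2_inner_minus_left ell2_inner_scale_left)
  then show ?thesis using assms by (simp add: ell2_norm_scale)
qed

lemma ell2_norm_minus_triangle:
  assumes "\<xi> \<in> ell2" "\<eta> \<in> ell2" "\<zeta> \<in> ell2"
  shows "ell2_norm (ell2_minus \<xi> \<zeta>) \<le> ell2_norm (ell2_minus \<xi> \<eta>) + ell2_norm (ell2_minus \<eta> \<zeta>)"
proof -
  have "ell2_minus \<xi> \<zeta> = ell2_plus (ell2_minus \<xi> \<eta>) (ell2_minus \<eta> \<zeta>)"
    using assms by (intro ell2_eqI) (auto simp: ell2_inner_minus_left ell2_inner_plus_left)
  then show ?thesis using assms by (simp add: ell2_norm_plus)
qed

text \<open>Each term is replaced by a finite sum within 1/(n+1). These sums form a Cauchy sequence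
  in \<open>Lalg\<close>, whose class is the limit sought.\<close>

lemma ell2_complete:
  assumes in_ell2: "\<And>n. \<xi> n \<in> ell2"
    and Cauchy: "\<And>e. e > 0 \<Longrightarrow> \<exists>N. \<forall>m\<ge>N. \<forall>n\<ge>N. ell2_norm (ell2_minus (\<xi> m) (\<xi> n)) < e"
  obtains \<eta> where "\<eta> \<in> ell2" "(\<lambda>n. ell2_norm (ell2_minus (\<xi> n) \<eta>)) \<longlonglongrightarrow> 0"
proof -
  have "\<exists>a. a \<in> Lalg \<and> ell2_norm (ell2_minus (\<xi> n) (emb a)) < 1 / real (Suc n)" for n
    using ell2_dense[OF in_ell2[of n], of "1 / real (Suc n)"] by (metis divide_pos_pos of_nat_0_less_iff zero_less_Suc zero_less_one)
  then obtain a where a: "\<And>n. a n \<in> Lalg" "\<And>n. ell2_norm (ell2_minus (\<xi> n) (emb (a n))) < 1 / real (Suc n)"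
    by metis
  have small: "\<exists>N. \<forall>n\<ge>N. 1 / real (Suc n) < e" if e: "e > 0" for e :: real
  proof -
    obtain N where N: "1 / real (Suc N) < e" using e by (rule nat_approx_posE)
    have "1 / real (Suc n) \<le> 1 / real (Suc N)" if "n \<ge> N" for n using that by (simp add: frac_le)
    then show ?thesis using N by (meson order_le_less_trans)
  qed
  have a_eq: "L_dist (a m) (a n) = ell2_norm (ell2_minus (emb (a m)) (emb (a n)))" for m n
    using a by (simp add: emb_minus ell2_norm_emb Lalg_diff L_dist_eq)
  have "a \<in> L_Cauchy" unfolding L_Cauchy_def
  proof (intro CollectI conjI allI impI a(1))
    fix e :: real assume e: "e > 0"
    obtain N where N: "\<And>m n. m \<ge> N \<Longrightarrow> n \<ge> N \<Longrightarrow> ell2_norm (ell2_minus (\<xi> m) (\<xi> n)) < e / 3"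
      using Cauchy[of "e / 3"] e by auto
    obtain M where M: "\<And>n. n \<ge> M \<Longrightarrow> 1 / real (Suc n) < e / 3" using small[of "e / 3"] e by auto
    have "L_dist (a m) (a n) < e" if "m \<ge> max M N" "n \<ge> max M N" for m n
      using ell2_norm_minus_triangle[of "emb (a m)" "\<xi> m" "emb (a n)"]
        ell2_norm_minus_triangle[of "\<xi> m" "\<xi> n" "emb (a n)"] N[of m n] M[of m] M[of n] a(2)[of m] a(2)[of n]
        ell2_norm_minus_commute[of "\<xi> m" "emb (a m)"] that a(1) in_ell2
      unfolding a_eq by simp
    then show "\<exists>N. \<forall>m\<ge>N. \<forall>n\<ge>N. L_dist (a m) (a n) < e" by blast
  qed
  note A = this
  show ?thesis
  proof (rule that[of "cls a"])
    show "cls a \<in> ell2" using A by simp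
    show "(\<lambda>n. ell2_norm (ell2_minus (\<xi> n) (cls a))) \<longlonglongrightarrow> 0"
    proof (rule LIMSEQ_I)
      fix e :: real assume e: "e > 0"
      obtain N where N: "\<And>m n. m \<ge> N \<Longrightarrow> n \<ge> N \<Longrightarrow> L_dist (a m) (a n) < e / 3"
        using L_CauchyD(2)[OF A, of "e / 3"] e by auto
      obtain M where M: "\<And>n. n \<ge> M \<Longrightarrow> 1 / real (Suc n) < e / 3" using small[of "e / 3"] e by auto
      have "ell2_norm (ell2_minus (\<xi> n) (cls a)) < e" if n: "n \<ge> max M N" for n
      proof -
        have "ell2_norm (ell2_minus (emb (a n)) (cls a)) \<le> e / 3"
          unfolding emb_def ell2_minus_cls[OF L_Cauchy_const[OF a(1)] A]
        proof (rule ell2_norm_cls_le)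
          show "L_norm (L_diff (a n) (a m)) \<le> e / 3" if "m \<ge> N" for m
            using N[of n m] that n by (simp add: L_dist_eq)
        qed (use A e L_Cauchy_const[OF a(1)] in \<open>auto intro!: L_Cauchy_diff\<close>)
        then show ?thesis
          using ell2_norm_minus_triangle[of "\<xi> n" "emb (a n)" "cls a"] a(2)[of n] M[of n] n in_ell2 a(1) A e
          by simp
      qed
      then show "\<exists>N. \<forall>n\<ge>N. norm (ell2_norm (ell2_minus (\<xi> n) (cls a)) - 0) < e"
        using ell2_norm_nonneg in_ell2 A by (intro exI[of _ "max M N"]) auto
    qed
  qed
qed

section \<open>Adjointable operators\<close>

abbreviation op_norm :: "((nat \<Rightarrow> 'a \<Rightarrow> 'x \<Rightarrow> complex) set \<Rightarrow> (nat \<Rightarrow> 'a \<Rightarrow> 'x \<Rightarrow> complex) set) \<Rightarrow> real" where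
  "op_norm \<equiv> anorm adjointable_ops"

abbreviation op_dist :: "((nat \<Rightarrow> 'a \<Rightarrow> 'x \<Rightarrow> complex) set \<Rightarrow> (nat \<Rightarrow> 'a \<Rightarrow> 'x \<Rightarrow> complex) set) \<Rightarrow>
    ((nat \<Rightarrow> 'a \<Rightarrow> 'x \<Rightarrow> complex) set \<Rightarrow> (nat \<Rightarrow> 'a \<Rightarrow> 'x \<Rightarrow> complex) set) \<Rightarrow> real" where
  "op_dist \<equiv> adist adjointable_ops"

section \<open>The algebra of adjoints\<close>

lemma is_adjointD:
  assumes "is_adjoint T S"
  shows "\<xi> \<in> ell2 \<Longrightarrow> T \<xi> \<in> ell2" "\<xi> \<in> ell2 \<Longrightarrow> S \<xi> \<in> ell2"
    "\<xi> \<in> ell2 \<Longrightarrow> \<eta> \<in> ell2 \<Longrightarrow> ell2_inner (T \<xi>) \<eta> x = ell2_inner \<xi> (S \<eta>) x"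
    "T \<in> extensional ell2" "S \<in> extensional ell2"
  using assms unfolding is_adjoint_def by (auto simp: PiE_def)

lemma is_adjointI:
  assumes "\<And>\<xi>. \<xi> \<in> ell2 \<Longrightarrow> T \<xi> \<in> ell2" "\<And>\<xi>. \<xi> \<in> ell2 \<Longrightarrow> S \<xi> \<in> ell2"
    "\<And>\<xi> \<eta> x. \<xi> \<in> ell2 \<Longrightarrow> \<eta> \<in> ell2 \<Longrightarrow> ell2_inner (T \<xi>) \<eta> x = ell2_inner \<xi> (S \<eta>) x"
    "T \<in> extensional ell2" "S \<in> extensional ell2"
  shows "is_adjoint T S"
  using assms unfolding is_adjoint_def by (auto simp: PiE_def fun_eq_iff)

lemma is_adjoint_sym:
  assumes "is_adjoint T S"
  shows "is_adjoint S T"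
proof (rule is_adjointI)
  fix \<xi> \<eta> x assume "\<xi> \<in> ell2" "\<eta> \<in> ell2"
  then show "ell2_inner (S \<xi>) \<eta> x = ell2_inner \<xi> (T \<eta>) x"
    using is_adjointD(3)[OF assms, of \<eta> \<xi> x] ell2_inner_cnj[of \<eta> "S \<xi>" x] ell2_inner_cnj[of "T \<eta>" \<xi> x]
      is_adjointD(1,2)[OF assms] by simp
qed (use is_adjointD[OF assms] in auto)

lemma is_adjoint_unique:
  assumes "is_adjoint T S" "is_adjoint T S'"
  shows "S' = S"
proof (rule extensionalityI[of _ ell2])
  fix \<eta> assume \<eta>: "\<eta> \<in> ell2"
  note A = is_adjointD[OF is_adjoint_sym[OF assms(1)]] is_adjointD[OF is_adjoint_sym[OF assms(2)]]
  show "S' \<eta> = S \<eta>"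
    by (rule ell2_eqI) (use A \<eta> in auto)
qed (use is_adjointD[OF assms(1)] is_adjointD[OF assms(2)] in auto)

lemma astar_eq: "is_adjoint T S \<Longrightarrow> astar adjointable_ops T = S"
  unfolding adjointable_ops_def using is_adjoint_unique by (auto intro!: the_equality)

text \<open>\<open>is_adjoint\<close> does not ask for linearity; it follows by moving T to the
  other side of every inner product, where addition is known to be linear.\<close>

lemma is_adjoint_plus:
  assumes "is_adjoint T S" "\<xi> \<in> ell2" "\<eta> \<in> ell2"
  shows "T (ell2_plus \<xi> \<eta>) = ell2_plus (T \<xi>) (T \<eta>)"
  using assms is_adjointD[OF assms(1)]
  by (intro ell2_eqI) (auto simp: ell2_inner_plus_left)

lemma is_adjoint_scale:
  assumes "is_adjoint T S" "\<xi> \<in> ell2"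
  shows "T (ell2_scale c \<xi>) = ell2_scale c (T \<xi>)"
  using assms is_adjointD[OF assms(1)]
  by (intro ell2_eqI) (auto simp: ell2_inner_scale_left)

lemma is_adjoint_minus:
  assumes "is_adjoint T S" "\<xi> \<in> ell2" "\<eta> \<in> ell2"
  shows "T (ell2_minus \<xi> \<eta>) = ell2_minus (T \<xi>) (T \<eta>)"
  using assms by (simp add: ell2_minus_def is_adjoint_plus is_adjoint_scale)

lemma is_adjoint_zero:
  assumes "is_adjoint T S"
  shows "T ell2_zero = ell2_zero"
proof -
  have "T (ell2_scale 0 ell2_zero) = ell2_scale 0 (T ell2_zero)" by (simp add: is_adjoint_scale[OF assms])
  moreover have "ell2_scale 0 \<xi> = ell2_zero" if "\<xi> \<in> ell2" for \<xi>
    using that by (intro ell2_norm_zeroD) (auto simp: ell2_norm_scale)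
  ultimately show ?thesis using is_adjointD(1)[OF assms] by simp
qed

lemma is_adjoint_compose:
  assumes "is_adjoint T S" "is_adjoint T' S'"
  shows "is_adjoint (compose ell2 T T') (compose ell2 S' S)"
  using is_adjointD[OF assms(1)] is_adjointD[OF assms(2)]
  by (intro is_adjointI) (auto simp: compose_eq)

lemma is_adjoint_diff:
  assumes "is_adjoint T S" "is_adjoint T' S'"
  shows "is_adjoint (\<lambda>\<xi>\<in>ell2. ell2_minus (T \<xi>) (T' \<xi>)) (\<lambda>\<xi>\<in>ell2. ell2_minus (S \<xi>) (S' \<xi>))"
  using is_adjointD[OF assms(1)] is_adjointD[OF assms(2)]
  by (intro is_adjointI) (auto simp: ell2_inner_minus_left ell2_inner_minus_right)

lemma is_adjoint_scaled:
  assumes "is_adjoint T S"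
  shows "is_adjoint (\<lambda>\<xi>\<in>ell2. ell2_scale c (T \<xi>)) (\<lambda>\<xi>\<in>ell2. ell2_scale (cnj c) (S \<xi>))"
  using is_adjointD[OF assms(1)]
  by (intro is_adjointI) (auto simp: ell2_inner_scale_left ell2_inner_scale_right)

text \<open>The Hellinger--Toeplitz theorem, proved with the gliding hump of the uniform boundedness
  principle: if \<open>T\<close> is unbounded then some \<open>\<eta>\<close>, built as a series \<open>\<Sum>\<^sub>n \<epsilon>\<^sub>n h\<^sub>n\<close> with \<open>\<parallel>h\<^sub>n\<parallel> = 5\<^sup>-\<^sup>n\<close> and
  \<open>\<epsilon>\<^sub>n \<in> {0, 1}\<close>, makes the numbers \<open>\<langle>T \<xi>\<^sub>n, \<eta>\<rangle> = \<langle>\<xi>\<^sub>n, S \<eta>\<rangle>\<close> unbounded.\<close>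

lemma is_adjoint_bounded:
  assumes TS: "is_adjoint T S"
  shows "\<exists>K. \<forall>\<xi>\<in>ell2. ell2_norm \<xi> \<le> 1 \<longrightarrow> ell2_norm (T \<xi>) \<le> K"
proof (rule ccontr)
  note TD = is_adjointD[OF TS]
  assume "\<not> ?thesis"
  then have unb: "\<exists>\<xi>\<in>ell2. ell2_norm \<xi> \<le> 1 \<and> K < ell2_norm (T \<xi>)" for K
    by (meson not_le)
  \<comment> \<open>A supremum norm need not be attained, so x only realises 3/4 of it. Starting
    from 16 n 5^n, this leaves more than the 8 n 5^n required at the end.\<close>
  have "\<exists>\<xi> x. \<xi> \<in> ell2 \<and> ell2_norm \<xi> \<le> 1 \<and> ell2_norm (T \<xi>) > 0 \<and>
      3/4 * ell2_norm (T \<xi>) \<le> ell2_fnorm (T \<xi>) x \<and> 8 * real n * 5 ^ n < ell2_fnorm (T \<xi>) x" for n :: nat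
  proof -
    obtain \<xi> where \<xi>: "\<xi> \<in> ell2" "ell2_norm \<xi> \<le> 1" "16 * real n * 5 ^ n < ell2_norm (T \<xi>)"
      using unb by blast
    have "0 \<le> 16 * real n * 5 ^ n" by simp
    then have pos: "ell2_norm (T \<xi>) > 0" using \<xi>(3) by linarith
    have "\<exists>x. 3/4 * ell2_norm (T \<xi>) < ell2_fnorm (T \<xi>) x"
    proof (rule ccontr)
      assume "\<not> ?thesis"
      then have "ell2_norm (T \<xi>) \<le> 3/4 * ell2_norm (T \<xi>)"
        using pos TD(1) \<xi>(1) by (intro ell2_norm_leI) (auto simp: not_less)
      then show False using pos by simp
    qed
    then obtain x where "3/4 * ell2_norm (T \<xi>) < ell2_fnorm (T \<xi>) x" by blast
    then show ?thesis using \<xi> pos by (intro exI[of _ \<xi>] exI[of _ x]) auto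
  qed
  then obtain \<xi> x where \<xi>: "\<And>n. \<xi> n \<in> ell2" "\<And>n. ell2_norm (\<xi> n) \<le> 1" "\<And>n. ell2_norm (T (\<xi> n)) > 0"
    and A: "\<And>n. 3/4 * ell2_norm (T (\<xi> n)) \<le> ell2_fnorm (T (\<xi> n)) (x n)"
      "\<And>n. 8 * real n * 5 ^ n < ell2_fnorm (T (\<xi> n)) (x n)" by metis
  define A where "A = (\<lambda>n. ell2_fnorm (T (\<xi> n)) (x n))"
  \<comment> \<open>The hump points along \<open>T (\<xi> n)\<close>, where the functional \<phi>_n
    is large, and is scaled to norm 5^-n.\<close>
  define h where "h = (\<lambda>n. ell2_scale (of_real (1 / (5 ^ n * ell2_norm (T (\<xi> n))))) (T (\<xi> n)))"
  define \<phi> where "\<phi> = (\<lambda>n \<eta>. ell2_inner (T (\<xi> n)) \<eta> (x n))"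
  \<comment> \<open>The hump is added only if the current value of \<phi>_n is below half of its
    value on the hump. In either case the next vector has at least that half.\<close>
  define \<eta> where "\<eta> = rec_nat ell2_zero (\<lambda>n e. if cmod (\<phi> n (h n)) / 2 \<le> cmod (\<phi> n e) then e else ell2_plus e (h n))"
  have \<eta>_Suc: "\<eta> (Suc n) = (if cmod (\<phi> n (h n)) / 2 \<le> cmod (\<phi> n (\<eta> n)) then \<eta> n else ell2_plus (\<eta> n) (h n))" for n
    by (simp add: \<eta>_def)
  have h_in: "h n \<in> ell2" for n unfolding h_def using TD(1) \<xi>(1) by simp
  have \<eta>_in: "\<eta> n \<in> ell2" for n
    by (induction n) (use h_in in \<open>auto simp: \<eta>_Suc\<close>, simp add: \<eta>_def)
  have A0: "A n > 0" for n using A(1)[of n] \<xi>(3)[of n] by (simp add: A_def)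
  have h_norm: "ell2_norm (h n) = 1 / 5 ^ n" for n
    unfolding h_def using TD(1) \<xi>(1) \<xi>(3)[of n] by (simp add: ell2_norm_scale norm_divide norm_mult norm_power field_simps)
  have \<phi>h: "cmod (\<phi> n (h n)) \<ge> 3/4 * A n / 5 ^ n" for n
  proof -
    have "\<phi> n (h n) = of_real (1 / (5 ^ n * ell2_norm (T (\<xi> n))) * (A n)\<^sup>2)"
      unfolding \<phi>_def h_def A_def using TD(1) \<xi>(1)
      by (simp add: ell2_inner_scale_right ell2_inner_self_real)
    then have "cmod (\<phi> n (h n)) = \<bar>1 / (5 ^ n * ell2_norm (T (\<xi> n))) * (A n)\<^sup>2\<bar>"
      by (simp only: norm_of_real)
    also have "\<dots> = A n * A n / (5 ^ n * ell2_norm (T (\<xi> n)))"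
      using \<xi>(3)[of n] by (simp add: power2_eq_square)
    also have "\<dots> \<ge> (3/4 * ell2_norm (T (\<xi> n))) * A n / (5 ^ n * ell2_norm (T (\<xi> n)))"
      using A(1)[of n] A0[of n] \<xi>(3)[of n]
      by (intro divide_right_mono mult_right_mono) (auto simp: A_def)
    finally show ?thesis using \<xi>(3)[of n] by (simp add: field_simps)
  qed
  have \<phi>\<eta>: "cmod (\<phi> n (\<eta> (Suc n))) \<ge> cmod (\<phi> n (h n)) / 2" for n
  proof (cases "cmod (\<phi> n (h n)) / 2 \<le> cmod (\<phi> n (\<eta> n))")
    case False
    have "\<phi> n (ell2_plus (\<eta> n) (h n)) = \<phi> n (\<eta> n) + \<phi> n (h n)"
      unfolding \<phi>_def using \<eta>_in h_in TD(1) \<xi>(1) by (simp add: ell2_inner_plus_right)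
    then have "cmod (\<phi> n (h n)) \<le> cmod (\<phi> n (ell2_plus (\<eta> n) (h n))) + cmod (\<phi> n (\<eta> n))"
      by (metis add_diff_cancel_left' norm_triangle_ineq4)
    then show ?thesis using False by (simp add: \<eta>_Suc)
  qed (simp add: \<eta>_Suc)
  have step: "ell2_norm (ell2_minus (\<eta> n) (\<eta> (Suc n))) \<le> 1 / 5 ^ n" for n
  proof (cases "cmod (\<phi> n (h n)) / 2 \<le> cmod (\<phi> n (\<eta> n))")
    case True
    have "ell2_norm (ell2_minus (\<eta> n) (\<eta> n)) \<le> 0"
      using \<eta>_in by (intro ell2_norm_leI) (auto simp: ell2_fnorm_def ell2_inner_minus_left)
    then show ?thesis using True by (simp add: \<eta>_Suc) (meson order_trans zero_le_divide_1_iff zero_le_numeral zero_le_power)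
  next
    case False
    have "ell2_minus (\<eta> n) (ell2_plus (\<eta> n) (h n)) = ell2_scale (-1) (h n)"
      using \<eta>_in h_in by (intro ell2_eqI) (auto simp: ell2_inner_minus_left ell2_inner_plus_left ell2_inner_scale_left)
    then show ?thesis using False h_in h_norm by (simp add: \<eta>_Suc ell2_norm_scale)
  qed
  \<comment> \<open>The factor 5/4 is the sum of the series of powers of 1/5; the subtracted term
    lets the induction close exactly.\<close>
  have tail: "ell2_norm (ell2_minus (\<eta> n) (\<eta> (n + k))) \<le> 5/4 / 5 ^ n - 5/4 / 5 ^ (n + k)" for n k
  proof (induction k)
    case 0
    have "ell2_norm (ell2_minus (\<eta> n) (\<eta> n)) \<le> 0"
      using \<eta>_in by (intro ell2_norm_leI) (auto simp: ell2_fnorm_def ell2_inner_minus_left)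
    then show ?case by simp
  next
    case (Suc k)
    have "ell2_norm (ell2_minus (\<eta> n) (\<eta> (n + Suc k))) \<le> 5/4 / 5 ^ n - 5/4 / 5 ^ (n + k) + 1 / 5 ^ (n + k)"
      using ell2_norm_minus_triangle[OF \<eta>_in[of n] \<eta>_in[of "n + k"] \<eta>_in[of "n + Suc k"]] step[of "n + k"] Suc by simp
    also have "\<dots> = 5/4 / 5 ^ n - 5/4 / 5 ^ (n + Suc k)" by (simp add: field_simps)
    finally show ?case .
  qed
  have tail': "ell2_norm (ell2_minus (\<eta> n) (\<eta> m)) \<le> 5/4 / 5 ^ n" if "n \<le> m" for n m
  proof -
    have "(0::real) \<le> 5/4 / 5 ^ m" by simp
    then show ?thesis using tail[of n "m - n"] unfolding le_add_diff_inverse[OF that] by linarith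
  qed
  have lim0: "(\<lambda>n. 5/4 / 5 ^ n :: real) \<longlonglongrightarrow> 0"
    using tendsto_mult_right_zero[OF LIMSEQ_realpow_zero[of "1/5::real"], of "5/4"]
    by (simp add: power_one_over)
  obtain \<eta>' where \<eta>': "\<eta>' \<in> ell2" "(\<lambda>n. ell2_norm (ell2_minus (\<eta> n) \<eta>')) \<longlonglongrightarrow> 0"
  proof (rule ell2_complete[of \<eta>, OF \<eta>_in])
    fix e :: real assume "e > 0"
    then obtain N where N: "\<And>n. n \<ge> N \<Longrightarrow> \<bar>5/4 / 5 ^ n\<bar> < e"
      using LIMSEQ_D[OF lim0, of e] by auto
    have "ell2_norm (ell2_minus (\<eta> m) (\<eta> n)) < e" if "m \<ge> N" "n \<ge> N" for m n
      using tail'[of m n] tail'[of n m] N[OF that(1)] N[OF that(2)]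
        ell2_norm_minus_commute[OF \<eta>_in \<eta>_in, of m n] by (cases "m \<le> n") auto
    then show "\<exists>N. \<forall>m\<ge>N. \<forall>n\<ge>N. ell2_norm (ell2_minus (\<eta> m) (\<eta> n)) < e" by blast
  qed
  have close: "ell2_norm (ell2_minus (\<eta> n) \<eta>') \<le> 5/4 / 5 ^ n" for n
  proof (rule LIMSEQ_le_const)
    show "(\<lambda>m. 5/4 / 5 ^ n + ell2_norm (ell2_minus (\<eta> m) \<eta>')) \<longlonglongrightarrow> 5/4 / 5 ^ n"
      using tendsto_add[OF tendsto_const \<eta>'(2), of "5/4 / 5 ^ n"] by simp
    have "ell2_norm (ell2_minus (\<eta> n) \<eta>') \<le> 5/4 / 5 ^ n + ell2_norm (ell2_minus (\<eta> m) \<eta>')" if "m \<ge> n" for m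
      using ell2_norm_minus_triangle[OF \<eta>_in[of n] \<eta>_in[of m] \<eta>'(1)] tail'[OF that] by linarith
    then show "\<exists>N. \<forall>m\<ge>N. ell2_norm (ell2_minus (\<eta> n) \<eta>') \<le> 5/4 / 5 ^ n + ell2_norm (ell2_minus (\<eta> m) \<eta>')"
      by blast
  qed
  have "real n \<le> ell2_norm (S \<eta>')" for n
  proof -
    have T\<xi>: "T (\<xi> n) \<in> ell2" using TD(1) \<xi>(1) by blast
    \<comment> \<open>The tail is taken from index n+1, after the n-th hump, and is therefore at
      most (5/4) 5^-(n+1) = (1/4) 5^-n.\<close>
    have 1: "cmod (\<phi> n (ell2_minus (\<eta> (Suc n)) \<eta>')) \<le> A n * (1/4 / 5 ^ n)"
    proof -
      have "cmod (\<phi> n (ell2_minus (\<eta> (Suc n)) \<eta>')) \<le> A n * ell2_fnorm (ell2_minus (\<eta> (Suc n)) \<eta>') (x n)"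
        unfolding \<phi>_def A_def using T\<xi> \<eta>_in \<eta>'(1) by (intro ell2_inner_CS) auto
      also have "\<dots> \<le> A n * ell2_norm (ell2_minus (\<eta> (Suc n)) \<eta>')"
        using A0[of n] \<eta>_in \<eta>'(1) by (intro mult_left_mono ell2_fnorm_le_norm) auto
      also have "\<dots> \<le> A n * (5/4 / 5 ^ Suc n)"
        using A0[of n] close[of "Suc n"] by (intro mult_left_mono) auto
      finally show ?thesis by simp
    qed
    have "\<phi> n (ell2_minus (\<eta> (Suc n)) \<eta>') = \<phi> n (\<eta> (Suc n)) - \<phi> n \<eta>'"
      unfolding \<phi>_def using \<eta>_in \<eta>'(1) T\<xi> by (simp add: ell2_inner_minus_right)
    then have "cmod (\<phi> n (\<eta> (Suc n))) \<le> cmod (\<phi> n (ell2_minus (\<eta> (Suc n)) \<eta>')) + cmod (\<phi> n \<eta>')"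
      using norm_triangle_ineq2[of "\<phi> n (\<eta> (Suc n))" "\<phi> n \<eta>'"] by simp
    \<comment> \<open>In units of A_n / (8 * 5^n) the hump gives at least 6, half of it is kept,
      which is 3, and the tail destroys at most 2. One unit remains, and it is at least n.\<close>
    moreover have "A n * (1/4 / 5 ^ n) = 2 * (A n / (8 * 5 ^ n))" "3/4 * A n / 5 ^ n = 6 * (A n / (8 * 5 ^ n))"
      by simp_all
    ultimately have "A n / (8 * 5 ^ n) \<le> cmod (\<phi> n \<eta>')"
      using 1 \<phi>\<eta>[of n] \<phi>h[of n] by linarith
    moreover have "real n \<le> A n / (8 * 5 ^ n)"
      using A(2)[of n] by (simp add: A_def field_simps)
    moreover have "cmod (\<phi> n \<eta>') \<le> ell2_norm (\<xi> n) * ell2_norm (S \<eta>')"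
      unfolding \<phi>_def TD(3)[OF \<xi>(1) \<eta>'(1)] using TD(2) \<xi>(1) \<eta>'(1) by (intro ell2_inner_le) auto
    moreover have "\<dots> \<le> 1 * ell2_norm (S \<eta>')"
      using \<xi>(2)[of n] ell2_norm_nonneg[OF TD(2)[OF \<eta>'(1)]] by (intro mult_right_mono) auto
    ultimately show ?thesis by linarith
  qed
  then show False using reals_Archimedean2[of "ell2_norm (S \<eta>')"] by (meson not_le)
qed

section \<open>Operator norm and operator distance\<close>

lemma op_norm_eq: "op_norm T = Sup {ell2_norm (T \<xi>) |\<xi>. \<xi> \<in> ell2 \<and> ell2_norm \<xi> \<le> 1}"
  by (simp add: adjointable_ops_def)

text \<open>Comparing the value at the zero vector with the \<open>Sup\<close> needs an upper bound
  for the set; this is where \<open>is_adjoint_bounded\<close> enters.\<close>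

lemma op_norm_nonneg:
  assumes "is_adjoint T S"
  shows "op_norm T \<ge> 0"
proof -
  obtain K where K: "\<forall>\<xi>\<in>ell2. ell2_norm \<xi> \<le> 1 \<longrightarrow> ell2_norm (T \<xi>) \<le> K"
    using is_adjoint_bounded[OF assms] by blast
  have "ell2_norm (T ell2_zero) \<le> op_norm T" unfolding op_norm_eq
    by (rule cSup_upper) (use K in \<open>auto intro!: bdd_aboveI[of _ K] exI[of _ ell2_zero] simp: ell2_norm_zero\<close>)
  then show ?thesis by (simp add: is_adjoint_zero[OF assms] ell2_norm_zero)
qed

lemma op_norm_bound:
  assumes "is_adjoint T S" "\<xi> \<in> ell2"
  shows "ell2_norm (T \<xi>) \<le> op_norm T * ell2_norm \<xi>"
proof (cases "ell2_norm \<xi> = 0")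
  case True
  then have "\<xi> = ell2_zero" using ell2_norm_zeroD[OF assms(2)] by simp
  then show ?thesis by (simp add: is_adjoint_zero[OF assms(1)] ell2_norm_zero)
next
  case False
  then have pos: "ell2_norm \<xi> > 0" using ell2_norm_nonneg[OF assms(2)] by simp
  obtain K where K: "\<forall>\<xi>\<in>ell2. ell2_norm \<xi> \<le> 1 \<longrightarrow> ell2_norm (T \<xi>) \<le> K"
    using is_adjoint_bounded[OF assms(1)] by blast
  let ?c = "complex_of_real (1 / ell2_norm \<xi>)"
  have c: "cmod ?c = 1 / ell2_norm \<xi>" using pos by (simp add: norm_divide)
  have "ell2_norm (T (ell2_scale ?c \<xi>)) \<le> op_norm T" unfolding op_norm_eq
  proof (rule cSup_upper)
    have "ell2_norm (ell2_scale ?c \<xi>) = 1" unfolding ell2_norm_scale[OF assms(2)] c using pos by simp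
    then show "ell2_norm (T (ell2_scale ?c \<xi>)) \<in> {ell2_norm (T \<xi>) |\<xi>. \<xi> \<in> ell2 \<and> ell2_norm \<xi> \<le> 1}"
      using ell2_scale_in[OF assms(2), of ?c] by force
    show "bdd_above {ell2_norm (T \<xi>) |\<xi>. \<xi> \<in> ell2 \<and> ell2_norm \<xi> \<le> 1}"
      using K by (auto intro!: bdd_aboveI[of _ K])
  qed
  then have "1 / ell2_norm \<xi> * ell2_norm (T \<xi>) \<le> op_norm T"
    unfolding is_adjoint_scale[OF assms] ell2_norm_scale[OF is_adjointD(1)[OF assms]] c .
  then show ?thesis using pos by (simp add: field_simps)
qed

lemma op_norm_least:
  assumes "\<And>\<xi>. \<xi> \<in> ell2 \<Longrightarrow> ell2_norm (T \<xi>) \<le> C * ell2_norm \<xi>" "C \<ge> 0"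
  shows "op_norm T \<le> C"
  unfolding op_norm_eq
proof (rule cSup_least)
  show "{ell2_norm (T \<xi>) |\<xi>. \<xi> \<in> ell2 \<and> ell2_norm \<xi> \<le> 1} \<noteq> {}"
    using ell2_zero_in ell2_norm_zero by (metis (mono_tags, lifting) empty_iff mem_Collect_eq zero_le_one)
  fix y assume "y \<in> {ell2_norm (T \<xi>) |\<xi>. \<xi> \<in> ell2 \<and> ell2_norm \<xi> \<le> 1}"
  then obtain \<xi> where \<xi>: "y = ell2_norm (T \<xi>)" "\<xi> \<in> ell2" "ell2_norm \<xi> \<le> 1" by blast
  then show "y \<le> C" using assms(1)[OF \<xi>(2)] mult_left_mono[OF \<xi>(3) assms(2)] by simp
qed

text \<open>The square of the norm of S \<eta> is controlled by \<langle>T S \<eta>,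
  \<eta>\<rangle>, hence by the norms of T, S \<eta> and \<eta>; then one factor is
  cancelled.\<close>

lemma op_norm_adjoint:
  assumes "is_adjoint T S"
  shows "op_norm S \<le> op_norm T"
proof (rule op_norm_least)
  fix \<eta> assume \<eta>: "\<eta> \<in> ell2"
  have S\<eta>: "S \<eta> \<in> ell2" using is_adjointD(2)[OF assms \<eta>] .
  show "ell2_norm (S \<eta>) \<le> op_norm T * ell2_norm \<eta>"
  proof (cases "ell2_norm (S \<eta>) = 0")
    case False
    then have pos: "ell2_norm (S \<eta>) > 0" using ell2_norm_nonneg[OF S\<eta>] by simp
    \<comment> \<open>The inner product bounds squared fibre norms; taking the root at each point
      allows passing to the supremum before squaring again.\<close>
    let ?C = "sqrt (op_norm T * ell2_norm (S \<eta>) * ell2_norm \<eta>)"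
    have nn: "0 \<le> op_norm T * ell2_norm (S \<eta>) * ell2_norm \<eta>"
      using op_norm_nonneg[OF assms] ell2_norm_nonneg[OF S\<eta>] ell2_norm_nonneg[OF \<eta>] by simp
    have "ell2_norm (S \<eta>) \<le> ?C"
    proof (rule ell2_norm_leI[OF S\<eta>])
      show "?C \<ge> 0" using nn by simp
      fix x
      have "(ell2_fnorm (S \<eta>) x)\<^sup>2 = cmod (ell2_inner (T (S \<eta>)) \<eta> x)"
        unfolding is_adjointD(3)[OF assms S\<eta> \<eta>] ell2_inner_self_real[OF S\<eta>] by (simp add: norm_power)
      also have "\<dots> \<le> ell2_norm (T (S \<eta>)) * ell2_norm \<eta>"
        by (rule ell2_inner_le[OF is_adjointD(1)[OF assms S\<eta>] \<eta>])
      also have "\<dots> \<le> op_norm T * ell2_norm (S \<eta>) * ell2_norm \<eta>"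
        by (rule mult_right_mono[OF op_norm_bound[OF assms S\<eta>] ell2_norm_nonneg[OF \<eta>]])
      finally show "ell2_fnorm (S \<eta>) x \<le> ?C" by (rule real_le_rsqrt)
    qed
    then have "(ell2_norm (S \<eta>))\<^sup>2 \<le> op_norm T * ell2_norm (S \<eta>) * ell2_norm \<eta>"
      using sqrt_ge_absD[of "ell2_norm (S \<eta>)"] pos by simp
    then have "ell2_norm (S \<eta>) * ell2_norm (S \<eta>) \<le> ell2_norm (S \<eta>) * (op_norm T * ell2_norm \<eta>)"
      by (simp add: power2_eq_square mult_ac)
    then show ?thesis using pos by (simp only: mult_le_cancel_left_pos)
  qed (use op_norm_nonneg[OF assms] ell2_norm_nonneg[OF \<eta>] in simp)
qed (rule op_norm_nonneg[OF assms])

lemma op_dist_eq: "op_dist T T' = op_norm (\<lambda>\<xi>\<in>ell2. ell2_minus (T \<xi>) (T' \<xi>))"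
  unfolding adist_def
  by (rule arg_cong[where f = op_norm]) (auto simp: adjointable_ops_def ell2_minus_def fun_eq_iff restrict_def)

lemma op_dist_bound:
  assumes "is_adjoint T S" "is_adjoint T' S'" "\<xi> \<in> ell2"
  shows "ell2_norm (ell2_minus (T \<xi>) (T' \<xi>)) \<le> op_dist T T' * ell2_norm \<xi>"
  using op_norm_bound[OF is_adjoint_diff[OF assms(1,2)] assms(3)] assms(3) by (simp add: op_dist_eq)

lemma op_dist_least:
  assumes "\<And>\<xi>. \<xi> \<in> ell2 \<Longrightarrow> ell2_norm (ell2_minus (T \<xi>) (T' \<xi>)) \<le> C * ell2_norm \<xi>" "C \<ge> 0"
  shows "op_dist T T' \<le> C"
  unfolding op_dist_eq by (rule op_norm_least) (use assms in auto)

lemma op_dist_nonneg: "is_adjoint T S \<Longrightarrow> is_adjoint T' S' \<Longrightarrow> op_dist T T' \<ge> 0"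
  unfolding op_dist_eq by (rule op_norm_nonneg[OF is_adjoint_diff])

lemma op_dist_adjoint:
  assumes "is_adjoint T S" "is_adjoint T' S'"
  shows "op_dist S S' \<le> op_dist T T'"
  unfolding op_dist_eq by (rule op_norm_adjoint[OF is_adjoint_diff[OF assms]])

lemma op_dist_zeroD:
  assumes "is_adjoint T S" "is_adjoint T' S'" "op_dist T T' \<le> 0"
  shows "T = T'"
proof (rule extensionalityI[of _ ell2])
  fix \<xi> assume \<xi>: "\<xi> \<in> ell2"
  have "op_dist T T' * ell2_norm \<xi> \<le> 0" using assms(3) ell2_norm_nonneg[OF \<xi>] by (simp add: mult_nonpos_nonneg)
  then have n0: "ell2_norm (ell2_minus (T \<xi>) (T' \<xi>)) \<le> 0"
    using op_dist_bound[OF assms(1,2) \<xi>] by linarith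
  have in2: "T \<xi> \<in> ell2" "T' \<xi> \<in> ell2" using is_adjointD(1) assms \<xi> by blast+
  show "T \<xi> = T' \<xi>"
  proof (rule ell2_eqI_fnorm[OF in2])
    show "ell2_fnorm (ell2_minus (T \<xi>) (T' \<xi>)) x = 0" for x
      using n0 ell2_fnorm_le_norm[of "ell2_minus (T \<xi>) (T' \<xi>)" x] in2
        ell2_fnorm_nonneg[of "ell2_minus (T \<xi>) (T' \<xi>)" x] by simp
  qed
qed (use is_adjointD[OF assms(1)] is_adjointD[OF assms(2)] in auto)

section \<open>The reduced crossed product\<close>

text \<open>The element 1 on \<open>D g\<close> times \<delta>_g, with adjoint
  \<open>isom (inv g)\<close>. For \<open>\<one>\<close> it is the unit of \<open>Lalg\<close> and,
  once embedded, the vector \<delta>_e.\<close>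

definition isom :: "'a \<Rightarrow> 'a \<Rightarrow> 'x \<Rightarrow> complex" where
  "isom g = (\<lambda>t x. if t = g \<and> x \<in> D g then 1 else 0)"

lemma supp_isom: "supp (isom g) \<subseteq> {g}"
  by (auto simp: supp_def isom_def)

lemma isom_in [simp]:
  assumes "g \<in> carrier G"
  shows "isom g \<in> Lalg"
proof (rule LalgI[of _ "{g}"])
  fix t
  have "isom g t = (if t = g then \<alpha> g (\<lambda>_. 1) else (\<lambda>_. 0))"
    by (auto simp: isom_def \<alpha>_def fun_eq_iff)
  then show "continuous_map X euclidean (isom g t)" using assms by (simp add: continuous_\<alpha>)
qed (use assms in \<open>auto simp: isom_def\<close>)

lemma star_isom:
  assumes "g \<in> carrier G"
  shows "L_star (isom g) = isom (inv g)"
proof (intro ext)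
  fix t x
  have "t = inv g \<longleftrightarrow> inv t = g" if "t \<in> carrier G" using that assms by auto
  then show "L_star (isom g) t x = isom (inv g) t x"
    using assms act_closed[of g x] by (auto simp: L_star_def isom_def \<alpha>_def)
qed

lemma isom_times:
  assumes g: "g \<in> carrier G" and b: "b \<in> Lalg" and r: "r \<in> carrier G"
  shows "L_times (isom (inv g)) b r x = (if x \<in> D (inv g) then b (g \<otimes> r) (\<theta> g x) else 0)"
proof -
  \<comment> \<open>Only s = g r can contribute. It is inserted so that the surviving index is
    present even where b has no coefficient.\<close>
  let ?F = "insert (g \<otimes> r) (supp b)"
  have F: "finite ?F" "supp b \<subseteq> ?F" "?F \<subseteq> carrier G" using LalgD[OF b] g r by auto
  have "L_times (isom (inv g)) b r x = (\<Sum>s\<in>?F. isom (inv g) (r \<otimes> inv s) x * b s (\<theta> (s \<otimes> inv r) x))"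
    using g by (intro L_times_eq b r F isom_in) auto
  also have "\<dots> = (\<Sum>s\<in>{g \<otimes> r}. isom (inv g) (r \<otimes> inv s) x * b s (\<theta> (s \<otimes> inv r) x))"
  proof (rule sum.mono_neutral_right[OF F(1)])
    have "s = g \<otimes> r" if "s \<in> carrier G" "r \<otimes> inv s = inv g" for s
      using that g r by (metis inv_closed inv_equality inv_inv inv_mult_group m_closed inv_solve_right')
    then show "\<forall>s\<in>?F - {g \<otimes> r}. isom (inv g) (r \<otimes> inv s) x * b s (\<theta> (s \<otimes> inv r) x) = 0"
      using F(3) by (auto simp: isom_def)
  qed simp
  also have "\<dots> = (if x \<in> D (inv g) then b (g \<otimes> r) (\<theta> g x) else 0)"
  proof -
    have "r \<otimes> inv (g \<otimes> r) = inv g" "g \<otimes> r \<otimes> inv r = g"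
      using g r by (simp_all add: inv_mult_group m_assoc flip: m_assoc[of r])
    then show ?thesis by (simp add: isom_def)
  qed
  finally show ?thesis .
qed

lemma times_isom:
  assumes g: "g \<in> carrier G" and a: "a \<in> Lalg" and r: "r \<in> carrier G"
  shows "L_times a (isom g) r x = (if \<theta> (g \<otimes> inv r) x \<in> D g then a (r \<otimes> inv g) x else 0)"
  using L_times_eq[OF a isom_in[OF g] r, of "{g}" x] supp_isom[of g] g by (simp add: isom_def)

lemma one_times:
  assumes "b \<in> Lalg"
  shows "L_times (isom \<one>) b = b"
proof (intro ext)
  fix r x
  show "L_times (isom \<one>) b r x = b r x"
  proof (cases "r \<in> carrier G")
    case True
    then show ?thesis using isom_times[OF one_closed assms True, of x] LalgD(4)[OF assms True, of x]
      dom_subset[OF True] dom_one act_one[of x] by auto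
  qed (simp add: L_times_outside assms LalgD(5)[OF assms])
qed

lemma times_one:
  assumes "a \<in> Lalg"
  shows "L_times a (isom \<one>) = a"
proof (intro ext)
  fix r x
  show "L_times a (isom \<one>) r x = a r x"
  proof (cases "r \<in> carrier G")
    case r: True
    show ?thesis
    proof (cases "x \<in> D r")
      case True
      then have "\<theta> (inv r) x \<in> D \<one>"
        using act_inv'(1)[OF r True] dom_subset[of "inv r"] r dom_one by auto
      then show ?thesis using times_isom[OF one_closed assms r, of x] r by simp
    next
      case False
      then show ?thesis using times_isom[OF one_closed assms r, of x] r LalgD(4)[OF assms r False] by simp
    qed
  qed (simp add: L_times_outside assms LalgD(5)[OF assms])
qed

text \<open>If \<open>D g\<close> is moved off itself by all \<open>t \<noteq> \<one>\<close> in the support of \<open>a\<close>, then compressing by the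
  isometry \<open>isom g\<close> leaves only the coefficient of \<open>a\<close> at \<open>\<one>\<close>.\<close>

lemma compression:
  assumes g: "g \<in> carrier G" and full: "D (inv g) = topspace X" and a: "a \<in> Lalg"
    and free: "\<And>t y. t \<in> supp a \<Longrightarrow> t \<noteq> \<one> \<Longrightarrow> y \<in> D g \<Longrightarrow> y \<in> D t \<Longrightarrow> \<theta> (inv t) y \<notin> D g"
  shows "L_times (isom (inv g)) (L_times a (isom g)) =
    (\<lambda>r x. if r = \<one> \<and> x \<in> topspace X then a \<one> (\<theta> g x) else 0)"
proof (intro ext)
  fix r x
  note ag = Lalg_times[OF a isom_in[OF g]]
  show "L_times (isom (inv g)) (L_times a (isom g)) r x =
    (if r = \<one> \<and> x \<in> topspace X then a \<one> (\<theta> g x) else 0)"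
  proof (cases "r \<in> carrier G")
    case r: True
    show ?thesis
    proof (cases "x \<in> topspace X")
      case x: True
      \<comment> \<open>The coefficient at r of the compressed element is the coefficient of a at
        the conjugate t, evaluated at \<open>\<theta> g x\<close> and kept only if
        \<open>inv t\<close> leaves that point in \<open>D g\<close>.\<close>
      define t where "t = g \<otimes> r \<otimes> inv g"
      have t: "t \<in> carrier G" using g r by (simp add: t_def)
      have y: "\<theta> g x \<in> D g" using act_closed[OF g] x full by simp
      have inv_t: "g \<otimes> inv (g \<otimes> r) = inv t" using g r by (simp add: t_def inv_mult_group m_assoc)
      have eq: "L_times (isom (inv g)) (L_times a (isom g)) r x =
          (if \<theta> (inv t) (\<theta> g x) \<in> D g then a t (\<theta> g x) else 0)"
        using isom_times[OF g ag r, of x] times_isom[OF g a, of "g \<otimes> r" "\<theta> g x"] g r x full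
        unfolding inv_t t_def[symmetric] by simp
      show ?thesis
      proof (cases "r = \<one>")
        case True
        then have "t = \<one>" using g by (simp add: t_def)
        then show ?thesis using eq True y x act_one[of "\<theta> g x"] dom_subset[OF g] by auto
      next
        case False
        have "t \<noteq> \<one>"
        proof
          assume "t = \<one>"
          then have "g \<otimes> r = g" using g r unfolding t_def
            by (metis inv_closed inv_equality inv_inv m_closed)
          then show False using False g r by simp
        qed
        then have "a t (\<theta> g x) = 0 \<or> \<theta> (inv t) (\<theta> g x) \<notin> D g"
          using free[of t "\<theta> g x"] y LalgD(3)[OF a] LalgD(4)[OF a t] by blast
        then show ?thesis using eq False by auto
      qed
    next
      case False
      then show ?thesis using isom_times[OF g ag r, of x] full by simp
    qed
  next
    case False
    then show ?thesis using L_times_outside[OF isom_in ag False] g by auto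
  qed
qed

text \<open>This is the compression of the unit, whose support lies in \<open>{\<one>}\<close>, so
  nothing has to be moved off \<open>D g\<close>.\<close>

lemma isom_isometry:
  assumes g: "g \<in> carrier G" and full: "D (inv g) = topspace X"
  shows "L_times (isom (inv g)) (isom g) = isom \<one>"
proof -
  have "L_times (isom (inv g)) (L_times (isom \<one>) (isom g)) =
      (\<lambda>r x. if r = \<one> \<and> x \<in> topspace X then isom \<one> \<one> (\<theta> g x) else 0)"
    using supp_isom[of \<one>] by (intro compression g full) auto
  also have "\<dots> = isom \<one>"
    using act_closed[OF g] dom_subset[OF g] full by (auto simp: isom_def dom_one fun_eq_iff)
  finally show ?thesis using g by (simp add: one_times)
qed

text \<open>A nonzero coefficient would put \<open>\<theta> g x\<close> into both \<open>D g\<close>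
  and \<open>D h\<close>.\<close>

lemma isom_orthogonal:
  assumes g: "g \<in> carrier G" and h: "h \<in> carrier G" and disj: "D g \<inter> D h = {}"
  shows "L_times (isom (inv g)) (isom h) = (\<lambda>_ _. 0)"
proof (intro ext)
  fix r x
  show "L_times (isom (inv g)) (isom h) r x = 0"
  proof (cases "r \<in> carrier G")
    case True
    then show ?thesis using isom_times[OF g isom_in[OF h] True, of x] act_closed[OF g, of x] disj
      by (auto simp: isom_def)
  next
    case False
    then show ?thesis using L_times_outside[OF isom_in isom_in False] g h by auto
  qed
qed

section \<open>Left multiplication on the completion\<close>

lemma L_times_scale:
  assumes a: "a \<in> Lalg" and b: "b \<in> Lalg"
  shows "L_times (L_scale c a) b = L_scale c (L_times a b)"
proof (intro ext)
  fix r x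
  note eq = L_times_eq[OF _ b _ LalgD(1)[OF b] order_refl LalgD(2)[OF b]]
  show "L_times (L_scale c a) b r x = c * L_times a b r x"
    using eq[OF a, of r x] eq[OF Lalg_scale[OF a, of c], of r x]
      L_times_outside[OF a b, of r x] L_times_outside[OF Lalg_scale[OF a, of c] b, of r x]
    by (cases "r \<in> carrier G") (auto simp: sum_distrib_left mult.assoc)
qed

lemma L_times_diff_left:
  assumes a: "a \<in> Lalg" and a': "a' \<in> Lalg" and b: "b \<in> Lalg"
  shows "L_times (L_diff a a') b = L_diff (L_times a b) (L_times a' b)"
proof (intro ext)
  fix r x
  note eq = L_times_eq[OF _ b _ LalgD(1)[OF b] order_refl LalgD(2)[OF b]]
  show "L_times (L_diff a a') b r x = L_times a b r x - L_times a' b r x"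
    using eq[OF a, of r x] eq[OF a', of r x] eq[OF Lalg_diff[OF a a'], of r x]
      L_times_outside[OF a b, of r x] L_times_outside[OF a' b, of r x]
      L_times_outside[OF Lalg_diff[OF a a'] b, of r x]
    by (cases "r \<in> carrier G") (auto simp: sum_subtractf left_diff_distrib)
qed

lemma L_times_fnorm:
  assumes a: "a \<in> Lalg" and x: "x \<in> Lalg" and K: "\<And>t y. cmod (a t y) \<le> K t"
  shows "L_fnorm (L_times a x) p \<le> (\<Sum>t\<in>supp a. K t) * L_fnorm x p"
proof -
  have "K t \<ge> 0" for t using K[of t] norm_ge_zero order_trans by blast
  then have nn: "(\<Sum>t\<in>supp a. K t) \<ge> 0" by (simp add: sum_nonneg)
  have "L_fnorm (L_times a x) p \<le> sqrt ((\<Sum>t\<in>supp a. K t)\<^sup>2 * Re (L_inner x x p))"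
    unfolding L_fnorm_def using L_times_bound[OF a x K] by (rule real_sqrt_le_mono)
  then show ?thesis using nn by (simp add: real_sqrt_mult L_fnorm_def)
qed

lemma L_times_dist:
  assumes a: "a \<in> Lalg"
  shows "\<exists>C. \<forall>x\<in>Lalg. \<forall>y\<in>Lalg. L_dist (L_times a x) (L_times a y) \<le> C * L_dist x y"
proof -
  obtain K where K0: "\<And>t. K t \<ge> (0::real)" and K: "\<And>t y. cmod (a t y) \<le> K t"
    using Lalg_bounded[OF a] by auto
  let ?C = "\<Sum>t\<in>supp a. K t"
  have C0: "?C \<ge> 0" using K0 by (simp add: sum_nonneg)
  have "L_dist (L_times a x) (L_times a y) \<le> ?C * L_dist x y" if x: "x \<in> Lalg" and y: "y \<in> Lalg" for x y
    unfolding L_dist_eq L_times_diff[OF a x y, symmetric]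
  proof (rule L_norm_leI[OF Lalg_times[OF a Lalg_diff[OF x y]]])
    show "0 \<le> ?C * L_norm (L_diff x y)" using C0 L_norm_nonneg[OF Lalg_diff[OF x y]] by simp
    show "L_fnorm (L_times a (L_diff x y)) p \<le> ?C * L_norm (L_diff x y)" for p
      using L_times_fnorm[OF a Lalg_diff[OF x y] K]
        mult_left_mono[OF L_fnorm_le_norm[OF Lalg_diff[OF x y]] C0] by (rule order_trans)
  qed
  then show ?thesis by blast
qed

lemma L_Cauchy_times:
  assumes a: "a \<in> Lalg" and p: "p \<in> L_Cauchy"
  shows "(\<lambda>n. L_times a (p n)) \<in> L_Cauchy"
proof -
  obtain C where C: "\<And>x y. x \<in> Lalg \<Longrightarrow> y \<in> Lalg \<Longrightarrow> L_dist (L_times a x) (L_times a y) \<le> C * L_dist x y"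
    using L_times_dist[OF a] by blast
  show ?thesis by (rule L_Cauchy_lipschitz[OF p Lalg_times[OF a] C])
qed

lemma left_mult_cls:
  assumes a: "a \<in> Lalg" and p: "p \<in> L_Cauchy"
  shows "left_mult a (cls p) = cls (\<lambda>n. L_times a (p n))"
proof -
  obtain C where C: "\<And>x y. x \<in> Lalg \<Longrightarrow> y \<in> Lalg \<Longrightarrow> L_dist (L_times a x) (L_times a y) \<le> C * L_dist x y"
    using L_times_dist[OF a] by blast
  show ?thesis using cls_lipschitz[OF p Lalg_times[OF a] C] cls_in[OF p] by (simp add: left_mult_def)
qed

lemma left_mult_emb: "a \<in> Lalg \<Longrightarrow> b \<in> Lalg \<Longrightarrow> left_mult a (emb b) = emb (L_times a b)"
  unfolding emb_def by (rule left_mult_cls[OF _ L_Cauchy_const])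

lemma left_mult_in [simp]:
  assumes "a \<in> Lalg" "\<xi> \<in> ell2"
  shows "left_mult a \<xi> \<in> ell2"
proof -
  obtain p where p: "p \<in> L_Cauchy" "\<xi> = cls p" using assms(2) by (rule ell2_cases)
  show ?thesis unfolding p(2) left_mult_cls[OF assms(1) p(1)] by (rule cls_in[OF L_Cauchy_times[OF assms(1) p(1)]])
qed

lemma left_mult_extensional: "left_mult a \<in> extensional ell2"
  by (simp add: left_mult_def)

lemma left_mult_adjoint:
  assumes a: "a \<in> Lalg"
  shows "is_adjoint (left_mult a) (left_mult (L_star a))"
proof (rule is_adjointI)
  fix \<xi> \<eta> x assume "\<xi> \<in> ell2" "\<eta> \<in> ell2"
  then obtain p q where p: "p \<in> L_Cauchy" "\<xi> = cls p" and q: "q \<in> L_Cauchy" "\<eta> = cls q"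
    by (metis ell2_cases)
  note L = p(1)[THEN L_CauchyD(1)] q(1)[THEN L_CauchyD(1)]
  note a' = Lalg_star[OF a]
  have 1: "(\<lambda>n. L_inner (L_times a (p n)) (q n) x) \<longlonglongrightarrow> ell2_inner (cls p) (cls (\<lambda>n. L_times (L_star a) (q n))) x"
    unfolding L_inner_adjoint[OF a L] by (rule ell2_inner_tendsto[OF p(1) L_Cauchy_times[OF a' q(1)]])
  show "ell2_inner (left_mult a \<xi>) \<eta> x = ell2_inner \<xi> (left_mult (L_star a) \<eta>) x"
    unfolding p(2) q(2) left_mult_cls[OF a p(1)] left_mult_cls[OF a' q(1)]
    by (rule LIMSEQ_unique[OF ell2_inner_tendsto[OF L_Cauchy_times[OF a p(1)] q(1)] 1])
qed (use assms in \<open>auto simp: Lalg_star left_mult_extensional\<close>)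

lemma left_mult_compose:
  assumes a: "a \<in> Lalg" and b: "b \<in> Lalg" and \<xi>: "\<xi> \<in> ell2"
  shows "left_mult a (left_mult b \<xi>) = left_mult (L_times a b) \<xi>"
proof -
  obtain p where p: "p \<in> L_Cauchy" "\<xi> = cls p" using \<xi> by (rule ell2_cases)
  show ?thesis
    unfolding p(2) left_mult_cls[OF b p(1)] left_mult_cls[OF a L_Cauchy_times[OF b p(1)]]
      left_mult_cls[OF Lalg_times[OF a b] p(1)] L_times_assoc[OF a b L_CauchyD(1)[OF p(1)]] ..
qed

lemma left_mult_one:
  assumes "\<xi> \<in> ell2"
  shows "left_mult (isom \<one>) \<xi> = \<xi>"
proof -
  obtain p where p: "p \<in> L_Cauchy" "\<xi> = cls p" using assms by (rule ell2_cases)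
  show ?thesis unfolding p(2) left_mult_cls[OF isom_in[OF one_closed] p(1)]
    one_times[OF L_CauchyD(1)[OF p(1)]] ..
qed

lemma left_mult_scale:
  assumes a: "a \<in> Lalg" and \<xi>: "\<xi> \<in> ell2"
  shows "left_mult (L_scale c a) \<xi> = ell2_scale c (left_mult a \<xi>)"
proof -
  obtain p where p: "p \<in> L_Cauchy" "\<xi> = cls p" using \<xi> by (rule ell2_cases)
  show ?thesis
    unfolding p(2) left_mult_cls[OF a p(1)] left_mult_cls[OF Lalg_scale[OF a] p(1)]
      L_times_scale[OF a L_CauchyD(1)[OF p(1)]] ell2_scale_cls[OF L_Cauchy_times[OF a p(1)]] ..
qed

lemma left_mult_diff:
  assumes a: "a \<in> Lalg" and b: "b \<in> Lalg" and \<xi>: "\<xi> \<in> ell2"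
  shows "left_mult (L_diff a b) \<xi> = ell2_minus (left_mult a \<xi>) (left_mult b \<xi>)"
proof -
  obtain p where p: "p \<in> L_Cauchy" "\<xi> = cls p" using \<xi> by (rule ell2_cases)
  show ?thesis
    unfolding p(2) left_mult_cls[OF a p(1)] left_mult_cls[OF b p(1)] left_mult_cls[OF Lalg_diff[OF a b] p(1)]
      L_times_diff_left[OF a b L_CauchyD(1)[OF p(1)]]
      ell2_minus_cls[OF L_Cauchy_times[OF a p(1)] L_Cauchy_times[OF b p(1)]] ..
qed

text \<open>For a single coefficient the Schur bound is a bound on that coefficient. It serves the
  elements \<open>isom g\<close> and, in \<open>RCP_compression\<close>, the error concentrated at
  \<open>\<one>\<close>.\<close>

lemma left_mult_norm:
  assumes a: "a \<in> Lalg" and supp: "supp a \<subseteq> {g}" and K: "\<And>t y. cmod (a t y) \<le> K" and \<xi>: "\<xi> \<in> ell2"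
  shows "ell2_norm (left_mult a \<xi>) \<le> K * ell2_norm \<xi>"
proof -
  obtain p where p: "p \<in> L_Cauchy" "\<xi> = cls p" using \<xi> by (rule ell2_cases)
  have K0: "K \<ge> 0" using K[of undefined undefined] norm_ge_zero order_trans by blast
  have "supp a = {} \<or> supp a = {g}" using supp by auto
  then have sum_le: "(\<Sum>t\<in>supp a. K) \<le> K" using K0 by auto
  have L: "L_fnorm (L_times a (p n)) x \<le> K * L_fnorm (p n) x" for n x
    by (rule order_trans[OF L_times_fnorm[OF a L_CauchyD(1)[OF p(1)] K]
          mult_right_mono[OF sum_le L_fnorm_nonneg[OF L_CauchyD(1)[OF p(1)]]]])
  have f: "ell2_fnorm (left_mult a \<xi>) x \<le> K * ell2_fnorm \<xi> x" for x
    unfolding p(2) left_mult_cls[OF a p(1)]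
    by (rule LIMSEQ_le[OF L_fnorm_tendsto[OF L_Cauchy_times[OF a p(1)]]
        tendsto_mult_left[OF L_fnorm_tendsto[OF p(1)]]]) (use L in blast)
  show ?thesis
  proof (rule ell2_norm_leI[OF left_mult_in[OF a \<xi>]])
    show "0 \<le> K * ell2_norm \<xi>" using K0 ell2_norm_nonneg[OF \<xi>] by simp
    show "ell2_fnorm (left_mult a \<xi>) x \<le> K * ell2_norm \<xi>" for x
      using f[of x] mult_left_mono[OF ell2_fnorm_le_norm[OF \<xi>] K0, of x] by linarith
  qed
qed

lemma left_mult_isom_norm:
  "g \<in> carrier G \<Longrightarrow> \<xi> \<in> ell2 \<Longrightarrow> ell2_norm (left_mult (isom g) \<xi>) \<le> ell2_norm \<xi>"
  using left_mult_norm[OF isom_in supp_isom, of g 1 \<xi>] by (simp add: isom_def)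

text \<open>Right multiplication by \<open>b\<close> is bounded for the norm of \<open>\<ell>\<^sub>2\<close>, although it is not \<open>C(X)\<close>-linear.
  This makes the vector \<open>\<delta>\<^sub>e\<close> separating for the crossed product.\<close>

lemma L_times_right_bound:
  assumes a: "a \<in> Lalg" and b: "b \<in> Lalg" and K: "\<And>t y. cmod (b t y) \<le> K t"
  shows "L_norm (L_times a b) \<le> (\<Sum>t\<in>supp b. K t) * L_norm a"
proof -
  note ab = Lalg_times[OF a b]
  let ?R = "supp (L_times a b)"
  have K0: "K t \<ge> 0" for t using K[of t] norm_ge_zero order_trans by blast
  have col: "L2_set (\<lambda>r. cmod (mat a p r t * fib b p t)) ?R \<le> K t * L_norm a" if t: "t \<in> supp b" for p t
  proof (cases "p \<in> D (inv t)")
    case True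
    have tG: "t \<in> carrier G" using t LalgD(2)[OF b] by auto
    \<comment> \<open>Column t of the matrix at p is dominated by the orbit vector of a at
      \<open>?q\<close>, reindexed by r to \<open>r \<otimes> inv t\<close>. As the base point
      moves, the estimate needs \<open>L_norm a\<close> in place of the fibre norm at p.\<close>
    let ?q = "\<theta> t p"
    let ?R' = "(\<lambda>r. r \<otimes> inv t) ` ?R"
    have rG: "r \<in> carrier G" if "r \<in> ?R" for r using that LalgD(2)[OF ab] by auto
    have inj: "inj_on (\<lambda>r. r \<otimes> inv t) ?R" using rG tG by (auto simp: inj_on_def)
    have mat_le: "cmod (mat a p r t) \<le> cmod (fib a ?q (r \<otimes> inv t))" if r: "r \<in> ?R" for r
    proof (cases "p \<in> D (inv r)")
      case in_r: True
      then show ?thesis using act_quot[OF tG rG[OF r] True in_r] tG rG[OF r]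
        by (simp add: mat_def fib_def inv_mult_group)
    qed (simp add: mat_def)
    have "L2_set (\<lambda>r. cmod (mat a p r t * fib b p t)) ?R \<le> L2_set (\<lambda>r. K t * cmod (fib a ?q (r \<otimes> inv t))) ?R"
    proof (rule L2_set_mono)
      fix r assume r: "r \<in> ?R"
      have "cmod (mat a p r t) * cmod (fib b p t) \<le> cmod (fib a ?q (r \<otimes> inv t)) * K t"
        using mat_le[OF r] K[of t "\<theta> t p"] K0 by (intro mult_mono) (auto simp: fib_def)
      then show "cmod (mat a p r t * fib b p t) \<le> K t * cmod (fib a ?q (r \<otimes> inv t))"
        by (simp add: norm_mult mult.commute)
    qed simp
    also have "\<dots> = K t * L2_set (\<lambda>r. cmod (fib a ?q (r \<otimes> inv t))) ?R"
      by (rule L2_set_right_distrib[OF K0, symmetric])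
    also have "L2_set (\<lambda>r. cmod (fib a ?q (r \<otimes> inv t))) ?R = L2_set (\<lambda>s. cmod (fib a ?q s)) ?R'"
      unfolding L2_set_def by (simp add: sum.reindex[OF inj])
    also have "\<dots> \<le> L2_set (\<lambda>s. cmod (fib a ?q s)) (?R' \<union> supp a)"
      unfolding L2_set_def using LalgD(1)[OF a] LalgD(1)[OF ab]
      by (intro real_sqrt_le_mono sum_mono2) auto
    also have "\<dots> = L_fnorm a ?q"
      using LalgD(1,2)[OF a] LalgD(1)[OF ab] rG tG by (intro L_fnorm_eq[OF a, symmetric]) auto
    also have "\<dots> \<le> L_norm a" by (rule L_fnorm_le_norm[OF a])
    finally show ?thesis using K0[of t] by (simp add: mult_left_mono)
  next
    case False
    then show ?thesis using K0[of t] L_norm_nonneg[OF a] by (simp add: fib_def L2_set_def)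
  qed
  show ?thesis
  proof (rule L_norm_leI[OF ab])
    show "0 \<le> (\<Sum>t\<in>supp b. K t) * L_norm a" using K0 L_norm_nonneg[OF a] by (simp add: sum_nonneg)
    fix p
    have "L_fnorm (L_times a b) p = L2_set (\<lambda>r. cmod (fib (L_times a b) p r)) ?R"
      by (rule L_fnorm_eq[OF ab LalgD(1)[OF ab] order_refl LalgD(2)[OF ab]])
    also have "\<dots> = L2_set (\<lambda>r. cmod (\<Sum>t\<in>supp b. mat a p r t * fib b p t)) ?R"
      using LalgD(2)[OF ab] by (intro L2_set_cong refl)
        (auto simp: fib_times[OF a b _ LalgD(1)[OF b] order_refl LalgD(2)[OF b]])
    also have "\<dots> \<le> (\<Sum>t\<in>supp b. L2_set (\<lambda>r. cmod (mat a p r t * fib b p t)) ?R)"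
      by (rule L2_set_sum_le[OF LalgD(1)[OF b]])
    also have "\<dots> \<le> (\<Sum>t\<in>supp b. K t * L_norm a)" by (intro sum_mono col)
    finally show "L_fnorm (L_times a b) p \<le> (\<Sum>t\<in>supp b. K t) * L_norm a"
      by (simp add: sum_distrib_right)
  qed
qed

abbreviation (input) RCP :: "((nat \<Rightarrow> 'a \<Rightarrow> 'x \<Rightarrow> complex) set \<Rightarrow> (nat \<Rightarrow> 'a \<Rightarrow> 'x \<Rightarrow> complex) set) star_alg" where
  "RCP \<equiv> reduced_crossed_product"

section \<open>Elements of the norm closure\<close>

lemma adj_simps:
  "acarrier adjointable_ops = {T. \<exists>S. is_adjoint T S}"
  "aplus adjointable_ops = (\<lambda>T S. \<lambda>\<xi>\<in>ell2. ell2_plus (T \<xi>) (S \<xi>))"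
  "atimes adjointable_ops = compose ell2"
  "ascale adjointable_ops = (\<lambda>c T. \<lambda>\<xi>\<in>ell2. ell2_scale c (T \<xi>))"
  by (simp_all add: adjointable_ops_def)

lemma RCP_simps:
  "acarrier RCP = {T. (\<exists>S. is_adjoint T S) \<and> (\<forall>e>0. \<exists>a\<in>Lalg. op_dist T (left_mult a) < e)}"
  "aplus RCP = (\<lambda>T S. \<lambda>\<xi>\<in>ell2. ell2_plus (T \<xi>) (S \<xi>))"
  "atimes RCP = compose ell2"
  "ascale RCP = (\<lambda>c T. \<lambda>\<xi>\<in>ell2. ell2_scale c (T \<xi>))"
  "astar RCP = astar adjointable_ops"
  "adist RCP = op_dist"
  by (auto simp: reduced_crossed_product_def adj_simps adist_def fun_eq_iff)

lemma ell2_minus_self: "\<xi> \<in> ell2 \<Longrightarrow> ell2_norm (ell2_minus \<xi> \<xi>) = 0"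
  using ell2_norm_leI[of "ell2_minus \<xi> \<xi>" 0] ell2_norm_nonneg[of "ell2_minus \<xi> \<xi>"]
  by (simp add: ell2_fnorm_def ell2_inner_minus_left)

lemma ell2_norm_le_minus:
  assumes "\<xi> \<in> ell2" "\<eta> \<in> ell2"
  shows "ell2_norm \<eta> \<le> ell2_norm \<xi> + ell2_norm (ell2_minus \<xi> \<eta>)"
proof -
  have "\<eta> = ell2_plus \<xi> (ell2_minus \<eta> \<xi>)"
    using assms by (intro ell2_eqI) (auto simp: ell2_inner_minus_left ell2_inner_plus_left)
  then show ?thesis
    using ell2_norm_plus[OF assms(1) ell2_minus_in[OF assms(2,1)]] ell2_norm_minus_commute[OF assms] by simp
qed

lemma op_dist_self:
  assumes "is_adjoint T S"
  shows "op_dist T T = 0"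
proof (rule antisym)
  show "op_dist T T \<le> 0"
    by (rule op_dist_least) (use is_adjointD(1)[OF assms] in \<open>auto simp: ell2_minus_self\<close>)
qed (rule op_dist_nonneg[OF assms assms])

lemma RCP_left_mult:
  assumes "a \<in> Lalg"
  shows "left_mult a \<in> acarrier RCP"
proof -
  have "\<exists>b\<in>Lalg. op_dist (left_mult a) (left_mult b) < e" if "e > 0" for e
    using that assms op_dist_self[OF left_mult_adjoint[OF assms]] by (intro bexI[of _ a]) auto
  then show ?thesis unfolding RCP_simps using left_mult_adjoint[OF assms] by blast
qed

text \<open>If a approximates T, then \<open>L_times b a\<close> approximates the composite. This
  places the comparing elements, an isometry followed after a rescaled d, in the crossed
  product.\<close>

lemma RCP_compose:
  assumes b: "b \<in> Lalg" and T: "T \<in> acarrier RCP"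
  shows "compose ell2 (left_mult b) T \<in> acarrier RCP"
proof -
  obtain S where TS: "is_adjoint T S" using T by (auto simp: RCP_simps)
  let ?C = "op_norm (left_mult b)"
  note bA = left_mult_adjoint[OF b]
  have C0: "?C \<ge> 0" by (rule op_norm_nonneg[OF bA])
  have "\<exists>a\<in>Lalg. op_dist (compose ell2 (left_mult b) T) (left_mult a) < e" if e: "e > 0" for e
  proof -
    \<comment> \<open>The added 1 allows \<open>?C\<close> to be 0 and makes the final inequality
      strict.\<close>
    have "e / (?C + 1) > 0" using e C0 by simp
    then obtain a where a: "a \<in> Lalg" "op_dist T (left_mult a) < e / (?C + 1)"
      using T by (auto simp: RCP_simps)
    have d0: "op_dist T (left_mult a) \<ge> 0" by (rule op_dist_nonneg[OF TS left_mult_adjoint[OF a(1)]])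
    have "op_dist (compose ell2 (left_mult b) T) (left_mult (L_times b a)) \<le> ?C * op_dist T (left_mult a)"
    proof (rule op_dist_least)
      fix \<xi> assume \<xi>: "\<xi> \<in> ell2"
      have T\<xi>: "T \<xi> \<in> ell2" "left_mult a \<xi> \<in> ell2" using is_adjointD(1)[OF TS \<xi>] a \<xi> by auto
      have "ell2_norm (left_mult b (ell2_minus (T \<xi>) (left_mult a \<xi>)))
          \<le> ?C * ell2_norm (ell2_minus (T \<xi>) (left_mult a \<xi>))"
        using T\<xi> by (intro op_norm_bound[OF bA]) simp
      also have "\<dots> \<le> ?C * (op_dist T (left_mult a) * ell2_norm \<xi>)"
        by (rule mult_left_mono[OF op_dist_bound[OF TS left_mult_adjoint[OF a(1)] \<xi>] C0])
      finally show "ell2_norm (ell2_minus (compose ell2 (left_mult b) T \<xi>) (left_mult (L_times b a) \<xi>))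
          \<le> ?C * op_dist T (left_mult a) * ell2_norm \<xi>"
        unfolding compose_eq[OF \<xi>] left_mult_compose[OF b a(1) \<xi>, symmetric]
          is_adjoint_minus[OF bA T\<xi>, symmetric] by (simp add: mult.assoc)
    qed (use C0 d0 in simp)
    also have "\<dots> \<le> ?C * (e / (?C + 1))" using a(2) C0 by (intro mult_left_mono) auto
    also have "\<dots> < e" using e C0 by (simp add: field_simps)
    finally show ?thesis using Lalg_times[OF b a(1)] by blast
  qed
  then show ?thesis using is_adjoint_compose[OF bA TS] by (auto simp: RCP_simps)
qed

lemma RCP_scale:
  assumes T: "T \<in> acarrier RCP"
  shows "(\<lambda>\<xi>\<in>ell2. ell2_scale c (T \<xi>)) \<in> acarrier RCP"
proof -
  obtain S where TS: "is_adjoint T S" using T by (auto simp: RCP_simps)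
  let ?T = "\<lambda>\<xi>\<in>ell2. ell2_scale c (T \<xi>)"
  have "\<exists>a\<in>Lalg. op_dist ?T (left_mult a) < e" if e: "e > 0" for e
  proof -
    have "e / (cmod c + 1) > 0" using e by (simp add: add_nonneg_pos)
    then obtain a where a: "a \<in> Lalg" "op_dist T (left_mult a) < e / (cmod c + 1)"
      using T by (auto simp: RCP_simps)
    have d0: "op_dist T (left_mult a) \<ge> 0" by (rule op_dist_nonneg[OF TS left_mult_adjoint[OF a(1)]])
    have "op_dist ?T (left_mult (L_scale c a)) \<le> cmod c * op_dist T (left_mult a)"
    proof (rule op_dist_least)
      fix \<xi> assume \<xi>: "\<xi> \<in> ell2"
      have T\<xi>: "T \<xi> \<in> ell2" "left_mult a \<xi> \<in> ell2" using is_adjointD(1)[OF TS \<xi>] a \<xi> by auto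
      have "ell2_minus (ell2_scale c (T \<xi>)) (ell2_scale c (left_mult a \<xi>))
          = ell2_scale c (ell2_minus (T \<xi>) (left_mult a \<xi>))"
        using T\<xi> by (intro ell2_eqI)
          (auto simp: ell2_inner_minus_left ell2_inner_scale_left right_diff_distrib)
      then show "ell2_norm (ell2_minus (?T \<xi>) (left_mult (L_scale c a) \<xi>))
          \<le> cmod c * op_dist T (left_mult a) * ell2_norm \<xi>"
        using \<xi> T\<xi> mult_left_mono[OF op_dist_bound[OF TS left_mult_adjoint[OF a(1)] \<xi>] norm_ge_zero, of c]
        by (simp add: left_mult_scale a ell2_norm_scale mult.assoc)
    qed (use d0 in simp)
    also have "\<dots> \<le> cmod c * (e / (cmod c + 1))" using a(2) by (intro mult_left_mono) auto
    also have "\<dots> < e"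
    proof -
      have "cmod c + 1 > 0" by (simp add: add_nonneg_pos)
      then show ?thesis using e by (simp add: field_simps)
    qed
    finally show ?thesis using Lalg_scale[OF a(1)] by blast
  qed
  then show ?thesis using is_adjoint_scaled[OF TS] by (auto simp: RCP_simps)
qed

lemma RCP_square_approx:
  assumes c: "c \<in> acarrier RCP" and adj: "is_adjoint c c'" and e: "e > 0"
  shows "\<exists>a\<in>Lalg. \<forall>\<xi>\<in>ell2. ell2_norm (ell2_minus (c' (c \<xi>)) (left_mult a \<xi>)) \<le> e * ell2_norm \<xi>"
proof -
  define K where "K = op_norm c + 1"
  have K: "K \<ge> 1" "op_norm c \<le> K" using op_norm_nonneg[OF adj] by (auto simp: K_def)
  \<comment> \<open>\<open>K\<close> bounds c* and, as d is at most 1, also b. Each of the two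
    errors is thus at most d K, and together they stay below e.\<close>
  define d where "d = min 1 (e / (2 * K))"
  have d: "0 < d" "d \<le> 1" "d * (2 * K) \<le> e"
  proof -
    show "0 < d" using e K by (simp add: d_def)
    show "d \<le> 1" by (simp add: d_def)
    have "d * (2 * K) \<le> e / (2 * K) * (2 * K)" using K by (intro mult_right_mono) (auto simp: d_def)
    then show "d * (2 * K) \<le> e" using K by simp
  qed
  obtain b where b: "b \<in> Lalg" "op_dist c (left_mult b) < d" using c d by (auto simp: RCP_simps)
  note bA = left_mult_adjoint[OF b(1)]
  note adj' = is_adjoint_sym[OF adj] and bA' = is_adjoint_sym[OF bA]
  have "ell2_norm (ell2_minus (c' (c \<xi>)) (left_mult (L_times (L_star b) b) \<xi>)) \<le> e * ell2_norm \<xi>"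
    if \<xi>: "\<xi> \<in> ell2" for \<xi>
  proof -
    let ?n = "ell2_norm \<xi>" and ?b = "left_mult b \<xi>"
    have n0: "?n \<ge> 0" by (rule ell2_norm_nonneg[OF \<xi>])
    have in2: "c \<xi> \<in> ell2" "?b \<in> ell2" using is_adjointD(1)[OF adj \<xi>] b \<xi> by auto
    have in3: "c' (c \<xi>) \<in> ell2" "c' ?b \<in> ell2" "left_mult (L_star b) ?b \<in> ell2"
      using is_adjointD(2)[OF adj] in2 Lalg_star[OF b(1)] by auto
    have cb: "ell2_norm (ell2_minus (c \<xi>) ?b) \<le> d * ?n"
      using op_dist_bound[OF adj bA \<xi>] mult_right_mono[OF less_imp_le[OF b(2)] n0] by linarith
    have "ell2_norm (ell2_minus (c' (c \<xi>)) (c' ?b)) \<le> op_norm c' * ell2_norm (ell2_minus (c \<xi>) ?b)"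
      unfolding is_adjoint_minus[OF adj' in2, symmetric] using in2 by (intro op_norm_bound[OF adj']) auto
    also have "\<dots> \<le> K * (d * ?n)"
      using op_norm_adjoint[OF adj] K cb ell2_norm_nonneg[OF ell2_minus_in[OF in2]]
      by (intro mult_mono) auto
    finally have 1: "ell2_norm (ell2_minus (c' (c \<xi>)) (c' ?b)) \<le> K * (d * ?n)" .
    have "ell2_norm ?b \<le> ell2_norm (c \<xi>) + ell2_norm (ell2_minus (c \<xi>) ?b)" by (rule ell2_norm_le_minus[OF in2])
    also have "\<dots> \<le> op_norm c * ?n + 1 * ?n"
      using op_norm_bound[OF adj \<xi>] cb mult_right_mono[OF d(2) n0] by linarith
    also have "\<dots> = K * ?n" by (simp add: K_def distrib_right)
    finally have bn: "ell2_norm ?b \<le> K * ?n" .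
    have "ell2_norm (ell2_minus (c' ?b) (left_mult (L_star b) ?b)) \<le> op_dist c' (left_mult (L_star b)) * ell2_norm ?b"
      by (rule op_dist_bound[OF adj' bA' in2(2)])
    also have "\<dots> \<le> d * (K * ?n)"
      using op_dist_adjoint[OF adj bA] b(2) d bn ell2_norm_nonneg[OF in2(2)] by (intro mult_mono) auto
    finally have 2: "ell2_norm (ell2_minus (c' ?b) (left_mult (L_star b) ?b)) \<le> d * (K * ?n)" .
    have "ell2_norm (ell2_minus (c' (c \<xi>)) (left_mult (L_star b) ?b)) \<le> d * (2 * K) * ?n"
      using ell2_norm_minus_triangle[OF in3] 1 2 by (simp add: algebra_simps)
    also have "\<dots> \<le> e * ?n" by (rule mult_right_mono[OF d(3) n0])
    finally show ?thesis by (simp add: left_mult_compose[OF Lalg_star[OF b(1)] b(1) \<xi>])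
  qed
  then show ?thesis using Lalg_times[OF Lalg_star[OF b(1)] b(1)] by blast
qed

text \<open>The vector \<delta>_e reads off the coefficient at \<open>\<one>\<close>, linking an
  operator to the values of its approximating sum.\<close>

lemma L_inner_one:
  assumes a: "a \<in> Lalg"
  shows "L_inner (isom \<one>) a x = a \<one> x"
proof -
  have "L_inner (isom \<one>) a x = cnj (fib (isom \<one>) x \<one>) * fib a x \<one>"
    using L_inner_eq'[OF isom_in[OF one_closed] a, of "{\<one>}" x] supp_isom[of \<one>] by simp
  then show ?thesis
    using LalgD(4)[OF a one_closed, of x] act_one[of x] dom_one by (auto simp: fib_def isom_def)
qed

lemma one_norm: "ell2_norm (emb (isom \<one>)) \<le> 1"
proof -
  have "L_fnorm (isom \<one>) p \<le> 1" for p
    unfolding L_fnorm_def by (simp add: L_inner_one) (simp add: isom_def)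
  then show ?thesis by (simp add: ell2_norm_emb L_norm_leI)
qed

text \<open>If c kills \<delta>_e, an approximant a of c satisfies a \<delta>_e = a, so a itself is
  small in the module norm. By \<open>L_times_right_bound\<close> so is a b, hence c kills b;
  density does the rest.\<close>

lemma RCP_separating:
  assumes c: "c \<in> acarrier RCP" and adj: "is_adjoint c c'"
    and zero: "c (emb (isom \<one>)) = ell2_zero" and \<xi>: "\<xi> \<in> ell2"
  shows "c \<xi> = ell2_zero"
proof -
  have emb0: "c (emb b) = ell2_zero" if b: "b \<in> Lalg" for b
  proof -
    obtain K where K0: "\<And>t. K t \<ge> (0::real)" and K: "\<And>t y. cmod (b t y) \<le> K t"
      using Lalg_bounded[OF b] by auto
    let ?C = "\<Sum>t\<in>supp b. K t"
    have C0: "?C \<ge> 0" using K0 by (simp add: sum_nonneg)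
    have cb: "c (emb b) \<in> ell2" using is_adjointD(1)[OF adj] b by simp
    have "ell2_norm (c (emb b)) \<le> 0"
    proof (rule nonpos_if_le_all_multiples)
      show "0 \<le> ?C + ell2_norm (emb b)" using C0 ell2_norm_nonneg b by simp
      fix e :: real assume e: "e > 0"
      obtain a where a: "a \<in> Lalg" "op_dist c (left_mult a) < e" using c e by (auto simp: RCP_simps)
      have close: "ell2_norm (ell2_minus (left_mult a \<eta>) (c \<eta>)) \<le> e * ell2_norm \<eta>" if \<eta>: "\<eta> \<in> ell2" for \<eta>
        using op_dist_bound[OF adj left_mult_adjoint[OF a(1)] \<eta>] a mult_right_mono[OF less_imp_le[OF a(2)] ell2_norm_nonneg[OF \<eta>]]
          ell2_norm_minus_commute[of "c \<eta>" "left_mult a \<eta>"] is_adjointD(1)[OF adj \<eta>] \<eta> by simp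
      have "L_norm a = ell2_norm (left_mult a (emb (isom \<one>)))"
        using a by (simp add: left_mult_emb times_one ell2_norm_emb)
      also have "\<dots> \<le> ell2_norm (c (emb (isom \<one>))) + ell2_norm (ell2_minus (c (emb (isom \<one>))) (left_mult a (emb (isom \<one>))))"
        using a zero by (intro ell2_norm_le_minus) auto
      also have "\<dots> \<le> e * ell2_norm (emb (isom \<one>))"
        using close[of "emb (isom \<one>)"] ell2_norm_minus_commute[of "c (emb (isom \<one>))" "left_mult a (emb (isom \<one>))"] a zero
        by (simp add: ell2_norm_zero)
      also have "\<dots> \<le> e" using one_norm e by (simp add: mult_left_le)
      finally have La: "L_norm a \<le> e" .
      have "ell2_norm (c (emb b)) \<le> ell2_norm (left_mult a (emb b)) + ell2_norm (ell2_minus (left_mult a (emb b)) (c (emb b)))"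
        using a b cb by (intro ell2_norm_le_minus) auto
      also have "\<dots> \<le> ?C * L_norm a + e * ell2_norm (emb b)"
        using close[of "emb b"] b L_times_right_bound[OF a(1) b K]
        by (simp add: left_mult_emb a ell2_norm_emb Lalg_times)
      also have "\<dots> \<le> ?C * e + e * ell2_norm (emb b)" using mult_left_mono[OF La C0] by simp
      finally show "ell2_norm (c (emb b)) \<le> e * (?C + ell2_norm (emb b))" by (simp add: algebra_simps)
    qed
    then show ?thesis using ell2_norm_zeroD[OF cb] by simp
  qed
  have c\<xi>: "c \<xi> \<in> ell2" using is_adjointD(1)[OF adj \<xi>] .
  have "ell2_norm (c \<xi>) \<le> 0"
  proof (rule nonpos_if_le_all_multiples)
    show "0 \<le> op_norm c" by (rule op_norm_nonneg[OF adj])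
    fix e :: real assume e: "e > 0"
    obtain b where b: "b \<in> Lalg" "ell2_norm (ell2_minus \<xi> (emb b)) < e" using ell2_dense[OF \<xi> e] .
    have "ell2_norm (c \<xi>) \<le> ell2_norm (c (emb b)) + ell2_norm (ell2_minus (c (emb b)) (c \<xi>))"
      using c\<xi> emb0[OF b(1)] by (intro ell2_norm_le_minus) auto
    also have "\<dots> = ell2_norm (c (ell2_minus (emb b) \<xi>))"
      using b \<xi> by (simp add: emb0 ell2_norm_zero is_adjoint_minus[OF adj])
    also have "\<dots> \<le> op_norm c * ell2_norm (ell2_minus (emb b) \<xi>)"
      using b \<xi> by (intro op_norm_bound[OF adj]) auto
    also have "\<dots> \<le> op_norm c * e"
      using b \<xi> ell2_norm_minus_commute[of \<xi> "emb b"] op_norm_nonneg[OF adj] by (intro mult_left_mono) auto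
    finally show "ell2_norm (c \<xi>) \<le> e * op_norm c" by (simp add: mult.commute)
  qed
  then show ?thesis using ell2_norm_zeroD[OF c\<xi>] by simp
qed

text \<open>The order of quantifiers matters: l depends on c alone, so a single normalisation by its
  square root serves every accuracy e.\<close>

lemma RCP_compression:
  assumes contract: "\<And>F U. finite F \<Longrightarrow> F \<subseteq> carrier G - {\<one>} \<Longrightarrow> openin X U \<Longrightarrow> U \<noteq> {} \<Longrightarrow>
      \<exists>g\<in>carrier G. D (inv g) = topspace X \<and> D g \<subseteq> U \<and> (\<forall>t\<in>F. \<forall>y\<in>D g \<inter> D t. \<theta> (inv t) y \<notin> D g)"
    and c: "c \<in> acarrier RCP" and adj: "is_adjoint c c'" and nz: "\<exists>\<xi>\<in>ell2. c \<xi> \<noteq> ell2_zero"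
  shows "\<exists>l>0. \<forall>e>0. \<exists>g\<in>carrier G. \<forall>\<eta>\<in>ell2. ell2_norm (ell2_minus
     (left_mult (isom (inv g)) (c' (c (left_mult (isom g) \<eta>)))) (ell2_scale (of_real l) \<eta>)) \<le> e * ell2_norm \<eta>"
proof -
  let ?d = "emb (isom \<one>)"
  have d: "?d \<in> ell2" by simp
  have cd: "c ?d \<in> ell2" and c'cd: "c' (c ?d) \<in> ell2"
    using is_adjointD(1,2)[OF adj] d by blast+
  have "c ?d \<noteq> ell2_zero" using RCP_separating[OF c adj] nz by blast
  then obtain x0 where x0: "ell2_fnorm (c ?d) x0 \<noteq> 0"
    using ell2_norm_leI[OF cd, of 0] ell2_norm_zeroD[OF cd] by fastforce
  define l where "l = (ell2_fnorm (c ?d) x0)\<^sup>2"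
  have l: "l > 0" using x0 by (simp add: l_def)
  have inner_l: "ell2_inner ?d (c' (c ?d)) x0 = of_real l"
    using is_adjointD(3)[OF adj d cd, of x0] ell2_inner_self_real[OF cd, of x0] by (simp add: l_def)
  have "\<exists>g\<in>carrier G. \<forall>\<eta>\<in>ell2. ell2_norm (ell2_minus
     (left_mult (isom (inv g)) (c' (c (left_mult (isom g) \<eta>)))) (ell2_scale (of_real l) \<eta>)) \<le> e * ell2_norm \<eta>"
    if e: "e > 0" for e :: real
  proof -
    \<comment> \<open>Replacing c* c by a finite sum costs e', and the variation of its coefficient
      on \<open>U\<close> costs 2 e', whence e/3. Staying below l keeps that coefficient nonzero at
      x0.\<close>
    define e' where "e' = min (e / 3) (l / 2)"
    have e': "e' > 0" "3 * e' \<le> e" "e' < l" using e l by (auto simp: e'_def)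
    obtain a where a: "a \<in> Lalg"
      and close: "\<And>\<xi>. \<xi> \<in> ell2 \<Longrightarrow> ell2_norm (ell2_minus (c' (c \<xi>)) (left_mult a \<xi>)) \<le> e' * ell2_norm \<xi>"
      using RCP_square_approx[OF c adj e'(1)] by blast
    have ad: "left_mult a ?d \<in> ell2" using a by simp
    have "ell2_inner ?d (left_mult a ?d) x0 = a \<one> x0"
      using a by (simp add: left_mult_emb times_one ell2_inner_emb L_inner_one)
    then have "cmod (of_real l - a \<one> x0) = cmod (ell2_inner ?d (ell2_minus (c' (c ?d)) (left_mult a ?d)) x0)"
      using ell2_inner_minus_right[OF c'cd ad d, of x0] inner_l by simp
    also have "\<dots> \<le> ell2_norm ?d * ell2_norm (ell2_minus (c' (c ?d)) (left_mult a ?d))"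
      using c'cd ad d by (intro ell2_inner_le) auto
    also have "\<dots> \<le> 1 * (e' * ell2_norm ?d)"
      using one_norm close[OF d] ell2_norm_nonneg[OF ell2_minus_in[OF c'cd ad]] by (intro mult_mono) auto
    also have "\<dots> \<le> e'" using one_norm e' by (simp add: mult_left_le)
    finally have a_x0: "cmod (of_real l - a \<one> x0) \<le> e'" .
    \<comment> \<open>So far x0 is any point of the underlying type. Coefficients vanish off
      \<open>X\<close>, so a nonzero value puts x0 into \<open>X\<close>.\<close>
    then have "a \<one> x0 \<noteq> 0" using e' l by auto
    then have x0_in: "x0 \<in> topspace X" using LalgD(4)[OF a one_closed, of x0] dom_one by auto
    \<comment> \<open>The value at x0 is within e' of l; the radius 2 e' makes the ball contain it
      strictly.\<close>
    define U where "U = {x \<in> topspace X. a \<one> x \<in> ball (of_real l) (2 * e')}"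
    have "openin X U" unfolding U_def
      by (rule openin_continuous_map_preimage[OF LalgD(6)[OF a]]) simp
    moreover have "x0 \<in> U" using x0_in a_x0 e' by (simp add: U_def dist_norm)
    ultimately obtain g where g: "g \<in> carrier G" "D (inv g) = topspace X" "D g \<subseteq> U"
      and free: "\<And>t y. t \<in> supp a - {\<one>} \<Longrightarrow> y \<in> D g \<inter> D t \<Longrightarrow> \<theta> (inv t) y \<notin> D g"
      using contract[of "supp a - {\<one>}" U] LalgD(1,2)[OF a] by blast
    let ?s = "isom g" and ?s' = "isom (inv g)"
    have s: "?s \<in> Lalg" "?s' \<in> Lalg" using g by auto
    define h where "h = L_times ?s' (L_times a ?s)"
    have h: "h \<in> Lalg" unfolding h_def by (intro Lalg_times s a)
    have h_eq: "h = (\<lambda>r x. if r = \<one> \<and> x \<in> topspace X then a \<one> (\<theta> g x) else 0)"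
      unfolding h_def by (rule compression[OF g(1,2) a]) (use free in blast)
    \<comment> \<open>The compressed sum minus the scalar l is a function at \<open>\<one>\<close>,
      so its norm is governed by the variation on \<open>U\<close>.\<close>
    let ?k = "L_diff h (L_scale (of_real l) (isom \<one>))"
    note one_l = Lalg_scale[OF isom_in[OF one_closed], of "of_real l"]
    have k: "?k \<in> Lalg" by (rule Lalg_diff[OF h one_l])
    have k_supp: "supp ?k \<subseteq> {\<one>}" by (auto simp: supp_def h_eq isom_def)
    have k_le: "cmod (?k t y) \<le> 2 * e'" for t y
    proof (cases "t = \<one> \<and> y \<in> topspace X")
      case True
      then have "\<theta> g y \<in> U" using act_closed[OF g(1), of y] g by auto
      then show ?thesis using True
        by (simp add: U_def h_eq isom_def dom_one dist_norm norm_minus_commute)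
    qed (use e' in \<open>auto simp: h_eq isom_def dom_one\<close>)
    have "ell2_norm (ell2_minus (left_mult ?s' (c' (c (left_mult ?s \<eta>)))) (ell2_scale (of_real l) \<eta>)) \<le> e * ell2_norm \<eta>"
      if \<eta>: "\<eta> \<in> ell2" for \<eta>
    proof -
      have s\<eta>: "left_mult ?s \<eta> \<in> ell2" using s \<eta> by simp
      then have in2: "c' (c (left_mult ?s \<eta>)) \<in> ell2" "left_mult a (left_mult ?s \<eta>) \<in> ell2"
        using is_adjointD(1,2)[OF adj] a by auto
      have h\<eta>: "left_mult h \<eta> = left_mult ?s' (left_mult a (left_mult ?s \<eta>))"
        using s a \<eta> by (simp add: h_def left_mult_compose Lalg_times)
      have "ell2_norm (ell2_minus (left_mult ?s' (c' (c (left_mult ?s \<eta>)))) (left_mult h \<eta>))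
          \<le> ell2_norm (ell2_minus (c' (c (left_mult ?s \<eta>))) (left_mult a (left_mult ?s \<eta>)))"
        unfolding h\<eta> is_adjoint_minus[OF left_mult_adjoint[OF s(2)] in2, symmetric]
        using g in2 by (intro left_mult_isom_norm) auto
      also have "\<dots> \<le> e' * ell2_norm (left_mult ?s \<eta>)" by (rule close[OF s\<eta>])
      also have "\<dots> \<le> e' * ell2_norm \<eta>" using left_mult_isom_norm[OF g(1) \<eta>] e' by simp
      finally have 1: "ell2_norm (ell2_minus (left_mult ?s' (c' (c (left_mult ?s \<eta>)))) (left_mult h \<eta>)) \<le> e' * ell2_norm \<eta>" .
      have 2: "ell2_norm (ell2_minus (left_mult h \<eta>) (ell2_scale (of_real l) \<eta>)) \<le> 2 * e' * ell2_norm \<eta>"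
        using left_mult_norm[OF k k_supp k_le \<eta>]
        unfolding left_mult_diff[OF h one_l \<eta>] left_mult_scale[OF isom_in[OF one_closed] \<eta>] left_mult_one[OF \<eta>] .
      have "ell2_norm (ell2_minus (left_mult ?s' (c' (c (left_mult ?s \<eta>)))) (ell2_scale (of_real l) \<eta>)) \<le> (3 * e') * ell2_norm \<eta>"
        using ell2_norm_minus_triangle[of "left_mult ?s' (c' (c (left_mult ?s \<eta>)))" "left_mult h \<eta>" "ell2_scale (of_real l) \<eta>"]
          1 2 in2 s h \<eta> by simp
      also have "\<dots> \<le> e * ell2_norm \<eta>" by (rule mult_right_mono[OF e'(2) ell2_norm_nonneg[OF \<eta>]])
      finally show ?thesis .
    qed
    then show ?thesis using g(1) by blast
  qed
  then show ?thesis using l by blast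
qed

section \<open>Characters and Cuntz comparison\<close>

lemma compose_left_mult:
  assumes "a \<in> Lalg" "b \<in> Lalg"
  shows "compose ell2 (left_mult a) (left_mult b) = left_mult (L_times a b)"
  by (rule extensionalityI[of _ ell2]) (auto simp: compose_eq left_mult_compose assms left_mult_extensional)

lemma left_mult_zero: "\<xi> \<in> ell2 \<Longrightarrow> left_mult (\<lambda>_ _. 0) \<xi> = ell2_zero"
  using left_mult_norm[OF Lalg_zero, of \<one> 0 \<xi>] ell2_norm_zeroD[of "left_mult (\<lambda>_ _. 0) \<xi>"] Lalg_zero
  by (simp add: supp_def)

lemma ell2_scale_zero: "ell2_scale c ell2_zero = ell2_zero"
  by (rule ell2_norm_zeroD) (auto simp: ell2_norm_scale ell2_norm_zero)

lemma ell2_plus_zero: "ell2_plus ell2_zero ell2_zero = ell2_zero"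
  by (rule ell2_norm_zeroD) (use ell2_norm_plus[of ell2_zero ell2_zero] in \<open>auto simp: ell2_norm_zero\<close>)

text \<open>Both s_g* s_g and s_h* s_h are the unit, so a character is nonzero on s_g* and on s_h,
  although their product s_g* s_h is 0.\<close>

lemma no_character_if_orthogonal_isometries:
  assumes g: "g \<in> carrier G" "D (inv g) = topspace X" and h: "h \<in> carrier G" "D (inv h) = topspace X"
    and disj: "D g \<inter> D h = {}"
  shows "\<not> alg_character RCP ch"
proof
  let ?l = "\<lambda>g. left_mult (isom g)" and ?Z = "left_mult (\<lambda>_ _. 0)"
  assume ch: "alg_character RCP ch"
  have mult: "ch (compose ell2 S T) = ch S * ch T" if "S \<in> acarrier RCP" "T \<in> acarrier RCP" for S T
    using ch that by (simp add: alg_character_def RCP_simps(3))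
  have l_in: "?l k \<in> acarrier RCP" if "k \<in> carrier G" for k using that by (simp add: RCP_left_mult)
  have Z: "?Z \<in> acarrier RCP" by (rule RCP_left_mult[OF Lalg_zero])
  obtain T where T: "T \<in> acarrier RCP" "ch T \<noteq> 0" using ch by (auto simp: alg_character_def)
  then obtain S where TS: "is_adjoint T S" by (auto simp: RCP_simps)
  \<comment> \<open>Characters are not assumed unital; multiplying an element of nonzero value by
    the unit gives the unit a nonzero value.\<close>
  have "compose ell2 (?l \<one>) T = T"
    by (rule extensionalityI[of _ ell2])
      (use is_adjointD(1,4)[OF TS] in \<open>auto simp: compose_eq left_mult_one\<close>)
  then have one: "ch (?l \<one>) \<noteq> 0" using mult[OF l_in[OF one_closed] T(1)] T(2) by auto
  have unit: "ch (?l (inv k)) * ch (?l k) = ch (?l \<one>)" if "k \<in> carrier G" "D (inv k) = topspace X" for k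
    using mult[OF l_in l_in, of "inv k" k] that by (simp add: compose_left_mult isom_isometry)
  have "ascale RCP 0 ?Z = ?Z" unfolding RCP_simps
    by (rule extensionalityI[of _ ell2]) (auto simp: left_mult_zero ell2_scale_zero left_mult_extensional)
  then have "ch ?Z = 0" using ch Z unfolding alg_character_def by (metis mult_zero_left)
  then have "ch (?l (inv g)) * ch (?l h) = 0"
    using mult[OF l_in l_in, of "inv g" h] g(1) h(1) by (simp add: compose_left_mult isom_orthogonal[OF g(1) h(1) disj])
  then show False using one unit[OF g] unit[OF h] by auto
qed

text \<open>Compression by small sets turns a nonzero a into approximately a scalar, from which b is
  rebuilt. The disjoint sets U and V supply the orthogonal isometries that rule out
  characters.\<close>

theorem purely_infinite_reduced_crossed_product:
  assumes contract: "\<And>F U. finite F \<Longrightarrow> F \<subseteq> carrier G - {\<one>} \<Longrightarrow> openin X U \<Longrightarrow> U \<noteq> {} \<Longrightarrow>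
      \<exists>g\<in>carrier G. D (inv g) = topspace X \<and> D g \<subseteq> U \<and> (\<forall>t\<in>F. \<forall>y\<in>D g \<inter> D t. \<theta> (inv t) y \<notin> D g)"
    and U: "openin X U" "U \<noteq> {}" and V: "openin X V" "V \<noteq> {}" and disj: "U \<inter> V = {}"
  shows "purely_infinite reduced_crossed_product"
  unfolding purely_infinite_def
proof (intro conjI allI impI)
  obtain g h where "g \<in> carrier G" "D (inv g) = topspace X" "D g \<subseteq> U"
    and "h \<in> carrier G" "D (inv h) = topspace X" "D h \<subseteq> V"
    using contract[of "{}", OF _ _ U] contract[of "{}", OF _ _ V] by auto
  then show "\<nexists>ch. alg_character RCP ch"
    using no_character_if_orthogonal_isometries[of g h] disj by blast
next
  fix a b assume "alg_positive RCP a" "alg_positive RCP b" and ideal: "b \<in> generated_closed_ideal RCP a"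
  then obtain c d where c: "c \<in> acarrier RCP" "a = compose ell2 (astar adjointable_ops c) c"
    and d: "d \<in> acarrier RCP" "b = compose ell2 (astar adjointable_ops d) d"
    by (auto simp: alg_positive_def RCP_simps(3,5))
  obtain c' where c': "is_adjoint c c'" using c(1) by (auto simp: RCP_simps)
  obtain d' where d': "is_adjoint d d'" using d(1) by (auto simp: RCP_simps)
  have a_eq: "a = compose ell2 c' c" using c(2) astar_eq[OF c'] by simp
  have b_eq: "b = compose ell2 d' d" using d(2) astar_eq[OF d'] by simp
  note aA = is_adjoint_compose[OF is_adjoint_sym[OF c'] c', folded a_eq]
  note bA = is_adjoint_compose[OF is_adjoint_sym[OF d'] d', folded b_eq]
  show "cuntz_below RCP b a"
  proof (cases "\<exists>\<xi>\<in>ell2. c \<xi> \<noteq> ell2_zero")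
    \<comment> \<open>Here a = 0. The zero operator alone is a closed ideal containing a, so b = 0
      as well, and the constant zero sequence witnesses the comparison.\<close>
    case False
    let ?Z = "left_mult (\<lambda>_ _. 0)"
    note ZA = left_mult_adjoint[OF Lalg_zero]
    have Z_in: "?Z \<in> acarrier RCP" by (rule RCP_left_mult[OF Lalg_zero])
    have ZI: "T = ?Z" if "T \<in> extensional ell2" "\<And>\<xi>. \<xi> \<in> ell2 \<Longrightarrow> T \<xi> = ell2_zero" for T
      by (rule extensionalityI[of _ ell2]) (use that in \<open>auto simp: left_mult_zero left_mult_extensional\<close>)
    have aZ: "a = ?Z"
      by (rule ZI) (use False is_adjoint_zero[OF is_adjoint_sym[OF c']] in \<open>auto simp: a_eq compose_eq\<close>)
    have "closed_ideal RCP {?Z}" unfolding closed_ideal_def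
    proof (intro conjI ballI allI impI)
      fix S T assume "S \<in> {?Z}" "T \<in> {?Z}"
      moreover have "(\<lambda>\<xi>\<in>ell2. ell2_plus (?Z \<xi>) (?Z \<xi>)) = ?Z"
        by (rule ZI) (simp_all add: left_mult_zero ell2_plus_zero)
      ultimately show "aplus RCP S T \<in> {?Z}" by (simp only: RCP_simps(2) singleton_iff)
    next
      fix c S assume "S \<in> {?Z}"
      moreover have "(\<lambda>\<xi>\<in>ell2. ell2_scale c (?Z \<xi>)) = ?Z"
        by (rule ZI) (simp_all add: left_mult_zero ell2_scale_zero)
      ultimately show "ascale RCP c S \<in> {?Z}" by (simp only: RCP_simps(4) singleton_iff)
    next
      fix S T assume "S \<in> {?Z}" and T: "T \<in> acarrier RCP"
      then obtain T' where T': "is_adjoint T T'" by (auto simp: RCP_simps)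
      have S: "S = ?Z" using \<open>S \<in> {?Z}\<close> by simp
      have "compose ell2 ?Z T = ?Z"
        by (rule ZI) (simp_all add: compose_eq left_mult_zero is_adjointD(1)[OF T'])
      moreover have "compose ell2 T ?Z = ?Z"
        by (rule ZI) (simp_all add: compose_eq left_mult_zero is_adjoint_zero[OF T'])
      ultimately show "atimes RCP S T \<in> {?Z}" "atimes RCP T S \<in> {?Z}"
        by (simp_all add: RCP_simps(3) S)
    next
      fix T assume T: "T \<in> acarrier RCP" and lim: "\<forall>e>0. \<exists>S\<in>{?Z}. adist RCP T S < e"
      obtain T' where T': "is_adjoint T T'" using T by (auto simp: RCP_simps)
      have "op_dist T ?Z \<le> 0"
      proof (rule field_le_epsilon)
        show "op_dist T ?Z \<le> 0 + e" if "e > 0" for e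
          using lim[rule_format, OF that] by (simp add: RCP_simps(6))
      qed
      then show "T \<in> {?Z}" using op_dist_zeroD[OF T' ZA] by simp
    qed (use Z_in in auto)
    then have bZ: "b = ?Z" using ideal aZ by (auto simp: generated_closed_ideal_def)
    have "atimes RCP (atimes RCP (astar RCP ?Z) ?Z) ?Z = ?Z"
      unfolding RCP_simps(3,5) astar_eq[OF ZA]
      by (rule ZI) (simp_all add: compose_eq left_mult_zero is_adjoint_zero[OF is_adjoint_sym[OF ZA]])
    then show ?thesis unfolding cuntz_below_def aZ bZ
      using Z_in op_dist_self[OF ZA] by (intro exI[of _ "\<lambda>_. ?Z"]) (simp add: RCP_simps(6))
  next
    case True
    obtain l where l: "l > 0" and comp: "\<And>e. e > 0 \<Longrightarrow> \<exists>g\<in>carrier G. \<forall>\<eta>\<in>ell2. ell2_norm (ell2_minus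
        (left_mult (isom (inv g)) (c' (c (left_mult (isom g) \<eta>)))) (ell2_scale (of_real l) \<eta>)) \<le> e * ell2_norm \<eta>"
      using RCP_compression[OF contract c(1) c' True] by blast
    \<comment> \<open>Chosen so that the scalar l between two factors m becomes 1; m is real, so the
      adjoint is rescaled by the same factor.\<close>
    define m where "m = complex_of_real (1 / sqrt l)"
    have m: "cnj m = m" "m * (of_real l * m) = 1"
    proof -
      have "1 / sqrt l * (l * (1 / sqrt l)) = 1" using l by (simp add: field_simps)
      then have "complex_of_real (1 / sqrt l * (l * (1 / sqrt l))) = 1" by (simp only: of_real_1)
      then show "m * (of_real l * m) = 1" by (simp only: m_def of_real_mult)
    qed (simp add: m_def)
    define f where "f = (\<lambda>\<xi>\<in>ell2. ell2_scale m (d \<xi>))"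
    define f' where "f' = (\<lambda>\<xi>\<in>ell2. ell2_scale m (d' \<xi>))"
    have fA: "is_adjoint f f'" using is_adjoint_scaled[OF d', of m] m by (simp add: f_def f'_def)
    have f_in: "f \<in> acarrier RCP" unfolding f_def by (rule RCP_scale[OF d(1)])
    note fA' = is_adjoint_sym[OF fA]
    \<comment> \<open>With f = m d this says b = f* l f, so it remains to replace l by a compression
      of a.\<close>
    have b_f: "b \<xi> = f' (ell2_scale (of_real l) (f \<xi>))" if \<xi>: "\<xi> \<in> ell2" for \<xi>
    proof -
      have in2: "d \<xi> \<in> ell2" "d' (d \<xi>) \<in> ell2" using is_adjointD(1,2)[OF d'] \<xi> by auto
      have "f' (ell2_scale (of_real l) (f \<xi>)) = ell2_scale m (ell2_scale (of_real l) (ell2_scale m (d' (d \<xi>))))"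
        using in2 \<xi> by (simp add: f_def f'_def is_adjoint_scale[OF is_adjoint_sym[OF d']])
      also have "\<dots> = d' (d \<xi>)"
        using in2 m
        by (intro ell2_eqI) (auto simp: ell2_inner_scale_left mult.assoc[symmetric])
      finally show ?thesis using \<xi> by (simp add: b_eq compose_eq)
    qed
    let ?M = "op_norm f' * op_norm f"
    have M0: "?M \<ge> 0" using op_norm_nonneg[OF fA] op_norm_nonneg[OF fA'] by simp
    \<comment> \<open>Surrounding the error by f* and f multiplies it by at most \<open>?M\<close>,
      so the result stays below 1/(k+1); the added 1 covers \<open>?M\<close> = 0.\<close>
    define e where "e = (\<lambda>k. 1 / (real (Suc k) * (?M + 1)))"
    have e0: "e k > 0" for k using M0 by (simp add: e_def)
    have "\<exists>g. \<forall>k. g k \<in> carrier G \<and> (\<forall>\<eta>\<in>ell2. ell2_norm (ell2_minus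
        (left_mult (isom (inv (g k))) (c' (c (left_mult (isom (g k)) \<eta>)))) (ell2_scale (of_real l) \<eta>)) \<le> e k * ell2_norm \<eta>)"
      using comp[OF e0] by (intro choice) blast
    then obtain g where g: "\<And>k. g k \<in> carrier G"
      and close: "\<And>k \<eta>. \<eta> \<in> ell2 \<Longrightarrow> ell2_norm (ell2_minus
        (left_mult (isom (inv (g k))) (c' (c (left_mult (isom (g k)) \<eta>)))) (ell2_scale (of_real l) \<eta>)) \<le> e k * ell2_norm \<eta>"
      by blast
    \<comment> \<open>Then r* a r = f* (s* a s) f, where s* a s is close to l.\<close>
    define r where "r = (\<lambda>k. compose ell2 (left_mult (isom (g k))) f)"
    have sA: "is_adjoint (left_mult (isom (g k))) (left_mult (isom (inv (g k))))" for k
      using left_mult_adjoint[OF isom_in[OF g]] by (simp add: star_isom g)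
    note rA = is_adjoint_compose[OF sA fA]
    have r_in: "r k \<in> acarrier RCP" for k unfolding r_def by (rule RCP_compose[OF isom_in[OF g] f_in])
    let ?q = "\<lambda>k. atimes RCP (atimes RCP (astar RCP (r k)) a) (r k)"
    have q_eq: "?q k = compose ell2 (compose ell2 (compose ell2 f' (left_mult (isom (inv (g k))))) a)
        (compose ell2 (left_mult (isom (g k))) f)" for k
      by (simp add: RCP_simps astar_eq[OF rA] r_def)
    have qA: "op_dist (?q k) b \<ge> 0" for k
      unfolding q_eq by (rule op_dist_nonneg[OF is_adjoint_compose[OF is_adjoint_compose[OF is_adjoint_sym[OF rA] aA] rA] bA])
    have le: "adist RCP (?q k) b \<le> inverse (real (Suc k))" for k
    proof -
      have "op_dist (?q k) b \<le> op_norm f' * (e k * op_norm f)"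
      proof (rule op_dist_least)
        fix \<xi> assume \<xi>: "\<xi> \<in> ell2"
        let ?w = "left_mult (isom (inv (g k))) (c' (c (left_mult (isom (g k)) (f \<xi>))))"
        have f\<xi>: "f \<xi> \<in> ell2" by (rule is_adjointD(1)[OF fA \<xi>])
        then have s\<xi>: "left_mult (isom (g k)) (f \<xi>) \<in> ell2" using g by simp
        then have cs\<xi>: "c' (c (left_mult (isom (g k)) (f \<xi>))) \<in> ell2" using is_adjointD(1,2)[OF c'] by blast
        then have w: "?w \<in> ell2" using g by simp
        have "?q k \<xi> = f' ?w"
          unfolding q_eq using \<xi> s\<xi> cs\<xi> by (simp add: compose_eq a_eq)
        then have "ell2_minus (?q k \<xi>) (b \<xi>) = f' (ell2_minus ?w (ell2_scale (of_real l) (f \<xi>)))"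
          using w f\<xi> by (simp add: b_f[OF \<xi>] is_adjoint_minus[OF fA'])
        then have "ell2_norm (ell2_minus (?q k \<xi>) (b \<xi>)) \<le> op_norm f' * ell2_norm (ell2_minus ?w (ell2_scale (of_real l) (f \<xi>)))"
          using w f\<xi> by (simp add: op_norm_bound[OF fA'])
        also have "\<dots> \<le> op_norm f' * (e k * (op_norm f * ell2_norm \<xi>))"
          by (intro mult_left_mono order_trans[OF close[OF f\<xi>]] op_norm_bound[OF fA \<xi>] less_imp_le[OF e0] op_norm_nonneg[OF fA'])
        finally show "ell2_norm (ell2_minus (?q k \<xi>) (b \<xi>)) \<le> op_norm f' * (e k * op_norm f) * ell2_norm \<xi>"
          by (simp add: mult.assoc)
      qed (use op_norm_nonneg[OF fA] op_norm_nonneg[OF fA'] e0[of k] in simp)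
      also have "\<dots> = ?M / (?M + 1) * inverse (real (Suc k))"
        by (simp add: e_def divide_inverse)
      also have "\<dots> \<le> 1 * inverse (real (Suc k))"
        using M0 by (intro mult_right_mono) auto
      finally show ?thesis by (simp add: RCP_simps(6))
    qed
    have "(\<lambda>k. adist RCP (?q k) b) \<longlonglongrightarrow> 0"
    proof (rule tendsto_zero_sandwich)
      show "norm (adist RCP (?q k) b) \<le> inverse (real (Suc k))" for k
        using le[of k] qA[of k] by (simp add: RCP_simps(6))
    qed (rule LIMSEQ_inverse_real_of_nat)
    then show ?thesis unfolding cuntz_below_def using r_in by blast
  qed
qed

end

section \<open>The Boava--Exel system of the integers\<close>

abbreviation BE_HG :: "(rat \<times> rat) monoid" where
  "BE_HG \<equiv> BE_G\<lparr>carrier := BE_H\<rparr>"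

lemma BE_HG_simps:
  "(u, w) \<in> carrier BE_HG \<longleftrightarrow> w > 0" "\<one>\<^bsub>BE_HG\<^esub> = (0, 1)"
  "w > 0 \<Longrightarrow> inv\<^bsub>BE_HG\<^esub> (u, w) = (- u / w, 1 / w)"
  using group.m_inv_consistent[OF group_BE_G subgroup_BE_H, of "(u, w)"] inv_BE_G[of w u]
  by (auto simp: BE_H_def)

section \<open>Integer moduli and basic open sets\<close>

lemma rat_dvd_trans: "rat_dvd u v \<Longrightarrow> rat_dvd v w \<Longrightarrow> rat_dvd u w"
  unfolding rat_dvd_def by (metis mult.assoc of_int_mult)

lemma pideal_mono: "rat_dvd w w' \<Longrightarrow> pideal w' \<subseteq> pideal w"
  unfolding rat_dvd_def pideal_def by (auto simp: mult.assoc simp flip: of_int_mult)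

lemma BE_points_coset:
  assumes "x \<in> BE_points" "w \<noteq> 0"
  obtains v where "v \<in> int_plus_pideal w" "x w = pcoset v w"
  using assms by (auto simp: BE_points_def)

text \<open>A coordinate determines those at all its divisors, so one coordinate at a common
  multiple encodes finitely many.\<close>

lemma BE_points_dvd:
  assumes x: "x \<in> BE_points" and nz: "w \<noteq> 0" "w' \<noteq> 0" and dvd: "rat_dvd w w'"
    and v: "x w' = pcoset v w'"
  shows "x w = pcoset v w"
proof -
  obtain u where u: "x = (\<lambda>w\<in>{w. w \<noteq> 0}. pcoset (u w) w)"
    and comp: "\<And>w w'. w \<noteq> 0 \<Longrightarrow> w' \<noteq> 0 \<Longrightarrow> rat_dvd w w' \<Longrightarrow> pcoset (u w') w = pcoset (u w) w"
    using x by (auto simp: BE_points_def)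
  have "u w' - v \<in> pideal w" using v nz u pideal_mono[OF dvd] by (auto simp: pcoset_eq_iff)
  then have "pcoset (u w') w = pcoset v w" by (simp add: pcoset_eq_iff)
  then show ?thesis using u nz comp[OF nz dvd] by simp
qed

lemma BE_points_int:
  assumes x: "x \<in> BE_points" and m: "m \<noteq> (0::int)"
  obtains k :: int where "x (of_int m) = pcoset (of_int k) (of_int m)"
proof -
  obtain v where v: "v \<in> int_plus_pideal (of_int m)" "x (of_int m) = pcoset v (of_int m)"
    using BE_points_coset[OF x, of "of_int m"] m by auto
  then obtain k z where "v = of_int k + z" "z \<in> pideal (of_int m)" by (auto simp: int_plus_pideal_def)
  then have "pcoset v (of_int m) = pcoset (of_int k) (of_int m)" by (simp add: pcoset_eq_iff)
  then show ?thesis using v that by simp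
qed

text \<open>The integers embed diagonally in \<open>X\<close>; their images show that residue
  classes are nonempty.\<close>

lemma const_in_BE_points: "(\<lambda>w\<in>{w. w \<noteq> 0}. pcoset (of_int k) w) \<in> BE_points"
proof -
  have "of_int k \<in> int_plus_pideal w" for w
    unfolding int_plus_pideal_def using pideal_zero[of w] by force
  then show ?thesis unfolding BE_points_def by (auto intro!: exI[of _ "\<lambda>_. of_int k"])
qed

text \<open>Positive integers are cofinal for divisibility, the numerator being a multiple of the
  fraction. Open sets can hence be described by integer moduli.\<close>

lemma rat_dvd_int:
  assumes "w \<noteq> (0::rat)"
  obtains n :: int where "n > 0" "rat_dvd w (of_int n)"
proof -
  obtain a b where w: "w = of_int a / of_int b" "b > 0"
    by (metis quotient_of_div quotient_of_denom_pos surj_pair)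
  then have "a \<noteq> 0" using assms by auto
  then have "\<bar>a\<bar> > 0" by simp
  moreover have "of_int \<bar>a\<bar> = w * of_int (sgn a * b)"
    using w by (simp add: abs_sgn mult.commute)
  then have "rat_dvd w (of_int \<bar>a\<bar>)" unfolding rat_dvd_def by blast
  ultimately show ?thesis using that by blast
qed

lemma rat_dvd_of_int: "m dvd n \<Longrightarrow> rat_dvd (of_int m) (of_int n)"
  unfolding rat_dvd_def by (metis dvd_def of_int_mult)

lemma BE_D_mono:
  assumes "m \<noteq> 0" "m' \<noteq> 0" "m dvd m'" "m dvd k' - k"
  shows "BE_D (of_int k', of_int m') \<subseteq> BE_D (of_int k, of_int m)"
proof
  fix x assume x: "x \<in> BE_D (of_int k', of_int m')"
  then have "x (of_int m) = pcoset (of_int k') (of_int m)"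
    using assms BE_points_dvd[of x "of_int m" "of_int m'"] by (auto simp: BE_D_def rat_dvd_of_int)
  moreover have "of_int k' - of_int k \<in> pideal (of_int m)"
    using assms(4) unfolding pideal_iff dvd_def by (metis of_int_diff of_int_mult)
  ultimately show "x \<in> BE_D (of_int k, of_int m)" using x by (auto simp: BE_D_def pcoset_eq_iff)
qed

lemma BE_D_disjoint:
  assumes "m \<noteq> 0" "\<not> m dvd k' - k"
  shows "BE_D (of_int k', of_int m) \<inter> BE_D (of_int k, of_int m) = {}"
proof -
  have "of_int k' - of_int k \<notin> pideal (of_int m)"
  proof
    assume "of_int k' - of_int k \<in> pideal (of_int m)"
    then obtain i where "rat_of_int (k' - k) = of_int (m * i)" by (auto simp: pideal_iff)
    then have "k' - k = m * i" by (simp only: of_int_eq_iff)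
    then show False using assms by simp
  qed
  then have "pcoset (of_int k') (of_int m) \<noteq> pcoset (of_int k) (of_int m)" by (simp add: pcoset_eq_iff)
  then show ?thesis by (auto simp: BE_D_def)
qed

text \<open>The inverse of (k, m) has modulus 1/m. All integers lie in (1/m), so the quotient at
  that coordinate is trivial and imposes no condition.\<close>

lemma BE_D_inv_full:
  assumes "m > 0"
  shows "BE_D (inv\<^bsub>BE_HG\<^esub> (of_int k, of_int m)) = topspace BE_X"
proof -
  have "x (1 / of_int m) = pcoset (- of_int k / of_int m) (1 / of_int m)" if x: "x \<in> BE_points" for x
  proof -
    obtain v where v: "v \<in> int_plus_pideal (1 / of_int m)" "x (1 / of_int m) = pcoset v (1 / of_int m)"
      using BE_points_coset[OF x, of "1 / of_int m"] assms by auto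
    then obtain j i where "v = of_int j + 1 / of_int m * of_int i"
      by (auto simp: int_plus_pideal_def pideal_iff)
    then have "v - - of_int k / of_int m = 1 / of_int m * of_int (m * j + i + k)"
      using assms by (simp add: field_simps)
    then have "pcoset v (1 / of_int m) = pcoset (- of_int k / of_int m) (1 / of_int m)"
      unfolding pcoset_eq_iff pideal_iff by blast
    then show ?thesis using v(2) by simp
  qed
  then show ?thesis using assms by (auto simp: BE_HG_simps BE_D_def topspace_BE_X)
qed

text \<open>A basic open set of the product restricts finitely many coordinates. The product m of
  integer multiples of them is a common multiple, so fixing the coordinate at m fixes them
  all.\<close>

lemma BE_basis:
  assumes U: "openin BE_X U" and x: "x \<in> U"
  obtains k m :: int where "m > 0" "x \<in> BE_D (of_int k, of_int m)" "BE_D (of_int k, of_int m) \<subseteq> U"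
proof -
  let ?I = "{w :: rat. w \<noteq> 0}" and ?Y = "\<lambda>w. discrete_topology ((\<lambda>u. pcoset u w) ` int_plus_pideal w)"
  obtain T where T: "openin (product_topology ?Y ?I) T" "U = T \<inter> BE_points"
    using U by (auto simp: BE_X_def openin_subtopology)
  have xp: "x \<in> BE_points" "x \<in> T" using x T by auto
  obtain W where W: "finite {i \<in> ?I. W i \<noteq> topspace (?Y i)}" "x \<in> PiE ?I W" "PiE ?I W \<subseteq> T"
    using T(1) xp(2) unfolding openin_product_topology_alt by meson
  let ?J = "{i \<in> ?I. W i \<noteq> topspace (?Y i)}"
  have "\<forall>i\<in>?J. \<exists>n::int. n > 0 \<and> rat_dvd i (of_int n)"
  proof
    fix i assume "i \<in> ?J"
    then have "i \<noteq> 0" by simp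
    then obtain n where "n > 0" "rat_dvd i (of_int n)" by (rule rat_dvd_int)
    then show "\<exists>n::int. n > 0 \<and> rat_dvd i (of_int n)" by (intro exI[of _ n] conjI)
  qed
  from bchoice[OF this] obtain n where "\<forall>i\<in>?J. n i > (0::int) \<and> rat_dvd i (of_int (n i))" by (elim exE)
  note n = this[rule_format]
  define m where "m = (\<Prod>i\<in>?J. n i)"
  have m: "m > 0" unfolding m_def by (rule prod_pos) (use n in simp)
  have dvd: "rat_dvd i (of_int m)" if i: "i \<in> ?J" for i
    unfolding m_def by (rule rat_dvd_trans[OF n[OF i, THEN conjunct2] rat_dvd_of_int[OF dvd_prodI[OF W(1) i, of n]]])
  obtain k where k: "x (of_int m) = pcoset (of_int k) (of_int m)"
    using BE_points_int[OF xp(1), of m] m by auto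
  have "BE_D (of_int k, of_int m) \<subseteq> U"
  proof
    fix y assume "y \<in> BE_D (of_int k, of_int m)"
    then have y: "y \<in> BE_points" "y (of_int m) = pcoset (of_int k) (of_int m)" by (auto simp: BE_D_def)
    have "y i \<in> W i" if i: "i \<in> ?I" for i
    proof (cases "i \<in> ?J")
      case True
      then have "y i = x i"
        using BE_points_dvd[OF y(1) _ _ dvd[OF True] y(2)] BE_points_dvd[OF xp(1) _ _ dvd[OF True] k] m i by simp
      then show ?thesis using W(2) i by auto
    next
      case False
      then have "W i = topspace (?Y i)" using i by blast
      moreover obtain v where "v \<in> int_plus_pideal i" "y i = pcoset v i"
        using y(1) i by (auto elim: BE_points_coset)
      ultimately show ?thesis by simp
    qed
    moreover have "y \<in> extensional ?I" using y(1) by (auto simp: BE_points_def)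
    ultimately have "y \<in> PiE ?I W" by (auto simp: PiE_def)
    then show "y \<in> U" using W(3) T(2) y(1) by blast
  qed
  moreover have "x \<in> BE_D (of_int k, of_int m)" using xp k by (simp add: BE_D_def)
  ultimately show ?thesis using that[OF m] by blast
qed

section \<open>Compactness of the space\<close>

lemma finite_cosets:
  assumes "w \<noteq> 0"
  shows "finite ((\<lambda>u. pcoset u w) ` int_plus_pideal w)"
proof -
  obtain n where n: "n > 0" "rat_dvd w (of_int n)" using rat_dvd_int[OF assms] .
  \<comment> \<open>Every coset has an integer representative, which matters only modulo the integer
    multiple n of w.\<close>
  have "(\<lambda>u. pcoset u w) ` int_plus_pideal w \<subseteq> (\<lambda>k. pcoset (of_int k) w) ` {0..<n}"
  proof
    fix C assume "C \<in> (\<lambda>u. pcoset u w) ` int_plus_pideal w"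
    then obtain k z where C: "C = pcoset (of_int k + z) w" "z \<in> pideal w" by (auto simp: int_plus_pideal_def)
    have "rat_of_int k - of_int (k mod n) = of_int n * of_int (k div n)"
      by (simp flip: of_int_mult of_int_diff add: minus_mod_eq_mult_div)
    then have "rat_of_int k - of_int (k mod n) \<in> pideal (of_int n)" unfolding pideal_iff by blast
    then have "rat_of_int k - of_int (k mod n) + z \<in> pideal w"
      using pideal_mono[OF n(2)] C(2) pideal_add by blast
    then have "C = pcoset (of_int (k mod n)) w" using C(1) by (simp add: pcoset_eq_iff algebra_simps)
    then show "C \<in> (\<lambda>k. pcoset (of_int k) w) ` {0..<n}" using n(1) by auto
  qed
  then show ?thesis by (rule finite_subset) simp
qed

lemma pcoset_subset_iff:
  assumes "rat_dvd w w'"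
  shows "pcoset v w' \<subseteq> pcoset u w \<longleftrightarrow> pcoset v w = pcoset u w"
proof
  assume "pcoset v w' \<subseteq> pcoset u w"
  moreover have "v \<in> pcoset v w'" by (simp add: pcoset_iff pideal_zero)
  ultimately have "v \<in> pcoset u w" by blast
  then show "pcoset v w = pcoset u w" by (simp add: pcoset_iff pcoset_eq_iff)
next
  assume "pcoset v w = pcoset u w"
  then have uv: "v - u \<in> pideal w" by (simp add: pcoset_eq_iff)
  show "pcoset v w' \<subseteq> pcoset u w"
  proof
    fix q assume "q \<in> pcoset v w'"
    then have "q - v \<in> pideal w" using pideal_mono[OF assms] by (auto simp: pcoset_iff)
    from pideal_add[OF this uv] show "q \<in> pcoset u w" by (simp add: pcoset_iff)
  qed
qed

text \<open>Compatibility is expressed by inclusion of cosets, without representatives; each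
  condition then involves just two coordinates.\<close>

lemma BE_points_eq:
  "BE_points = {x \<in> (\<Pi>\<^sub>E w\<in>{w. w \<noteq> 0}. (\<lambda>u. pcoset u w) ` int_plus_pideal w).
     \<forall>(w, w') \<in> {(w, w'). w \<noteq> 0 \<and> w' \<noteq> 0 \<and> rat_dvd w w'}. x w' \<subseteq> x w}" (is "_ = ?B")
proof (intro subset_antisym subsetI)
  fix x assume x: "x \<in> BE_points"
  have "x w' \<subseteq> x w" if nz: "w \<noteq> 0" "w' \<noteq> 0" and dvd: "rat_dvd w w'" for w w'
  proof -
    obtain v where v: "x w' = pcoset v w'" using BE_points_coset[OF x nz(2)] by metis
    show ?thesis using BE_points_dvd[OF x nz dvd v] v pcoset_subset_iff[OF dvd] by simp
  qed
  moreover have "x \<in> (\<Pi>\<^sub>E w\<in>{w. w \<noteq> 0}. (\<lambda>u. pcoset u w) ` int_plus_pideal w)"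
    using x by (auto simp: BE_points_def)
  ultimately show "x \<in> ?B" by blast
next
  fix x assume x: "x \<in> ?B"
  then have "\<forall>w\<in>{w. w \<noteq> 0}. \<exists>u. u \<in> int_plus_pideal w \<and> x w = pcoset u w" by (auto simp: PiE_def Pi_def)
  from bchoice[OF this] obtain u where u: "\<And>w. w \<noteq> 0 \<Longrightarrow> u w \<in> int_plus_pideal w \<and> x w = pcoset (u w) w" by auto
  have "x = (\<lambda>w\<in>{w. w \<noteq> 0}. pcoset (u w) w)"
    by (rule extensionalityI[of _ "{w. w \<noteq> 0}"]) (use x u in \<open>auto simp: PiE_def\<close>)
  moreover have "pcoset (u w') w = pcoset (u w) w" if "w \<noteq> 0" "w' \<noteq> 0" "rat_dvd w w'" for w w'
  proof -
    have "x w' \<subseteq> x w" using x that by auto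
    then show ?thesis using pcoset_subset_iff[OF that(3)] u that by simp
  qed
  ultimately show "x \<in> BE_points" unfolding BE_points_def using u by blast
qed

text \<open>The space is closed in a product of finite discrete spaces. An inclusion between two
  coordinates with finitely many values defines a finite union of closed cylinders.\<close>

lemma compact_BE_X: "compact_space BE_X"
proof -
  let ?I = "{w :: rat. w \<noteq> 0}" and ?Y = "\<lambda>w. discrete_topology ((\<lambda>u. pcoset u w) ` int_plus_pideal w)"
  let ?P = "product_topology ?Y ?I" and ?R = "{(w, w'). w \<noteq> 0 \<and> w' \<noteq> 0 \<and> rat_dvd w w'}"
  have top: "topspace ?P = (\<Pi>\<^sub>E w\<in>?I. (\<lambda>u. pcoset u w) ` int_plus_pideal w)"
    by (simp add: topspace_product_topology)
  have comp: "compact_space ?P"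
    using finite_cosets by (auto simp: compact_space_product_topology compact_space_discrete_topology)
  have "closedin ?P {x \<in> topspace ?P. x w' \<subseteq> x w}" if w: "w \<noteq> 0" "w' \<noteq> 0" for w w'
  proof -
    have c: "continuous_map ?P (?Y v) (\<lambda>x. x v)" if "v \<noteq> 0" for v
      using that by (intro continuous_map_product_projection) simp
    have cl: "closedin ?P {x \<in> topspace ?P. x v \<in> {C}}" if "v \<noteq> 0" "C \<in> topspace (?Y v)" for v C
      using that by (intro closedin_continuous_map_preimage[OF c]) auto
    have "{x \<in> topspace ?P. x w' \<subseteq> x w} =
      (\<Union>(C, C') \<in> {(C, C') \<in> topspace (?Y w) \<times> topspace (?Y w'). C' \<subseteq> C}.
        {x \<in> topspace ?P. x w \<in> {C}} \<inter> {x \<in> topspace ?P. x w' \<in> {C'}})"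
    proof (intro subset_antisym subsetI)
      fix x assume x: "x \<in> {x \<in> topspace ?P. x w' \<subseteq> x w}"
      then have "x w \<in> topspace (?Y w)" "x w' \<in> topspace (?Y w')"
        using w unfolding top by auto
      then show "x \<in> (\<Union>(C, C') \<in> {(C, C') \<in> topspace (?Y w) \<times> topspace (?Y w'). C' \<subseteq> C}.
        {x \<in> topspace ?P. x w \<in> {C}} \<inter> {x \<in> topspace ?P. x w' \<in> {C'}})"
        using x by (intro UN_I[of "(x w, x w')"]) auto
    qed auto
    moreover have "finite {(C, C') \<in> topspace (?Y w) \<times> topspace (?Y w'). C' \<subseteq> C}"
      using finite_cosets[OF w(1)] finite_cosets[OF w(2)]
      by (intro finite_subset[OF _ finite_cartesian_product[of "topspace (?Y w)" "topspace (?Y w')"]]) auto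
    ultimately show ?thesis using cl w by (auto intro!: closedin_Union closedin_Int)
  qed
  then have "closedin ?P (topspace ?P \<inter> (\<Inter>(w, w')\<in>?R. {x \<in> topspace ?P. x w' \<subseteq> x w}))"
  proof (intro closedin_Int closedin_topspace closedin_INT)
    \<comment> \<open>The intersection rule asks for a nonempty family.\<close>
    have "(1, 1) \<in> ?R" unfolding rat_dvd_def by (auto intro: exI[of _ 1])
    then show "?R \<noteq> {}" by blast
  qed auto
  moreover have "topspace ?P \<inter> (\<Inter>(w, w')\<in>?R. {x \<in> topspace ?P. x w' \<subseteq> x w}) = BE_points"
  proof (rule Set.set_eqI)
    fix x
    show "x \<in> topspace ?P \<inter> (\<Inter>(w, w')\<in>?R. {x \<in> topspace ?P. x w' \<subseteq> x w}) \<longleftrightarrow> x \<in> BE_points"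
      unfolding BE_points_eq top
      by (cases "x \<in> (\<Pi>\<^sub>E w\<in>?I. (\<lambda>u. pcoset u w) ` int_plus_pideal w)") (simp_all add: case_prod_unfold)
  qed
  ultimately have "compactin ?P BE_points" using closedin_compact_space[OF comp] by simp
  then show ?thesis unfolding BE_X_def by (simp add: compact_space_subtopology)
qed

lemma closedin_BE_D:
  assumes "w \<noteq> 0"
  shows "closedin BE_X (BE_D (a, w))"
proof -
  let ?Y = "(\<lambda>u. pcoset u w) ` int_plus_pideal w"
  have "closedin BE_X {x \<in> topspace BE_X. x w \<in> {pcoset a w} \<inter> ?Y}"
    by (rule closedin_continuous_map_preimage[OF BE_continuous_proj[OF assms]]) auto
  moreover have "{x \<in> topspace BE_X. x w \<in> {pcoset a w} \<inter> ?Y} = BE_D (a, w)"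
    using assms by (auto simp: topspace_BE_X BE_D_def BE_points_def)
  ultimately show ?thesis by simp
qed

section \<open>Small residue classes moved off themselves\<close>

interpretation BE_HC: clopen_partial_action BE_HG BE_X BE_D BE_\<theta>
proof
  show "closedin BE_X (BE_D t)" if "t \<in> carrier BE_HG" for t
    using that by (cases t) (simp add: BE_H_def closedin_BE_D)
qed (rule compact_BE_X)

text \<open>If z and u + w z both had residue k modulo m, then u + (w - 1) k would lie in m (Z + w
  Z). After multiplication by the denominator b it would be a multiple of m, yet it is nonzero and
  smaller than m.\<close>

lemma BE_moved_off:
  assumes w: "w > 0" "w = of_int a / of_int b" "b > 0" and m: "m > 0"
    and nz: "u + (w - 1) * of_int k \<noteq> 0"
    and small: "\<bar>of_int b * (u + (w - 1) * of_int k)\<bar> < of_int m"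
    and z: "z \<in> BE_D (of_int k, of_int m)"
  shows "BE_\<theta> (u, w) z \<notin> BE_D (of_int k, of_int m)"
proof
  assume y: "BE_\<theta> (u, w) z \<in> BE_D (of_int k, of_int m)"
  let ?k = "rat_of_int k" and ?m = "rat_of_int m"
  have zp: "z \<in> BE_points" "z ?m = pcoset ?k ?m" using z by (auto simp: BE_D_def)
  have nzs: "?m \<noteq> 0" "inverse w * ?m \<noteq> 0" using m w by auto
  \<comment> \<open>The coordinates at m and at m/w are both needed; at a common multiple r one
    representative v describes both.\<close>
  obtain r where r: "r \<noteq> 0" "rat_dvd ?m r" "rat_dvd (inverse w * ?m) r" using rat_common_multiple[OF nzs] .
  obtain v where v: "z r = pcoset v r" using BE_points_coset[OF zp(1) r(1)] by metis
  have "pcoset v ?m = pcoset ?k ?m" using BE_points_dvd[OF zp(1) nzs(1) r(1,2) v] zp(2) by simp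
  then obtain i where i: "v - ?k = ?m * of_int i" by (auto simp: pcoset_eq_iff pideal_iff)
  have "z (inverse w * ?m) = pcoset v (inverse w * ?m)" by (rule BE_points_dvd[OF zp(1) nzs(2) r(1,3) v])
  then have "BE_\<theta> (u, w) z ?m = pcoset (u + w * v) ?m"
    using affine_pcoset[of w u v ?m] w nzs by (simp add: BE_\<theta>_def)
  then have "pcoset (u + w * v) ?m = pcoset ?k ?m" using y by (simp add: BE_D_def)
  then obtain j where j: "u + w * v - ?k = ?m * of_int j" by (auto simp: pcoset_eq_iff pideal_iff)
  have "u + (w - 1) * ?k = (u + w * v - ?k) - w * (v - ?k)" by (simp add: algebra_simps)
  also have "\<dots> = ?m * of_int j - w * (?m * of_int i)" unfolding i j ..
  finally have "of_int b * (u + (w - 1) * ?k) = of_int b * (?m * of_int j - w * (?m * of_int i))" by simp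
  also have "\<dots> = of_int b * (?m * of_int j) - (of_int b * w) * (?m * of_int i)"
    by (simp add: algebra_simps)
  also have "of_int b * w = of_int a" using w by simp
  finally have eq: "of_int b * (u + (w - 1) * ?k) = ?m * of_int (b * j - a * i)" by (simp add: algebra_simps)
  have "b * j - a * i \<noteq> 0"
  proof
    assume "b * j - a * i = 0"
    then have "of_int b * (u + (w - 1) * ?k) = 0" unfolding eq by simp
    then show False using nz w by simp
  qed
  then have "1 \<le> \<bar>rat_of_int (b * j - a * i)\<bar>" by linarith
  then have "?m * 1 \<le> ?m * \<bar>rat_of_int (b * j - a * i)\<bar>" using m by (intro mult_left_mono) auto
  then have "?m \<le> \<bar>of_int b * (u + (w - 1) * ?k)\<bar>" unfolding eq using m by (simp add: abs_mult)
  then show False using small by simp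
qed

lemma BE_contracting:
  assumes F: "finite F" "F \<subseteq> carrier BE_HG - {\<one>\<^bsub>BE_HG\<^esub>}" and U: "openin BE_X U" "U \<noteq> {}"
  shows "\<exists>g\<in>carrier BE_HG. BE_D (inv\<^bsub>BE_HG\<^esub> g) = topspace BE_X \<and> BE_D g \<subseteq> U \<and>
    (\<forall>t\<in>F. \<forall>y\<in>BE_D g \<inter> BE_D t. BE_\<theta> (inv\<^bsub>BE_HG\<^esub> t) y \<notin> BE_D g)"
proof -
  obtain x where "x \<in> U" using U by blast
  then obtain k0 m0 where m0: "m0 > 0" "BE_D (of_int k0, of_int m0) \<subseteq> U"
    using BE_basis[OF U(1)] by metis
  \<comment> \<open>Fixed points of the maps x to u + w x. For w = 1 the quotient is 0 by
    convention, but then u is nonzero and a translation has no fixed point.\<close>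
  let ?bad = "(\<lambda>(u, w). u / (1 - w)) ` F"
  have "infinite ((\<lambda>j. rat_of_int (k0 + m0 * j)) ` UNIV)"
    using m0 by (subst finite_image_iff) (auto simp: inj_on_def)
  then obtain j where j: "rat_of_int (k0 + m0 * j) \<notin> ?bad"
    using F(1) by (meson finite_imageI finite_subset image_subset_iff)
  define k where "k = k0 + m0 * j"
  \<comment> \<open>The number that \<open>BE_moved_off\<close> compares with the modulus, with the
    denominator of w in front. It depends on k and not on m, so m can be chosen after k.\<close>
  define c where "c = (\<lambda>(u, w). of_int (snd (quotient_of w)) * (u + (w - 1) * rat_of_int k) :: rat)"
  have "\<exists>N. \<forall>t\<in>F. \<bar>c t\<bar> < rat_of_int N"
  proof -
    obtain N where "Max (insert 0 ((\<lambda>t. \<bar>c t\<bar>) ` F)) < rat_of_int N" using ex_less_of_int by blast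
    then show ?thesis using F(1) by auto
  qed
  then obtain N where N: "\<And>t. t \<in> F \<Longrightarrow> \<bar>c t\<bar> < rat_of_int N" by blast
  \<comment> \<open>A multiple of m0 stays inside \<open>U\<close>, the factor N dominates all the
    shifts, and the maximum with 1 keeps m positive.\<close>
  define m where "m = m0 * max 1 N"
  have m: "m > 0" "N \<le> m" "m0 dvd m"
  proof -
    show "m > 0" using m0 by (simp add: m_def)
    have "1 * max 1 N \<le> m0 * max 1 N" using m0 by (intro mult_right_mono) auto
    then show "N \<le> m" by (simp add: m_def)
  qed (simp add: m_def)
  let ?g = "(rat_of_int k, rat_of_int m)"
  have "BE_D ?g \<subseteq> BE_D (of_int k0, of_int m0)" using m m0 by (intro BE_D_mono) (auto simp: k_def)
  moreover have "BE_\<theta> (inv\<^bsub>BE_HG\<^esub> t) y \<notin> BE_D ?g" if t: "t \<in> F" and y: "y \<in> BE_D ?g \<inter> BE_D t" for t y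
  proof
    assume z: "BE_\<theta> (inv\<^bsub>BE_HG\<^esub> t) y \<in> BE_D ?g"
    obtain u w where uw: "t = (u, w)" by (cases t)
    have tG: "t \<in> carrier BE_HG" and t1: "t \<noteq> (0, 1)" using t F(2) by (auto simp: BE_HG_simps)
    then have w: "w > 0" by (simp add: uw BE_H_def)
    \<comment> \<open>If \<open>inv t\<close> sent y back into the class, then t would map the
      image, a point of the class, to y in the class.\<close>
    have "BE_\<theta> t (BE_\<theta> (inv\<^bsub>BE_HG\<^esub> t) y) = y" using BE_HC.act_inv'(2)[OF tG] y by blast
    then have mem: "BE_\<theta> (u, w) (BE_\<theta> (inv\<^bsub>BE_HG\<^esub> t) y) \<in> BE_D ?g" using y by (simp add: uw)
    obtain a b where ab: "quotient_of w = (a, b)" by fastforce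
    have nz: "u + (w - 1) * of_int k \<noteq> 0"
    proof
      assume 0: "u + (w - 1) * of_int k = 0"
      show False
      proof (cases "w = 1")
        case False
        then have "of_int k = u / (1 - w)" using 0 by (simp add: field_simps)
        then show False using j t uw by (force simp: k_def)
      qed (use 0 t1 uw in auto)
    qed
    have "\<bar>of_int b * (u + (w - 1) * of_int k)\<bar> < rat_of_int m"
      using N[OF t] m(2) by (simp add: c_def uw ab)
    from BE_moved_off[OF w quotient_of_div[OF ab] quotient_of_denom_pos[OF ab] m(1) nz this z] mem
    show False by blast
  qed
  moreover have "?g \<in> carrier BE_HG" using m(1) by (simp add: BE_H_def)
  ultimately show ?thesis using BE_D_inv_full[OF m(1), of k] m0(2) by blast
qed

section \<open>Paradoxical decompositions and the conclusion\<close>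

lemma BE_D_nonempty:
  assumes "m \<noteq> 0"
  shows "BE_D (of_int k, of_int m) \<noteq> {}"
  using const_in_BE_points[of k] assms by (auto simp: BE_D_def)

text \<open>Two maps of the form \<open>x \<mapsto> k + 2 m x\<close> already embed \<open>X\<close> disjointly into a basic open set, so
  the pieces can all be taken equal to \<open>V\<close>.\<close>

lemma BE_paradoxical:
  assumes V: "openin BE_X V" "V \<noteq> {}"
  shows "BE_H.paradoxical V"
proof -
  obtain x where "x \<in> V" using V by blast
  then obtain k m where m: "m > 0" "BE_D (of_int k, of_int m) \<subseteq> V"
    using BE_basis[OF V(1)] by metis
  \<comment> \<open>The class of k modulo m is the disjoint union of the classes of k and k + m
    modulo 2 m, one for each copy of V.\<close>
  define t where "t = (\<lambda>i::nat. (rat_of_int (if i = 1 then k else k + m), rat_of_int (2 * m)))"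
  have tG: "t i \<in> carrier BE_HG" for i using m by (simp add: t_def BE_H_def)
  have full: "BE_D (inv\<^bsub>BE_HG\<^esub> (t i)) = topspace BE_X" for i
    unfolding t_def using m by (intro BE_D_inv_full) simp
  have Vtop: "V \<subseteq> topspace BE_X" using openin_subset[OF V(1)] .
  have im: "BE_\<theta> (t i) ` V \<subseteq> BE_D (t i)" for i
    using BE_HC.act_closed[OF tG, of _ i] Vtop full by blast
  have sub: "BE_D (t i) \<subseteq> V" for i
  proof -
    have "BE_D (t i) \<subseteq> BE_D (of_int k, of_int m)" unfolding t_def using m by (intro BE_D_mono) auto
    then show ?thesis using m(2) by blast
  qed
  have imV: "BE_\<theta> (t i) ` V \<subseteq> V" for i using im[of i] sub[of i] by (rule order_trans)
  have disj: "BE_D (t i) \<inter> BE_D (t j) = {}" if "i \<in> {1..2}" "j \<in> {1..2}" "i \<noteq> j" for i j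
  proof -
    have "\<not> 2 * m dvd m" "\<not> 2 * m dvd - m" using m zdvd_imp_le[of "2 * m" m] by auto
    then show ?thesis using that m BE_D_disjoint[of "2 * m" "k + m" k] BE_D_disjoint[of "2 * m" k "k + m"]
      by (auto simp: t_def)
  qed
  have "\<forall>k\<in>{1..2}. \<forall>l\<in>{1..2}. k \<noteq> l \<longrightarrow> BE_\<theta> (t k) ` V \<inter> BE_\<theta> (t l) ` V = {}"
    using disj im by blast
  then show ?thesis unfolding BE_H.paradoxical_def using V Vtop tG full imV
    by (intro conjI exI[of _ "1::nat"] exI[of _ "\<lambda>_. V"] exI[of _ t]) (auto simp: numeral_2_eq_2)
qed

theorem corollary5p7:
  shows "(\<forall>V. V \<noteq> {} \<and> compactin BE_X V \<and> openin BE_X V \<longrightarrow> BE_H.paradoxical V) \<and>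
         purely_infinite BE_H.reduced_crossed_product"
proof (intro conjI allI impI)
  fix V assume "V \<noteq> {} \<and> compactin BE_X V \<and> openin BE_X V"
  then have V: "openin BE_X V" "V \<noteq> {}" by simp_all
  show "BE_H.paradoxical V" by (rule BE_paradoxical[OF V])
next
  show "purely_infinite BE_H.reduced_crossed_product"
  \<comment> \<open>The two residue classes modulo 2 serve as disjoint nonempty open sets.\<close>
  proof (rule BE_HC.purely_infinite_reduced_crossed_product[where U = "BE_D (1, 2)" and V = "BE_D (0, 2)"])
    fix F U assume FU: "finite F" "F \<subseteq> carrier BE_HG - {\<one>\<^bsub>BE_HG\<^esub>}" "openin BE_X U" "U \<noteq> {}"
    show "\<exists>g\<in>carrier BE_HG. BE_D (inv\<^bsub>BE_HG\<^esub> g) = topspace BE_X \<and> BE_D g \<subseteq> U \<and>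
      (\<forall>t\<in>F. \<forall>y\<in>BE_D g \<inter> BE_D t. BE_\<theta> (inv\<^bsub>BE_HG\<^esub> t) y \<notin> BE_D g)"
      by (rule BE_contracting[OF FU])
  next
    show "openin BE_X (BE_D (1, 2))" "openin BE_X (BE_D (0, 2))" by (simp_all add: openin_BE_D)
    show "BE_D (1, 2) \<noteq> {}" "BE_D (0, 2) \<noteq> {}"
      using BE_D_nonempty[of 2 1] BE_D_nonempty[of 2 0] by simp_all
    show "BE_D (1, 2) \<inter> BE_D (0, 2) = {}" using BE_D_disjoint[of 2 1 0] by simp
  qed
qed

end
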